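(* There is a constant $c$ and an algorithm which takes as input a connected universally signable graph $G$ with $n$ vertices and $m$ edges, runs in time $O(n+m)$, and outputs a graph $H$ such that $V(H)=V(G)$, the tree-width of $H$ is at most two, and $|d_G(u,v)-d_H(u,v)|\leq c$ for all $u,v\in V(G)$.
   Context: All graphs are finite, undirected, unweighted and simple. For a graph $X$, $d_X(u,v)$ is the length of a shortest $(u,v)$-path in $X$. The constant $c$ does not depend on $G$. A hole is an induced cycle of length at least four. A graph is universally signable if and only if it contains no theta, pyramid, prism or wheel as an induced subgraph, where: a prism is a graph made of three vertex-disjoint induced paths $P_i=a_i\ldots b_i$ ($i=1,2,3$) of lengths at least 1 such that $a_1a_2a_3$ and $b_1b_2b_3$ are triangles and there are no edges between the paths except those of the two triangles; a pyramid is a graph made of three induced paths $P_i=a\ldots b_i$ ($i=1,2,3$), pairwise vertex-disjoint except at $a$, at least two of which have length at least two, such that $b_1b_2b_3$ is a triangle and there are no edges between the paths except those of the triangle and the three edges incident to $a$; a theta is a graph made of three internally vertex-disjoint induced $(a,b)$-paths of lengths at least two with no edges between the paths except the three edges incident to $a$ and the three edges incident to $b$; a wheel consists of a hole together with a vertex (outside the hole) having at least three neighbours on the hole. *)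

theory Defs
  imports Main "HOL-Library.Extended_Nat"
begin

section \<open>Graphs\<close>

record 'a ugraph =
  verts :: "'a set"
  edges :: "'a set set"

definition simple_graph :: "'a ugraph \<Rightarrow> bool" where
  "simple_graph G \<longleftrightarrow> finite (verts G) \<and> (\<forall>e\<in>edges G. e \<subseteq> verts G \<and> card e = 2)"

definition adjacent :: "'a ugraph \<Rightarrow> 'a \<Rightarrow> 'a \<Rightarrow> bool" where
  "adjacent G u v \<longleftrightarrow> {u, v} \<in> edges G"

definition induced_subgraph :: "'a ugraph \<Rightarrow> 'a set \<Rightarrow> 'a ugraph" where
  "induced_subgraph G S = \<lparr> verts = verts G \<inter> S, edges = {e \<in> edges G. e \<subseteq> S} \<rparr>"

text \<open>A path or cycle is given by its list of vertices; a path \<open>p\<close> has length \<open>length p - 1\<close>,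
  a cycle \<open>c\<close> has length \<open>length c\<close>.\<close>

definition is_path :: "'a ugraph \<Rightarrow> 'a list \<Rightarrow> bool" where
  "is_path G p \<longleftrightarrow> p \<noteq> [] \<and> distinct p \<and> set p \<subseteq> verts G \<and>
     (\<forall>i. Suc i < length p \<longrightarrow> adjacent G (p ! i) (p ! Suc i))"

definition is_path_between :: "'a ugraph \<Rightarrow> 'a \<Rightarrow> 'a list \<Rightarrow> 'a \<Rightarrow> bool" where
  "is_path_between G u p v \<longleftrightarrow> is_path G p \<and> hd p = u \<and> last p = v"

definition induced_path :: "'a ugraph \<Rightarrow> 'a list \<Rightarrow> bool" where
  "induced_path G p \<longleftrightarrow> is_path G p \<and>
     (\<forall>i<length p. \<forall>j<length p. adjacent G (p ! i) (p ! j) \<longrightarrow> j = Suc i \<or> i = Suc j)"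

definition is_cycle :: "'a ugraph \<Rightarrow> 'a list \<Rightarrow> bool" where
  "is_cycle G c \<longleftrightarrow> 3 \<le> length c \<and> distinct c \<and> set c \<subseteq> verts G \<and>
     (\<forall>i<length c. adjacent G (c ! i) (c ! (Suc i mod length c)))"

definition hole :: "'a ugraph \<Rightarrow> 'a list \<Rightarrow> bool" where
  "hole G c \<longleftrightarrow> is_cycle G c \<and> 4 \<le> length c \<and>
     (\<forall>i<length c. \<forall>j<length c. adjacent G (c ! i) (c ! j) \<longrightarrow>
        j = Suc i mod length c \<or> i = Suc j mod length c)"

definition connected_graph :: "'a ugraph \<Rightarrow> bool" where
  "connected_graph G \<longleftrightarrow> verts G \<noteq> {} \<and>
     (\<forall>u\<in>verts G. \<forall>v\<in>verts G. \<exists>p. is_path_between G u p v)"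

text \<open>The distance is \<open>\<infinity>\<close> if there is no path.\<close>

definition graph_dist :: "'a ugraph \<Rightarrow> 'a \<Rightarrow> 'a \<Rightarrow> enat" where
  "graph_dist G u v = (INF p\<in>{p. is_path_between G u p v}. enat (length p - 1))"


section \<open>Tree-width\<close>

definition is_tree :: "'a ugraph \<Rightarrow> bool" where
  "is_tree T \<longleftrightarrow> simple_graph T \<and> connected_graph T \<and> (\<nexists>c. is_cycle T c)"

definition tree_decomposition :: "'a ugraph \<Rightarrow> 'b ugraph \<Rightarrow> ('b \<Rightarrow> 'a set) \<Rightarrow> bool" where
  "tree_decomposition G T bag \<longleftrightarrow> is_tree T \<and>
     (\<Union>t\<in>verts T. bag t) = verts G \<and>
     (\<forall>e\<in>edges G. \<exists>t\<in>verts T. e \<subseteq> bag t) \<and>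
     (\<forall>v\<in>verts G. connected_graph (induced_subgraph T {t \<in> verts T. v \<in> bag t}))"

definition decomposition_width :: "'b ugraph \<Rightarrow> ('b \<Rightarrow> 'a set) \<Rightarrow> nat" where
  "decomposition_width T bag = Max ((\<lambda>t. card (bag t)) ` verts T) - 1"

text \<open>Decomposition trees are finite, so taking their nodes in \<^typ>\<open>nat\<close> is no restriction.\<close>

definition tree_width :: "'a ugraph \<Rightarrow> nat" where
  "tree_width G = (LEAST w. \<exists>(T :: nat ugraph) bag.
     tree_decomposition G T bag \<and> decomposition_width T bag = w)"


section \<open>Universally signable graphs\<close>

text \<open>In the first three definitions \<open>P 0\<close>, \<open>P 1\<close>, \<open>P 2\<close> are the three paths.
  The stated adjacencies are the only ones between different paths.\<close>

definition is_prism :: "'a ugraph \<Rightarrow> bool" where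
  "is_prism X \<longleftrightarrow> (\<exists>P :: nat \<Rightarrow> 'a list.
     (\<forall>i<3. induced_path X (P i) \<and> 2 \<le> length (P i)) \<and>
     (\<forall>i<3. \<forall>j<3. i \<noteq> j \<longrightarrow>
        set (P i) \<inter> set (P j) = {} \<and>
        (\<forall>x\<in>set (P i). \<forall>y\<in>set (P j).
           adjacent X x y \<longleftrightarrow>
             x = hd (P i) \<and> y = hd (P j) \<or> x = last (P i) \<and> y = last (P j))) \<and>
     verts X = (\<Union>i<3. set (P i)))"

definition is_pyramid :: "'a ugraph \<Rightarrow> bool" where
  "is_pyramid X \<longleftrightarrow> (\<exists>(P :: nat \<Rightarrow> 'a list) a.
     (\<forall>i<3. induced_path X (P i) \<and> hd (P i) = a \<and> 2 \<le> length (P i)) \<and>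
     2 \<le> card {i. i < 3 \<and> 3 \<le> length (P i)} \<and>
     (\<forall>i<3. \<forall>j<3. i \<noteq> j \<longrightarrow>
        set (P i) \<inter> set (P j) = {a} \<and>
        (\<forall>x\<in>set (P i) - {a}. \<forall>y\<in>set (P j) - {a}.
           adjacent X x y \<longleftrightarrow> x = last (P i) \<and> y = last (P j))) \<and>
     verts X = (\<Union>i<3. set (P i)))"

definition is_theta :: "'a ugraph \<Rightarrow> bool" where
  "is_theta X \<longleftrightarrow> (\<exists>(P :: nat \<Rightarrow> 'a list) a b.
     (\<forall>i<3. induced_path X (P i) \<and> hd (P i) = a \<and> last (P i) = b \<and> 3 \<le> length (P i)) \<and>
     (\<forall>i<3. \<forall>j<3. i \<noteq> j \<longrightarrow>
        set (P i) \<inter> set (P j) = {a, b} \<and>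
        (\<forall>x\<in>set (P i) - {a, b}. \<forall>y\<in>set (P j) - {a, b}. \<not> adjacent X x y)) \<and>
     verts X = (\<Union>i<3. set (P i)))"

definition is_wheel :: "'a ugraph \<Rightarrow> bool" where
  "is_wheel X \<longleftrightarrow> (\<exists>c v. hole X c \<and> v \<notin> set c \<and>
     3 \<le> card {x \<in> set c. adjacent X v x} \<and> verts X = insert v (set c))"

definition universally_signable :: "'a ugraph \<Rightarrow> bool" where
  "universally_signable G \<longleftrightarrow> simple_graph G \<and>
     \<not> (\<exists>S\<subseteq>verts G. let X = induced_subgraph G S in
          is_theta X \<or> is_pyramid X \<or> is_prism X \<or> is_wheel X)"


section \<open>Random access machine programs\<close>

text \<open>An algorithm is a program for a random access machine whose memory consists of scalar
  registers and arrays, all holding natural numbers. Register and array names are fixed in the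
  program text, so each program uses finitely many of them. The arithmetic operations are
  successor and truncated subtraction, whence after \<open>t\<close> steps all values are at most linear in \<open>t\<close>
  plus the largest input number: the unit-cost measure cannot be abused by computing with huge
  numbers.\<close>

datatype aexp =
    Const nat
  | Reg nat
  | Get nat aexp  \<comment> \<open>array name, index\<close>
  | Succ aexp
  | Minus aexp aexp

datatype bexp =
    Less aexp aexp
  | Equal aexp aexp
  | Neg bexp
  | Conj bexp bexp

datatype com =
    Skip
  | Assign nat aexp
  | Put nat aexp aexp  \<comment> \<open>array name, index, new value\<close>
  | Seq com com
  | Cond bexp com com
  | While bexp com

record ram_state =
  regs :: "nat \<Rightarrow> nat"
  arrs :: "nat \<Rightarrow> nat \<Rightarrow> nat"

primrec aval :: "aexp \<Rightarrow> ram_state \<Rightarrow> nat" where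
  "aval (Const k) s = k"
| "aval (Reg x) s = regs s x"
| "aval (Get a e) s = arrs s a (aval e s)"
| "aval (Succ e) s = Suc (aval e s)"
| "aval (Minus e f) s = aval e s - aval f s"

primrec bval :: "bexp \<Rightarrow> ram_state \<Rightarrow> bool" where
  "bval (Less e f) s \<longleftrightarrow> aval e s < aval f s"
| "bval (Equal e f) s \<longleftrightarrow> aval e s = aval f s"
| "bval (Neg b) s \<longleftrightarrow> \<not> bval b s"
| "bval (Conj b c) s \<longleftrightarrow> bval b s \<and> bval c s"

text \<open>\<open>exec P s t s'\<close>: started in \<open>s\<close>, the program \<open>P\<close> halts in \<open>s'\<close> after \<open>t\<close> steps. Every
  assignment and every test counts as one step; the expressions occurring in a fixed program have
  bounded size, so charging for each operation in them would only change constant factors.\<close>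

inductive exec :: "com \<Rightarrow> ram_state \<Rightarrow> nat \<Rightarrow> ram_state \<Rightarrow> bool" where
  Skip: "exec Skip s 1 s"
| Assign: "exec (Assign x e) s 1 (s\<lparr>regs := (regs s)(x := aval e s)\<rparr>)"
| Put: "exec (Put a i e) s 1
    (s\<lparr>arrs := (arrs s)(a := (arrs s a)(aval i s := aval e s))\<rparr>)"
| Seq: "exec P s t s' \<Longrightarrow> exec Q s' u s'' \<Longrightarrow> exec (Seq P Q) s (t + u) s''"
| CondTrue: "bval b s \<Longrightarrow> exec P s t s' \<Longrightarrow> exec (Cond b P Q) s (1 + t) s'"
| CondFalse: "\<not> bval b s \<Longrightarrow> exec Q s t s' \<Longrightarrow> exec (Cond b P Q) s (1 + t) s'"
| WhileFalse: "\<not> bval b s \<Longrightarrow> exec (While b P) s 1 s"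
| WhileTrue: "bval b s \<Longrightarrow> exec P s t s' \<Longrightarrow> exec (While b P) s' u s'' \<Longrightarrow>
    exec (While b P) s (1 + t + u) s''"

inductive_cases Skip_exec: "exec Skip s t s'"
inductive_cases Assign_exec: "exec (Assign x e) s t s'"
inductive_cases Put_exec: "exec (Put a i e) s t s'"
inductive_cases Seq_exec: "exec (Seq P Q) s t s'"
inductive_cases Cond_exec: "exec (Cond b P Q) s t s'"
inductive_cases While_exec: "exec (While b P) s t s'"

lemma exec_deterministic:
  "exec P s t s' \<Longrightarrow> exec P s u s'' \<Longrightarrow> u = t \<and> s'' = s'"
proof (induction arbitrary: u s'' rule: exec.induct)
  case (Skip s)
  from Skip.prems show ?case by (rule Skip_exec) simp
next
  case (Assign x e s)
  from Assign.prems show ?case by (rule Assign_exec) simp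
next
  case (Put a i e s)
  from Put.prems show ?case by (rule Put_exec) simp
next
  case (Seq P s t s' Q t' s2)
  from Seq.prems obtain v w r where "u = v + w" "exec P s v r" "exec Q r w s''"
    by (rule Seq_exec)
  with Seq.IH(1)[of v r] Seq.IH(2)[of w s''] show ?case by simp
next
  case (CondTrue b s P t s' Q)
  from CondTrue.prems CondTrue.hyps(1) obtain v where "u = 1 + v" "exec P s v s''"
    by (auto elim: Cond_exec)
  with CondTrue.IH[of v s''] show ?case by simp
next
  case (CondFalse b s Q t s' P)
  from CondFalse.prems CondFalse.hyps(1) obtain v where "u = 1 + v" "exec Q s v s''"
    by (auto elim: Cond_exec)
  with CondFalse.IH[of v s''] show ?case by simp
next
  case (WhileFalse b s P)
  then show ?case by (auto elim: While_exec)
next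
  case (WhileTrue b s P t s' t' s2)
  from WhileTrue.prems obtain v w r
    where "u = 1 + v + w" "exec P s v r" "exec (While b P) r w s''"
    by (rule While_exec) (use WhileTrue.hyps(1) in simp_all)
  with WhileTrue.IH(1)[of v r] WhileTrue.IH(2)[of w s''] show ?case by simp
qed


section \<open>Input and output of graphs\<close>

text \<open>The vertices of an input graph are numbered \<open>0, \<dots>, n - 1\<close>; \<open>adj ! v\<close> lists the
  neighbours of \<open>v\<close>, in any order.\<close>

definition adjacency_lists :: "nat ugraph \<Rightarrow> nat list list \<Rightarrow> bool" where
  "adjacency_lists G adj \<longleftrightarrow> verts G = {..<length adj} \<and>
     (\<forall>v<length adj. distinct (adj ! v) \<and> set (adj ! v) = {u \<in> verts G. adjacent G v u})"

definition array_of :: "nat list \<Rightarrow> nat \<Rightarrow> nat" where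
  "array_of xs i = (if i < length xs then xs ! i else 0)"

text \<open>Initially register 0 holds \<open>n\<close>, array 1 holds the concatenation of the adjacency lists, and
  the list of \<open>v\<close> occupies the positions from \<open>arrs s 0 v\<close> to \<open>arrs s 0 (v + 1) - 1\<close> of it. Everything
  else is zero.\<close>

definition input_state :: "nat list list \<Rightarrow> ram_state" where
  "input_state adj =
     \<lparr> regs = (\<lambda>_. 0)(0 := length adj),
       arrs = (\<lambda>_ _. 0)
         (0 := array_of (map (\<lambda>v. length (concat (take v adj))) [0..<Suc (length adj)]),
          1 := array_of (concat adj)) \<rparr>"

text \<open>The output graph is read off as an edge list: register 0 holds the number of vertices,
  register 1 the length of the edge list, and arrays 2 and 3 hold the ends of the edges.\<close>

definition output_graph :: "ram_state \<Rightarrow> nat ugraph" where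
  "output_graph s =
     \<lparr> verts = {..<regs s 0},
       edges = {{arrs s 2 i, arrs s 3 i} | i. i < regs s 1} \<rparr>"

end

theory Submission
  imports Defs
begin

text \<open>Run a breadth-first search from vertex 0, and call the vertices of a layer that are connected through
  this and the higher layers a cluster. The lower neighbours of a cluster form a minimal separator, and in a
  universally signable graph this is a clique or a pair of nonadjacent vertices: otherwise a shortest path
  attaching to two nonadjacent vertices of a hole would yield a theta, pyramid, prism or wheel. Hence a
  cluster either has bounded diameter or falls into two parts, one above each of two lower neighbours.
  Contracting each such part to a representative, and hanging the other vertices as leaves below, gives a
  graph of tree-width at most two, because the representatives of a cluster have all their lower neighbours
  among the at most two representatives of the cluster below. Contraction increases distances by at
  most a constant. Conversely, shortest walks between representatives go down, up, down and up, since between two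
  peaks there would be a shortcut, and each descending piece lifts to the original graph with constant error.

  The clusters are computed in linear time from the highest layer downwards; since the lower neighbours of a
  cluster form a clique or a pair, it suffices to link two of them.\<close>

section \<open>Minimal separators of universally signable graphs\<close>

text \<open>Contracting each cluster to a single vertex would give a tree, but on a long cycle a
  cluster consists of two vertices that may be arbitrarily far apart. Two representatives are
  therefore needed, told apart by their unique lower neighbour, and this is what raises the width to
  two. The obstacle is that errors must not add up along a descent. A chain of representatives need
  not be a path of \<open>G\<close>. However, walking down along \<open>par\<close> from a fixed
  vertex costs nothing extra and stays in the clusters of the chain, and in a merged cluster one may
  switch from this walk to the chain at cost 5; in the other clusters the parent alone determines
  how the chain goes on. The constant is 50 = 5 + 4 * 10 + 5: both ends move to their
  representatives, and each of the four monotone pieces of a walk has error at most 10. Linear time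
  is possible because one label stands for a whole component of the higher layers once these are
  finished, so the layers above are never searched again.\<close>

lemma adjacent_commute: "adjacent G u v \<longleftrightarrow> adjacent G v u"
  by (simp add: adjacent_def insert_commute)

lemma adjacent_neq: "simple_graph G \<Longrightarrow> adjacent G u v \<Longrightarrow> u \<noteq> v"
  by (force simp: simple_graph_def adjacent_def)

lemma adjacent_verts: "simple_graph G \<Longrightarrow> adjacent G u v \<Longrightarrow> u \<in> verts G \<and> v \<in> verts G"
  by (fastforce simp: simple_graph_def adjacent_def)

section \<open>Induced paths and holes as concatenations of lists\<close>

lemma induced_path_singleton: "simple_graph G \<Longrightarrow> x \<in> verts G \<Longrightarrow> induced_path G [x]"
  by (auto simp: induced_path_def is_path_def dest: adjacent_neq)

text \<open>Cutting an induced path leaves exactly one edge across the cut. Through this equivalence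
  paths are taken apart and reassembled by list operations, without vertex indices.\<close>

lemma induced_path_append:
  assumes "simple_graph G" "xs \<noteq> []" "ys \<noteq> []"
  shows "induced_path G (xs @ ys) \<longleftrightarrow> induced_path G xs \<and> induced_path G ys \<and> set xs \<inter> set ys = {} \<and>
    (\<forall>x\<in>set xs. \<forall>y\<in>set ys. adjacent G x y \<longleftrightarrow> x = last xs \<and> y = hd ys)"
  (is "?L \<longleftrightarrow> ?R")
proof
  assume L: ?L
  let ?m = "length xs"
  have d: "distinct (xs @ ys)" and V: "set (xs @ ys) \<subseteq> verts G"
    and E: "\<And>i. Suc i < length (xs @ ys) \<Longrightarrow> adjacent G ((xs @ ys) ! i) ((xs @ ys) ! Suc i)"
    and I: "\<And>i j. i < length (xs @ ys) \<Longrightarrow> j < length (xs @ ys) \<Longrightarrow>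
        adjacent G ((xs @ ys) ! i) ((xs @ ys) ! j) \<Longrightarrow> j = Suc i \<or> i = Suc j"
    using L unfolding induced_path_def is_path_def by blast+
  have 1: "induced_path G xs"
    unfolding induced_path_def is_path_def
  proof (intro conjI allI impI)
    show "xs \<noteq> []" "distinct xs" "set xs \<subseteq> verts G" using assms d V by auto
    show "adjacent G (xs ! i) (xs ! Suc i)" if "Suc i < length xs" for i
      using E[of i] that by (simp add: nth_append)
    show "j = Suc i \<or> i = Suc j" if "i < length xs" "j < length xs" "adjacent G (xs ! i) (xs ! j)" for i j
      using I[of i j] that by (simp add: nth_append)
  qed
  have 2: "induced_path G ys"
    unfolding induced_path_def is_path_def
  proof (intro conjI allI impI)
    show "ys \<noteq> []" "distinct ys" "set ys \<subseteq> verts G" using assms d V by auto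
    show "adjacent G (ys ! i) (ys ! Suc i)" if "Suc i < length ys" for i
      using E[of "?m + i"] that by (simp add: nth_append)
    show "j = Suc i \<or> i = Suc j" if "i < length ys" "j < length ys" "adjacent G (ys ! i) (ys ! j)" for i j
      using I[of "?m + i" "?m + j"] that by (simp add: nth_append)
  qed
  have 3: "adjacent G x y \<longleftrightarrow> x = last xs \<and> y = hd ys" if xy: "x \<in> set xs" "y \<in> set ys" for x y
  proof
    assume a: "adjacent G x y"
    obtain i j where i: "i < length xs" "x = xs ! i" and j: "j < length ys" "y = ys ! j"
      using xy by (metis in_set_conv_nth)
    have "?m + j = Suc i \<or> i = Suc (?m + j)"
      using I[of i "?m + j"] a i j by (simp add: nth_append)
    then have "Suc i = ?m" "j = 0" using i(1) by auto
    then show "x = last xs \<and> y = hd ys" using i j assms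
      by (metis diff_Suc_1 hd_conv_nth last_conv_nth)
  next
    assume "x = last xs \<and> y = hd ys"
    then show "adjacent G x y" using E[of "?m - 1"] assms
      by (cases ys) (simp_all add: nth_append last_conv_nth hd_conv_nth)
  qed
  from 1 2 3 d show ?R by auto
next
  assume R: ?R
  let ?m = "length xs"
  have ix: "induced_path G xs" and iy: "induced_path G ys" and dis: "set xs \<inter> set ys = {}"
    and cr: "\<And>x y. x \<in> set xs \<Longrightarrow> y \<in> set ys \<Longrightarrow> adjacent G x y \<longleftrightarrow> x = last xs \<and> y = hd ys"
    using R by auto
  have dx: "distinct xs" "distinct ys" "set xs \<subseteq> verts G" "set ys \<subseteq> verts G"
    using ix iy by (auto simp: induced_path_def is_path_def)
  have cross: "Suc i = ?m \<and> j = 0" if "i < ?m" "j < length ys" "adjacent G (xs ! i) (ys ! j)" for i j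
  proof -
    have "xs ! i = last xs \<and> ys ! j = hd ys" using cr that by simp
    then show ?thesis using that dx assms
      by (metis Suc_pred' diff_less hd_conv_nth last_conv_nth length_greater_0_conv
          less_numeral_extra(1) nth_eq_iff_index_eq)
  qed
  show ?L
    unfolding induced_path_def is_path_def
  proof (intro conjI allI impI)
    show "xs @ ys \<noteq> []" "distinct (xs @ ys)" "set (xs @ ys) \<subseteq> verts G" using assms dx dis by auto
    show "adjacent G ((xs @ ys) ! i) ((xs @ ys) ! Suc i)" if l: "Suc i < length (xs @ ys)" for i
    proof -
      consider "Suc i < ?m" | "Suc i = ?m" | "i \<ge> ?m" by linarith
      then show ?thesis
      proof cases
        case 1 then show ?thesis using ix by (simp add: nth_append induced_path_def is_path_def)
      next
        case 2
        then have "xs ! i = last xs" using assms by (metis diff_Suc_1 last_conv_nth)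
        then show ?thesis using 2 cr[of "last xs" "hd ys"] assms l
          by (simp add: nth_append hd_conv_nth)
      next
        case 3 
        then obtain k where "i = ?m + k" using le_Suc_ex by blast
        then show ?thesis using l iy by (simp add: nth_append induced_path_def is_path_def)
      qed
    qed
    show "j = Suc i \<or> i = Suc j" if h: "i < length (xs @ ys)" "j < length (xs @ ys)"
      "adjacent G ((xs @ ys) ! i) ((xs @ ys) ! j)" for i j
    proof (cases "i < ?m"; cases "j < ?m")
      assume "i < ?m" "j < ?m"
      then show ?thesis using h ix by (simp add: nth_append induced_path_def)
    next
      assume "i < ?m" "\<not> j < ?m"
      moreover from this have "j - ?m < length ys" using h by auto
      ultimately show ?thesis using h cross[of i "j - ?m"] by (simp add: nth_append)
    next
      assume "\<not> i < ?m" "j < ?m"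
      moreover from this have "i - ?m < length ys" using h by auto
      ultimately show ?thesis using h cross[of j "i - ?m"]
        by (simp add: nth_append adjacent_commute[of G "xs ! j"])
    next
      assume "\<not> i < ?m" "\<not> j < ?m"
      then obtain k l where "i = ?m + k" "j = ?m + l" by (metis le_Suc_ex not_less)
      then show ?thesis using h iy by (simp add: nth_append induced_path_def)
    qed
  qed
qed

lemma induced_path_rev:
  assumes "simple_graph G" "induced_path G p"
  shows "induced_path G (rev p)"
  using assms(2)
proof (induction p)
  case Nil
  then show ?case by simp
next
  case (Cons x p)
  show ?case
  proof (cases "p = []")
    case True
    then show ?thesis using Cons by simp
  next
    case False
    have "induced_path G ([x] @ p)" using Cons.prems by simp
    then have "induced_path G p" "induced_path G [x]" "x \<notin> set p"
      "\<forall>y\<in>set p. adjacent G x y \<longleftrightarrow> y = hd p"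
      using induced_path_append[OF assms(1), of "[x]" p] False by auto
    then show ?thesis
      using Cons.IH False by (auto simp: induced_path_append[OF assms(1)] last_rev adjacent_commute[of G _ x])
  qed
qed

text \<open>Resolving the wrap-around \<open>mod\<close> into cases makes adjacency on a hole
  accessible to linear arithmetic.\<close>

lemma hole_adjacent_iff:
  assumes "simple_graph G" "hole G c" "i < length c" "j < length c"
  shows "adjacent G (c ! i) (c ! j) \<longleftrightarrow>
    j = Suc i \<or> i = Suc j \<or> i = 0 \<and> Suc j = length c \<or> j = 0 \<and> Suc i = length c"
proof -
  have c: "\<And>i. i < length c \<Longrightarrow> adjacent G (c ! i) (c ! (Suc i mod length c))"
    and h: "adjacent G (c ! i) (c ! j) \<Longrightarrow> j = Suc i mod length c \<or> i = Suc j mod length c"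
    using assms unfolding hole_def is_cycle_def by blast+
  have m: "Suc i mod length c = (if Suc i = length c then 0 else Suc i)" if "i < length c" for i
    using that by auto
  show ?thesis
    using h c[of i] c[of j] assms(3,4) m[of i] m[of j] adjacent_commute[of G "c ! i" "c ! j"]
    by (auto split: if_splits)
qed

text \<open>A cycle cut in two places falls into two paths with two connecting edges. The
  equivalence serves both ways: it reads paths off a hole, and it builds a hole from paths. If a
  part is a singleton, its \<open>hd\<close> and \<open>last\<close> coincide and the two edges meet
  there.\<close>

lemma hole_append:
  assumes "simple_graph G" "xs \<noteq> []" "ys \<noteq> []"
  shows "hole G (xs @ ys) \<longleftrightarrow> 4 \<le> length xs + length ys \<and> induced_path G xs \<and> induced_path G ys \<and>
    set xs \<inter> set ys = {} \<and> (\<forall>x\<in>set xs. \<forall>y\<in>set ys. adjacent G x y \<longleftrightarrow>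
      x = last xs \<and> y = hd ys \<or> x = hd xs \<and> y = last ys)"
  (is "?L \<longleftrightarrow> ?R")
proof
  assume L: ?L
  let ?m = "length xs" and ?c = "xs @ ys"
  note adj = hole_adjacent_iff[OF assms(1) L]
  have len: "4 \<le> length xs + length ys" and d: "distinct ?c" and V: "set ?c \<subseteq> verts G"
    using L by (auto simp: hole_def is_cycle_def)
  have mpos: "0 < ?m" "0 < length ys" using assms by auto
  have 1: "induced_path G xs"
    unfolding induced_path_def is_path_def
  proof (intro conjI allI impI)
    show "xs \<noteq> []" "distinct xs" "set xs \<subseteq> verts G" using assms d V by auto
    show "adjacent G (xs ! i) (xs ! Suc i)" if "Suc i < length xs" for i
      using adj[of i "Suc i"] that by (simp add: nth_append)
    show "j = Suc i \<or> i = Suc j" if "i < length xs" "j < length xs" "adjacent G (xs ! i) (xs ! j)" for i j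
      using adj[of i j] that mpos by (simp add: nth_append)
  qed
  have 2: "induced_path G ys"
    unfolding induced_path_def is_path_def
  proof (intro conjI allI impI)
    show "ys \<noteq> []" "distinct ys" "set ys \<subseteq> verts G" using assms d V by auto
    show "adjacent G (ys ! i) (ys ! Suc i)" if "Suc i < length ys" for i
      using adj[of "?m + i" "?m + Suc i"] that by (simp add: nth_append)
    show "j = Suc i \<or> i = Suc j" if "i < length ys" "j < length ys" "adjacent G (ys ! i) (ys ! j)" for i j
      using adj[of "?m + i" "?m + j"] that mpos by (simp add: nth_append)
  qed
  have 3: "adjacent G x y \<longleftrightarrow> x = last xs \<and> y = hd ys \<or> x = hd xs \<and> y = last ys"
    if xy: "x \<in> set xs" "y \<in> set ys" for x y
  proof -
    obtain i j where i: "i < length xs" "x = xs ! i" and j: "j < length ys" "y = ys ! j"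
      using xy by (metis in_set_conv_nth)
    have "adjacent G x y \<longleftrightarrow> Suc i = ?m \<and> j = 0 \<or> i = 0 \<and> Suc j = length ys"
      using adj[of i "?m + j"] i j by (auto simp add: nth_append)
    moreover have "Suc i = ?m \<longleftrightarrow> x = last xs" "i = 0 \<longleftrightarrow> x = hd xs"
       "Suc j = length ys \<longleftrightarrow> y = last ys" "j = 0 \<longleftrightarrow> y = hd ys"
      using i j d mpos nth_eq_iff_index_eq[of xs i] nth_eq_iff_index_eq[of ys j] assms
      by (auto simp: last_conv_nth hd_conv_nth)
    ultimately show ?thesis by blast
  qed
  from 1 2 3 d len show ?R by auto
next
  assume R: ?R
  let ?m = "length xs" and ?c = "xs @ ys"
  have ix: "induced_path G xs" and iy: "induced_path G ys" and dis: "set xs \<inter> set ys = {}"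
    and cr: "\<And>x y. x \<in> set xs \<Longrightarrow> y \<in> set ys \<Longrightarrow> adjacent G x y \<longleftrightarrow>
        x = last xs \<and> y = hd ys \<or> x = hd xs \<and> y = last ys"
    and len: "4 \<le> length ?c"
    using R by auto
  have dx: "distinct xs" "distinct ys" "set xs \<subseteq> verts G" "set ys \<subseteq> verts G"
    using ix iy by (auto simp: induced_path_def is_path_def)
  have mpos: "0 < ?m" "0 < length ys" using assms by auto
  have cross: "adjacent G (xs ! i) (ys ! j) \<longleftrightarrow> Suc i = ?m \<and> j = 0 \<or> i = 0 \<and> Suc j = length ys"
    if "i < ?m" "j < length ys" for i j
  proof -
    have "Suc i = ?m \<longleftrightarrow> xs ! i = last xs" "i = 0 \<longleftrightarrow> xs ! i = hd xs"
       "Suc j = length ys \<longleftrightarrow> ys ! j = last ys" "j = 0 \<longleftrightarrow> ys ! j = hd ys"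
      using that dx mpos nth_eq_iff_index_eq[of xs i] nth_eq_iff_index_eq[of ys j] assms
      by (auto simp: last_conv_nth hd_conv_nth)
    then show ?thesis using cr[of "xs ! i" "ys ! j"] that by simp
  qed
  have ixa: "adjacent G (xs ! i) (xs ! j) \<longleftrightarrow> j = Suc i \<or> i = Suc j" if "i < ?m" "j < ?m" for i j
    using ix that adjacent_commute[of G "xs ! i" "xs ! j"] by (auto simp: induced_path_def is_path_def)
  have iya: "adjacent G (ys ! i) (ys ! j) \<longleftrightarrow> j = Suc i \<or> i = Suc j" if "i < length ys" "j < length ys" for i j
    using iy that adjacent_commute[of G "ys ! i" "ys ! j"] by (auto simp: induced_path_def is_path_def)
  have adj: "adjacent G (?c ! i) (?c ! j) \<longleftrightarrow>
      j = Suc i \<or> i = Suc j \<or> i = 0 \<and> Suc j = length ?c \<or> j = 0 \<and> Suc i = length ?c"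
    if h: "i < length ?c" "j < length ?c" for i j
  proof (cases "i < ?m"; cases "j < ?m")
    assume "i < ?m" "j < ?m"
    then have "Suc i \<noteq> length ?c" "Suc j \<noteq> length ?c"
      using mpos(2) unfolding length_append by linarith+
    then show ?thesis using ixa[of i j] \<open>i < ?m\<close> \<open>j < ?m\<close> by (simp add: nth_append)
  next
    assume "i < ?m" "\<not> j < ?m"
    then show ?thesis using h cross[of i "j - ?m"] by (auto simp: nth_append)
  next
    assume "\<not> i < ?m" "j < ?m"
    then show ?thesis using h cross[of j "i - ?m"]
      by (auto simp: nth_append adjacent_commute[of G _ "xs ! j"])
  next
    assume ij: "\<not> i < ?m" "\<not> j < ?m"
    then obtain k l where "i = ?m + k" "j = ?m + l" by (metis le_Suc_ex not_less)
    then show ?thesis using h iya[of k l] mpos by (auto simp add: nth_append)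
  qed
  have m: "Suc i mod length ?c = (if Suc i = length ?c then 0 else Suc i)" if "i < length ?c" for i
    using that by auto
  show ?L
    unfolding hole_def is_cycle_def
  proof (intro conjI allI impI)
    show "3 \<le> length ?c" "4 \<le> length ?c" using len by auto
    show "distinct ?c" "set ?c \<subseteq> verts G" using dx dis by auto
    show "adjacent G (?c ! i) (?c ! (Suc i mod length ?c))" if "i < length ?c" for i
    proof -
      have "(if Suc i = length ?c then 0 else Suc i) < length ?c" using that mpos by auto
      then show ?thesis
        unfolding m[OF that] using that adj[of i "if Suc i = length ?c then 0 else Suc i"]
        by (simp del: length_append split: if_splits)
    qed
    show "j = Suc i mod length ?c \<or> i = Suc j mod length ?c"
      if "i < length ?c" "j < length ?c" "adjacent G (?c ! i) (?c ! j)" for i j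
      unfolding m[OF that(1)] m[OF that(2)] using that adj[of i j] by auto
  qed
qed

lemma hole_rotate:
  assumes "simple_graph G" "hole G (xs @ ys)"
  shows "hole G (ys @ xs)"
proof (cases "xs = [] \<or> ys = []")
  case True
  then show ?thesis using assms by auto
next
  case False
  then have "xs \<noteq> []" "ys \<noteq> []" by auto
  note iff = hole_append[OF assms(1)]
  have "\<forall>x\<in>set ys. \<forall>y\<in>set xs. adjacent G x y \<longleftrightarrow> x = last ys \<and> y = hd xs \<or> x = hd ys \<and> y = last xs"
    using assms(2) unfolding iff[OF \<open>xs \<noteq> []\<close> \<open>ys \<noteq> []\<close>] by (metis adjacent_commute)
  then show ?thesis
    using assms(2) unfolding iff[OF \<open>xs \<noteq> []\<close> \<open>ys \<noteq> []\<close>] iff[OF \<open>ys \<noteq> []\<close> \<open>xs \<noteq> []\<close>]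
    by (auto simp: add.commute)
qed

text \<open>With the first vertex held fixed only the remaining path has to be reversed; a rotation
  then moves that vertex to the end.\<close>

lemma hole_rev:
  assumes "simple_graph G" "hole G c"
  shows "hole G (rev c)"
proof -
  obtain x ys where c: "c = [x] @ ys" "ys \<noteq> []"
    using assms by (cases c; cases "tl c") (auto simp: hole_def)
  then have "hole G ([x] @ rev ys)"
    using assms c(2) unfolding c(1)
    by (subst hole_append) (auto simp: hole_append[OF assms(1), of "[x]", simplified] induced_path_rev hd_rev last_rev)
  then have "hole G (rev ys @ [x])" by (rule hole_rotate[OF assms(1)])
  then show ?thesis using c by simp
qed

section \<open>The four obstructions in terms of lists\<close>

lemma induced_path_subgraph:
  "induced_path G p \<Longrightarrow> set p \<subseteq> S \<Longrightarrow> induced_path (induced_subgraph G S) p"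
proof -
  assume a: "induced_path G p" "set p \<subseteq> S"
  have *: "p ! i \<in> S" if "i < length p" for i using a(2) that by auto
  show ?thesis using a * unfolding induced_path_def is_path_def
    by (auto simp: induced_subgraph_def adjacent_def)
qed

lemma adjacent_subgraph:
  "x \<in> S \<Longrightarrow> y \<in> S \<Longrightarrow> adjacent (induced_subgraph G S) x y \<longleftrightarrow> adjacent G x y"
  by (auto simp: induced_subgraph_def adjacent_def)

lemma hole_subgraph:
  "hole G p \<Longrightarrow> set p \<subseteq> S \<Longrightarrow> hole (induced_subgraph G S) p"
proof -
  assume a: "hole G p" "set p \<subseteq> S"
  have *: "p ! i \<in> S" if "i < length p" for i using a(2) that by auto
  have "p ! (Suc i mod length p) \<in> S" if "i < length p" for i by (rule *, rule mod_less_divisor) (use that in linarith)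
  then show ?thesis using a * unfolding hole_def is_cycle_def
    by (auto simp: induced_subgraph_def adjacent_def)
qed

lemma universally_signable_obstruction:
  assumes "universally_signable G" "S \<subseteq> verts G"
    "is_theta (induced_subgraph G S) \<or> is_pyramid (induced_subgraph G S) \<or>
     is_prism (induced_subgraph G S) \<or> is_wheel (induced_subgraph G S)"
  shows False
  using assms unfolding universally_signable_def Let_def by blast

lemma all_less_3: "(\<forall>i<(3::nat). Q i) \<longleftrightarrow> Q 0 \<and> Q 1 \<and> Q 2"
  by (auto simp: numeral_3_eq_3 less_Suc_eq numeral_2_eq_2)

text \<open>The definitions of the obstructions quantify over ordered pairs of indices; for a
  symmetric relation three pairs suffice.\<close>

lemma pairs_less_3:
  assumes "R p q" "R p r" "R q r" and sym: "\<And>x y. R x y \<Longrightarrow> R y x"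
  defines "P \<equiv> (\<lambda>i::nat. if i = 0 then p else if i = 1 then q else r)"
  shows "\<forall>i<3. \<forall>j<3. i \<noteq> j \<longrightarrow> R (P i) (P j)"
  unfolding all_less_3 P_def using assms(1-3)[THEN sym] assms(1-3) by simp

lemma Un_less_3: "(\<Union>i<(3::nat). f i) = f 0 \<union> f 1 \<union> f 2"
  by (auto simp: numeral_3_eq_3 less_Suc_eq numeral_2_eq_2)

lemma induced_path_verts: "induced_path G p \<Longrightarrow> set p \<subseteq> verts G"
  by (simp add: induced_path_def is_path_def)

lemma no_wheel:
  assumes "universally_signable G" "hole G c" "v \<in> verts G" "v \<notin> set c"
    "3 \<le> card {x \<in> set c. adjacent G v x}"
  shows False
proof -
  let ?S = "insert v (set c)" and ?X = "induced_subgraph G (insert v (set c))"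
  have "{x \<in> set c. adjacent ?X v x} = {x \<in> set c. adjacent G v x}"
    by (auto simp: adjacent_subgraph)
  moreover have V: "?S \<subseteq> verts G" using assms(2,3) by (auto simp: hole_def is_cycle_def)
  moreover from V have "verts ?X = ?S" by (auto simp: induced_subgraph_def)
  ultimately have "is_wheel ?X"
    unfolding is_wheel_def using assms hole_subgraph[OF assms(2), of ?S]
    by (intro exI[of _ c] exI[of _ v]) auto
  with V assms(1) show False using universally_signable_obstruction by blast
qed

lemma no_wheel3:
  assumes "universally_signable G" "hole G c" "v \<in> verts G" "v \<notin> set c"
    "x \<in> set c" "y \<in> set c" "z \<in> set c" "x \<noteq> y" "x \<noteq> z" "y \<noteq> z"
    "adjacent G v x" "adjacent G v y" "adjacent G v z"
  shows False
proof -
  have "card {x, y, z} \<le> card {x \<in> set c. adjacent G v x}"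
    using assms by (intro card_mono) auto
  then show False using assms by (intro no_wheel[OF assms(1-4)]) simp
qed

text \<open>The two branch vertices are split off, so that only interiors occur in the conditions of
  disjointness and non-adjacency.\<close>

lemma no_theta:
  assumes us: "universally_signable G"
    and p: "induced_path G (a # ps @ [b])" "induced_path G (a # qs @ [b])" "induced_path G (a # rs @ [b])"
    and ne: "ps \<noteq> []" "qs \<noteq> []" "rs \<noteq> []"
    and dis: "set ps \<inter> set qs = {}" "set ps \<inter> set rs = {}" "set qs \<inter> set rs = {}"
    and anti: "\<And>x y. x \<in> set ps \<Longrightarrow> y \<in> set qs \<Longrightarrow> \<not> adjacent G x y"
      "\<And>x y. x \<in> set ps \<Longrightarrow> y \<in> set rs \<Longrightarrow> \<not> adjacent G x y"
      "\<And>x y. x \<in> set qs \<Longrightarrow> y \<in> set rs \<Longrightarrow> \<not> adjacent G x y"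
  shows False
proof -
  define S where S: "S = {a, b} \<union> set ps \<union> set qs \<union> set rs"
  let ?X = "induced_subgraph G S"
  let ?P = "\<lambda>i::nat. if i = 0 then a # ps @ [b] else if i = 1 then a # qs @ [b] else a # rs @ [b]"
  have V: "S \<subseteq> verts G" unfolding S using p[THEN induced_path_verts] by auto
  have nin: "a \<notin> set ps \<union> set qs \<union> set rs" "b \<notin> set ps \<union> set qs \<union> set rs"
    using p by (auto simp: induced_path_def is_path_def)
  have adj: "adjacent ?X x y \<longleftrightarrow> adjacent G x y" if "x \<in> S" "y \<in> S" for x y
    using that by (rule adjacent_subgraph)
  have sub: "set ps \<subseteq> S" "set qs \<subseteq> S" "set rs \<subseteq> S" unfolding S by auto
  have "is_theta ?X"
    unfolding is_theta_def
  proof (rule exI[of _ ?P], rule exI[of _ a], rule exI[of _ b], intro conjI)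
    show "\<forall>i<3. induced_path ?X (?P i) \<and> hd (?P i) = a \<and> last (?P i) = b \<and> 3 \<le> length (?P i)"
      unfolding all_less_3 using p ne by (auto intro!: induced_path_subgraph simp: S Suc_le_eq)
    show "verts ?X = (\<Union>i<3. set (?P i))"
      unfolding Un_less_3 using V by (auto simp: induced_subgraph_def S)
    show "\<forall>i<3. \<forall>j<3. i \<noteq> j \<longrightarrow> set (?P i) \<inter> set (?P j) = {a, b} \<and>
        (\<forall>x\<in>set (?P i) - {a, b}. \<forall>y\<in>set (?P j) - {a, b}. \<not> adjacent ?X x y)"
    proof (rule pairs_less_3[where R = "\<lambda>p q. set p \<inter> set q = {a, b} \<and>
        (\<forall>x\<in>set p - {a, b}. \<forall>y\<in>set q - {a, b}. \<not> adjacent ?X x y)"])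
      show "set (a # ps @ [b]) \<inter> set (a # qs @ [b]) = {a, b} \<and>
        (\<forall>x\<in>set (a # ps @ [b]) - {a, b}. \<forall>y\<in>set (a # qs @ [b]) - {a, b}. \<not> adjacent ?X x y)"
        using dis nin anti by (auto simp: adj subsetD[OF sub(1)] subsetD[OF sub(2)] subsetD[OF sub(3)])
      show "set (a # ps @ [b]) \<inter> set (a # rs @ [b]) = {a, b} \<and>
        (\<forall>x\<in>set (a # ps @ [b]) - {a, b}. \<forall>y\<in>set (a # rs @ [b]) - {a, b}. \<not> adjacent ?X x y)"
        using dis nin anti by (auto simp: adj subsetD[OF sub(1)] subsetD[OF sub(2)] subsetD[OF sub(3)])
      show "set (a # qs @ [b]) \<inter> set (a # rs @ [b]) = {a, b} \<and>
        (\<forall>x\<in>set (a # qs @ [b]) - {a, b}. \<forall>y\<in>set (a # rs @ [b]) - {a, b}. \<not> adjacent ?X x y)"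
        using dis nin anti by (auto simp: adj subsetD[OF sub(1)] subsetD[OF sub(2)] subsetD[OF sub(3)])
    qed (metis Int_commute adjacent_commute)
  qed
  with V us show False using universally_signable_obstruction by blast
qed

lemma no_prism:
  assumes us: "universally_signable G"
    and p: "induced_path G ps" "induced_path G qs" "induced_path G rs"
    and len: "2 \<le> length ps" "2 \<le> length qs" "2 \<le> length rs"
    and dis: "set ps \<inter> set qs = {}" "set ps \<inter> set rs = {}" "set qs \<inter> set rs = {}"
    and cr: "\<And>x y. x \<in> set ps \<Longrightarrow> y \<in> set qs \<Longrightarrow> adjacent G x y \<longleftrightarrow> x = hd ps \<and> y = hd qs \<or> x = last ps \<and> y = last qs"
      "\<And>x y. x \<in> set ps \<Longrightarrow> y \<in> set rs \<Longrightarrow> adjacent G x y \<longleftrightarrow> x = hd ps \<and> y = hd rs \<or> x = last ps \<and> y = last rs"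
      "\<And>x y. x \<in> set qs \<Longrightarrow> y \<in> set rs \<Longrightarrow> adjacent G x y \<longleftrightarrow> x = hd qs \<and> y = hd rs \<or> x = last qs \<and> y = last rs"
  shows False
proof -
  define S where S: "S = set ps \<union> set qs \<union> set rs"
  let ?X = "induced_subgraph G S"
  let ?P = "\<lambda>i::nat. if i = 0 then ps else if i = 1 then qs else rs"
  have V: "S \<subseteq> verts G" unfolding S using p[THEN induced_path_verts] by auto
  have adj: "adjacent ?X x y \<longleftrightarrow> adjacent G x y" if "x \<in> S" "y \<in> S" for x y
    using that by (rule adjacent_subgraph)
  have sub: "set ps \<subseteq> S" "set qs \<subseteq> S" "set rs \<subseteq> S" unfolding S by auto
  have "is_prism ?X"
    unfolding is_prism_def
  proof (intro exI[of _ ?P] conjI)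
    show "\<forall>i<3. induced_path ?X (?P i) \<and> 2 \<le> length (?P i)"
      unfolding all_less_3 using p len by (auto intro!: induced_path_subgraph simp: S)
    show "verts ?X = (\<Union>i<3. set (?P i))"
      unfolding Un_less_3 using V by (auto simp: induced_subgraph_def S)
    show "\<forall>i<3. \<forall>j<3. i \<noteq> j \<longrightarrow> set (?P i) \<inter> set (?P j) = {} \<and>
        (\<forall>x\<in>set (?P i). \<forall>y\<in>set (?P j). adjacent ?X x y \<longleftrightarrow>
           x = hd (?P i) \<and> y = hd (?P j) \<or> x = last (?P i) \<and> y = last (?P j))"
    proof (rule pairs_less_3[where R = "\<lambda>p q. set p \<inter> set q = {} \<and>
        (\<forall>x\<in>set p. \<forall>y\<in>set q. adjacent ?X x y \<longleftrightarrow>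
           x = hd p \<and> y = hd q \<or> x = last p \<and> y = last q)"])
      show "set ps \<inter> set qs = {} \<and> (\<forall>x\<in>set ps. \<forall>y\<in>set qs. adjacent ?X x y \<longleftrightarrow>
           x = hd ps \<and> y = hd qs \<or> x = last ps \<and> y = last qs)"
        using dis cr(1) by (simp add: adj subsetD[OF sub(1)] subsetD[OF sub(2)] subsetD[OF sub(3)])
      show "set ps \<inter> set rs = {} \<and> (\<forall>x\<in>set ps. \<forall>y\<in>set rs. adjacent ?X x y \<longleftrightarrow>
           x = hd ps \<and> y = hd rs \<or> x = last ps \<and> y = last rs)"
        using dis cr(2) by (simp add: adj subsetD[OF sub(1)] subsetD[OF sub(2)] subsetD[OF sub(3)])
      show "set qs \<inter> set rs = {} \<and> (\<forall>x\<in>set qs. \<forall>y\<in>set rs. adjacent ?X x y \<longleftrightarrow>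
           x = hd qs \<and> y = hd rs \<or> x = last qs \<and> y = last rs)"
        using dis cr(3) by (simp add: adj subsetD[OF sub(1)] subsetD[OF sub(2)] subsetD[OF sub(3)])
    qed (metis Int_commute adjacent_commute)
  qed
  with V us show False using universally_signable_obstruction by blast
qed

text \<open>The apex is split off. Instead of counting the long paths, the first path is taken to be
  one of them.\<close>

lemma no_pyramid:
  assumes us: "universally_signable G"
    and p: "induced_path G (a # ps)" "induced_path G (a # qs)" "induced_path G (a # rs)"
    and ne: "ps \<noteq> []" "qs \<noteq> []" "rs \<noteq> []"
    and len: "2 \<le> length ps" "2 \<le> length qs \<or> 2 \<le> length rs"
    and dis: "set ps \<inter> set qs = {}" "set ps \<inter> set rs = {}" "set qs \<inter> set rs = {}"
    and cr: "\<And>x y. x \<in> set ps \<Longrightarrow> y \<in> set qs \<Longrightarrow> adjacent G x y \<longleftrightarrow> x = last ps \<and> y = last qs"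
      "\<And>x y. x \<in> set ps \<Longrightarrow> y \<in> set rs \<Longrightarrow> adjacent G x y \<longleftrightarrow> x = last ps \<and> y = last rs"
      "\<And>x y. x \<in> set qs \<Longrightarrow> y \<in> set rs \<Longrightarrow> adjacent G x y \<longleftrightarrow> x = last qs \<and> y = last rs"
  shows False
proof -
  define S where S: "S = {a} \<union> set ps \<union> set qs \<union> set rs"
  let ?X = "induced_subgraph G S"
  let ?P = "\<lambda>i::nat. if i = 0 then a # ps else if i = 1 then a # qs else a # rs"
  have V: "S \<subseteq> verts G" unfolding S using p[THEN induced_path_verts] by auto
  have nin: "a \<notin> set ps" "a \<notin> set qs" "a \<notin> set rs"
    using p by (auto simp: induced_path_def is_path_def)
  have adj: "adjacent ?X x y \<longleftrightarrow> adjacent G x y" if "x \<in> S" "y \<in> S" for x y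
    using that by (rule adjacent_subgraph)
  have sub: "set ps \<subseteq> S" "set qs \<subseteq> S" "set rs \<subseteq> S" unfolding S by auto
  have "is_pyramid ?X"
    unfolding is_pyramid_def
  proof (intro exI[of _ ?P] exI[of _ a] conjI)
    show "\<forall>i<3. induced_path ?X (?P i) \<and> hd (?P i) = a \<and> 2 \<le> length (?P i)"
      unfolding all_less_3 using p ne by (auto intro!: induced_path_subgraph simp: S Suc_le_eq)
    have "\<exists>j\<in>{1, 2}. 3 \<le> length (?P j)" using len by auto
    then obtain j where "j \<in> {1, 2}" "3 \<le> length (?P j)" ..
    then have "{0, j} \<subseteq> {i. i < 3 \<and> 3 \<le> length (?P i)}" "j \<noteq> 0" using len by auto
    then show "2 \<le> card {i. i < 3 \<and> 3 \<le> length (?P i)}"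
      using card_mono[of "{i. i < 3 \<and> 3 \<le> length (?P i)}" "{0, j}"] by simp
    show "verts ?X = (\<Union>i<3. set (?P i))"
      unfolding Un_less_3 using V by (auto simp: induced_subgraph_def S)
    have rm: "set (a # ps) - {a} = set ps" "set (a # qs) - {a} = set qs" "set (a # rs) - {a} = set rs"
      using nin by auto
    show "\<forall>i<3. \<forall>j<3. i \<noteq> j \<longrightarrow> set (?P i) \<inter> set (?P j) = {a} \<and>
        (\<forall>x\<in>set (?P i) - {a}. \<forall>y\<in>set (?P j) - {a}. adjacent ?X x y \<longleftrightarrow>
           x = last (?P i) \<and> y = last (?P j))"
    proof (rule pairs_less_3[where R = "\<lambda>p q. set p \<inter> set q = {a} \<and>
        (\<forall>x\<in>set p - {a}. \<forall>y\<in>set q - {a}. adjacent ?X x y \<longleftrightarrow> x = last p \<and> y = last q)"])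
      show "set (a # ps) \<inter> set (a # qs) = {a} \<and> (\<forall>x\<in>set (a # ps) - {a}. \<forall>y\<in>set (a # qs) - {a}.
           adjacent ?X x y \<longleftrightarrow> x = last (a # ps) \<and> y = last (a # qs))"
        unfolding rm using dis ne cr(1) by (auto simp: adj subsetD[OF sub(1)] subsetD[OF sub(2)] subsetD[OF sub(3)])
      show "set (a # ps) \<inter> set (a # rs) = {a} \<and> (\<forall>x\<in>set (a # ps) - {a}. \<forall>y\<in>set (a # rs) - {a}.
           adjacent ?X x y \<longleftrightarrow> x = last (a # ps) \<and> y = last (a # rs))"
        unfolding rm using dis ne cr(2) by (auto simp: adj subsetD[OF sub(1)] subsetD[OF sub(2)] subsetD[OF sub(3)])
      show "set (a # qs) \<inter> set (a # rs) = {a} \<and> (\<forall>x\<in>set (a # qs) - {a}. \<forall>y\<in>set (a # rs) - {a}.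
           adjacent ?X x y \<longleftrightarrow> x = last (a # qs) \<and> y = last (a # rs))"
        unfolding rm using dis ne cr(3) by (auto simp: adj subsetD[OF sub(1)] subsetD[OF sub(2)] subsetD[OF sub(3)])
    qed (metis Int_commute adjacent_commute)
  qed
  with V us show False using universally_signable_obstruction by blast
qed

text \<open>Three indices that are pairwise cyclically consecutive force a cycle of length
  three.\<close>

lemma hole_no_triangle:
  assumes "simple_graph G" "hole G c" "x \<in> set c" "y \<in> set c" "z \<in> set c"
    "adjacent G x y" "adjacent G y z" "adjacent G x z"
  shows False
proof -
  obtain i j k where "i < length c" "x = c ! i" "j < length c" "y = c ! j" "k < length c" "z = c ! k"
    using assms(3-5) by (metis in_set_conv_nth)
  moreover have "4 \<le> length c" using assms(2) by (simp add: hole_def)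
  ultimately show False
    using assms(6-8) by (auto simp: hole_adjacent_iff[OF assms(1,2)])
qed

lemma hole_degree:
  assumes "simple_graph G" "hole G c" "x \<in> set c" "y \<in> set c" "z \<in> set c" "w \<in> set c"
    "adjacent G w x" "adjacent G w y" "adjacent G w z" "x \<noteq> y" "x \<noteq> z"
  shows "y = z"
proof -
  obtain i j k l where "i < length c" "x = c ! i" "j < length c" "y = c ! j" "k < length c" "z = c ! k"
     "l < length c" "w = c ! l"
    using assms(3-6) by (metis in_set_conv_nth)
  moreover have "4 \<le> length c" using assms(2) by (simp add: hole_def)
  moreover from calculation have "i \<noteq> j" "i \<noteq> k" using assms(10,11) by auto
  ultimately have "j = k"
    using assms(7-9) by (auto simp: hole_adjacent_iff[OF assms(1,2)])
  then show ?thesis using \<open>y = c ! j\<close> \<open>z = c ! k\<close> by simp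
qed

section \<open>A path outside a hole and the obstruction it creates\<close>

context
  fixes G :: "'a ugraph" and vs :: "'a list" and c :: "'a list"
  assumes us: "universally_signable G" and vs: "induced_path G vs" and disj: "set vs \<inter> set c = {}"
    and hc: "hole G c"
begin

lemma attach_simple: "simple_graph G" using us by (simp add: universally_signable_def)

lemma attach_nonempty: "vs \<noteq> []" using vs by (simp add: induced_path_def is_path_def)

text \<open>The two arcs of the hole between \<open>a\<close> and \<open>b\<close> and the path
  through \<open>vs\<close> are three paths with common ends.\<close>

lemma attach_theta:
  assumes c: "hole G (a # A1 @ b # A2)" "set c = set (a # A1 @ b # A2)" and ne: "A1 \<noteq> []" "A2 \<noteq> []"
    and att: "\<And>x v. x \<in> set c \<Longrightarrow> v \<in> set vs \<Longrightarrow> adjacent G x v \<longleftrightarrow> x = a \<and> v = hd vs \<or> x = b \<and> v = last vs"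
  shows False
proof -
  note app = hole_append[OF attach_simple] and pap = induced_path_append[OF attach_simple]
  have d: "distinct (a # A1 @ b # A2)" using c by (auto simp: hole_def is_cycle_def)
  have h1: "hole G ((a # A1 @ [b]) @ A2)" using c by simp
  have p1: "induced_path G (a # A1 @ [b])" using h1 ne by (subst (asm) app) auto
  have c12: "\<not> adjacent G x y" if "x \<in> set A1" "y \<in> set A2" for x y
    using h1 that d ne by (subst (asm) app) auto
  have "hole G ((b # A2 @ [a]) @ A1)" using hole_rotate[OF attach_simple, of "a # A1" "b # A2"] c
      hole_rotate[OF attach_simple, of A1 "b # A2 @ [a]"] hole_rotate[OF attach_simple, of "[a]" "A1 @ b # A2"] by simp
  then have "induced_path G (b # A2 @ [a])" using ne by (subst (asm) app) auto
  then have p2: "induced_path G (a # rev A2 @ [b])" using induced_path_rev[OF attach_simple] by fastforce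
  have ab: "\<not> adjacent G a b" "a \<noteq> b"
    using p1 d ne pap[of "[a]" "A1 @ [b]"] by (auto simp: hd_append)
  have V: "a \<in> verts G" "b \<in> verts G" using p1 by (auto simp: induced_path_def is_path_def)
  have "induced_path G (vs @ [b])"
    using vs attach_nonempty disj c(2) att V attach_simple ab
    by (subst pap) (auto intro!: induced_path_singleton simp: adjacent_commute[of G _ b] dest: att[of b, THEN iffD1, rotated 2])
  then have p3: "induced_path G ([a] @ (vs @ [b]))"
    using attach_nonempty disj c(2) att V attach_simple ab
    by (subst pap) (auto intro!: induced_path_singleton dest: att[of a, THEN iffD1, rotated 2])
  show False
  proof (rule no_theta[OF us p1 p2 p3[simplified]])
    show "A1 \<noteq> []" "rev A2 \<noteq> []" "vs \<noteq> []" using ne attach_nonempty by auto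
    show "set A1 \<inter> set (rev A2) = {}" using d by auto
    show "set A1 \<inter> set vs = {}" "set (rev A2) \<inter> set vs = {}" using disj c(2) by auto
    show "\<not> adjacent G x y" if "x \<in> set A1" "y \<in> set (rev A2)" for x y using c12 that by simp
    show "\<not> adjacent G x y" if "x \<in> set A1" "y \<in> set vs" for x y
      using att[of x y] that d c(2) by auto
    show "\<not> adjacent G x y" if "x \<in> set (rev A2)" "y \<in> set vs" for x y
      using att[of x y] that d c(2) by auto
  qed
qed

text \<open>The last vertex of \<open>vs\<close> sees \<open>hd D1\<close> and
  \<open>last D2\<close>, which are consecutive on the hole. These three form the triangle, and
  \<open>a\<close> is the apex.\<close>

lemma attach_pyramid:
  assumes c: "hole G (D1 @ a # D2)" "set c = set (D1 @ a # D2)" and ne: "D1 \<noteq> []" "D2 \<noteq> []" "2 \<le> length vs"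
    and att: "\<And>x v. x \<in> set c \<Longrightarrow> v \<in> set vs \<Longrightarrow> adjacent G x v \<longleftrightarrow>
      x = a \<and> v = hd vs \<or> (x = hd D1 \<or> x = last D2) \<and> v = last vs"
  shows False
proof -
  note app = hole_append[OF attach_simple] and pap = induced_path_append[OF attach_simple]
  have d: "distinct (D1 @ a # D2)" and len: "4 \<le> length (D1 @ a # D2)"
    using c by (auto simp: hole_def is_cycle_def)
  have p1: "induced_path G (a # D2)" using c(1) ne by (subst (asm) app) auto
  have "hole G ((D1 @ [a]) @ D2)" using c by simp
  then have p2: "induced_path G (D1 @ [a])"
    and cr: "\<And>x y. x \<in> set (D1 @ [a]) \<Longrightarrow> y \<in> set D2 \<Longrightarrow> adjacent G x y \<longleftrightarrow>
      x = last (D1 @ [a]) \<and> y = hd D2 \<or> x = hd (D1 @ [a]) \<and> y = last D2"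
    using app[of "D1 @ [a]" D2] ne by blast+
  have p2: "induced_path G (a # rev D1)" using induced_path_rev[OF attach_simple p2] by simp
  have V: "a \<in> verts G" using p1 by (auto simp: induced_path_def is_path_def)
  have a12: "a \<noteq> hd D1" "a \<noteq> last D2" using d ne by auto
  have "adjacent G a y \<longleftrightarrow> y = hd vs" if "y \<in> set vs" for y
    using att[OF _ that, of a] c(2) a12 by auto
  then have p3: "induced_path G ([a] @ vs)"
    using vs attach_nonempty disj c(2) V attach_simple
    by (subst pap) (auto intro!: induced_path_singleton)
  show False
  proof (rule no_pyramid[OF us p3[simplified] p2 p1 attach_nonempty _ ne(2) ne(3)])
    show "rev D1 \<noteq> []" using ne by auto
    show "2 \<le> length (rev D1) \<or> 2 \<le> length D2" using len by auto
    show "set vs \<inter> set (rev D1) = {}" "set vs \<inter> set D2 = {}" using disj c(2) by auto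
    show "set (rev D1) \<inter> set D2 = {}" using d by auto
    show "adjacent G x y \<longleftrightarrow> x = last vs \<and> y = last (rev D1)" if "x \<in> set vs" "y \<in> set (rev D1)" for x y
    proof -
      have "y \<noteq> a" "y \<noteq> last D2" "last (rev D1) = hd D1" using that d ne by (auto simp: last_rev)
      then show ?thesis using att[of y x] that c(2) by (auto simp: adjacent_commute[of G x])
    qed
    show "adjacent G x y \<longleftrightarrow> x = last vs \<and> y = last D2" if "x \<in> set vs" "y \<in> set D2" for x y
    proof -
      have "y \<noteq> a" "y \<noteq> hd D1" using that d hd_in_set[OF ne(1)] by auto
      then show ?thesis using att[of y x] that c(2) by (auto simp: adjacent_commute[of G x])
    qed
    show "adjacent G x y \<longleftrightarrow> x = last (rev D1) \<and> y = last D2" if "x \<in> set (rev D1)" "y \<in> set D2" for x y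
      using cr[of x y] that d ne by (auto simp: last_rev)
  qed
qed

text \<open>Each end of \<open>vs\<close> closes a triangle with an edge of the hole, and removing
  these two edges from the hole leaves the paths \<open>D1\<close> and \<open>D2\<close>.\<close>

lemma attach_prism:
  assumes c: "hole G (D1 @ D2)" "set c = set (D1 @ D2)" and len: "2 \<le> length D1" "2 \<le> length D2" "2 \<le> length vs"
    and att: "\<And>x v. x \<in> set c \<Longrightarrow> v \<in> set vs \<Longrightarrow> adjacent G x v \<longleftrightarrow>
      (x = hd D1 \<or> x = last D2) \<and> v = hd vs \<or> (x = last D1 \<or> x = hd D2) \<and> v = last vs"
  shows False
proof -
  note app = hole_append[OF attach_simple] and pap = induced_path_append[OF attach_simple]
  have d: "distinct (D1 @ D2)" using c by (auto simp: hole_def is_cycle_def)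
  have ne: "D1 \<noteq> []" "D2 \<noteq> []" using len by auto
  have p1: "induced_path G D1" and p2: "induced_path G D2"
    and cr: "\<And>x y. x \<in> set D1 \<Longrightarrow> y \<in> set D2 \<Longrightarrow> adjacent G x y \<longleftrightarrow>
      x = last D1 \<and> y = hd D2 \<or> x = hd D1 \<and> y = last D2"
    using app[OF ne] c(1) by blast+
  show False
  proof (rule no_prism[OF us vs p1 induced_path_rev[OF attach_simple p2] len(3) len(1)])
    show "2 \<le> length (rev D2)" using len by auto
    show "set vs \<inter> set D1 = {}" "set vs \<inter> set (rev D2) = {}" using disj c(2) by auto
    show "set D1 \<inter> set (rev D2) = {}" using d by auto
    show "adjacent G x y \<longleftrightarrow> x = hd vs \<and> y = hd D1 \<or> x = last vs \<and> y = last D1"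
      if "x \<in> set vs" "y \<in> set D1" for x y
    proof -
      have "y \<noteq> last D2" "y \<noteq> hd D2" using that d ne by auto
      then show ?thesis using att[of y x] that c(2) by (auto simp: adjacent_commute[of G x])
    qed
    show "adjacent G x y \<longleftrightarrow> x = hd vs \<and> y = hd (rev D2) \<or> x = last vs \<and> y = last (rev D2)"
      if "x \<in> set vs" "y \<in> set (rev D2)" for x y
    proof -
      have "y \<noteq> last D1" "y \<noteq> hd D1"
        using that d last_in_set[OF ne(1)] hd_in_set[OF ne(1)] by auto
      then show ?thesis using att[of y x] that c(2) ne by (auto simp: adjacent_commute[of G x] hd_rev last_rev)
    qed
    show "adjacent G x y \<longleftrightarrow> x = hd D1 \<and> y = hd (rev D2) \<or> x = last D1 \<and> y = last (rev D2)"
      if "x \<in> set D1" "y \<in> set (rev D2)" for x y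
      using cr[of x y] that ne by (auto simp: hd_rev last_rev)
  qed
qed

text \<open>Replacing \<open>y\<close> by \<open>vs\<close> gives another hole. On it
  \<open>y\<close> sees its two former neighbours and a vertex of \<open>vs\<close>, so it is the
  centre of a wheel.\<close>

lemma attach_wheel:
  assumes c: "hole G (y # D)" "set c = set (y # D)" and v: "v \<in> set vs" "adjacent G y v"
    and att: "\<And>x v. x \<in> set D \<Longrightarrow> v \<in> set vs \<Longrightarrow> adjacent G x v \<longleftrightarrow> x = last D \<and> v = hd vs \<or> x = hd D \<and> v = last vs"
  shows False
proof -
  note app = hole_append[OF attach_simple] and pap = induced_path_append[OF attach_simple]
  have d: "distinct (y # D)" and len: "4 \<le> length (y # D)" using c by (auto simp: hole_def is_cycle_def)
  have ne: "D \<noteq> []" using len by auto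
  have h: "hole G ([y] @ D)" using c by simp
  have D: "induced_path G D" and yD: "adjacent G y (hd D)" "adjacent G y (last D)"
    using app[of "[y]" D] h ne by auto
  have "hole G (vs @ D)"
    unfolding app[OF attach_nonempty ne]
  proof (intro conjI ballI)
    show "4 \<le> length vs + length D" using len attach_nonempty by (cases vs) auto
    show "set vs \<inter> set D = {}" using disj c(2) by auto
    show "adjacent G x z \<longleftrightarrow> x = last vs \<and> z = hd D \<or> x = hd vs \<and> z = last D"
      if "x \<in> set vs" "z \<in> set D" for x z
      using att[of z x] that by (auto simp: adjacent_commute[of G x])
  qed (use vs D in auto)
  moreover have "hd D \<noteq> last D" using d len by (cases D) auto
  moreover have "v \<noteq> hd D" "v \<noteq> last D"
    using disj c(2) v hd_in_set[OF ne] last_in_set[OF ne] by auto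
  moreover have "y \<in> verts G" using adjacent_verts[OF attach_simple yD(1)] by simp
  ultimately show False
    using no_wheel3[OF us, of "vs @ D" y "hd D" "last D" v] yD v ne d disj c(2) by auto
qed

end

section \<open>Shortest walks and connectivity inside a vertex set\<close>

lemma shortest_walk_induced:
  assumes G: "simple_graph G" and p: "p \<noteq> []" "successively (adjacent G) p" "set p \<subseteq> verts G"
    and min: "\<And>q. q \<noteq> [] \<Longrightarrow> successively (adjacent G) q \<Longrightarrow> set q \<subseteq> set p \<Longrightarrow> hd q = hd p \<Longrightarrow>
      last q = last p \<Longrightarrow> length p \<le> length q"
  shows "induced_path G p"
proof -
  \<comment> \<open>The piece between two occurrences of a vertex could be cut out.\<close>
  have d: "distinct p"
  proof (rule ccontr)
    assume "\<not> distinct p"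
    then obtain xs ys zs a where q: "p = xs @ [a] @ ys @ [a] @ zs" using not_distinct_decomp by blast
    have "length p \<le> length (xs @ [a] @ zs)"
      using p(2) by (intro min) (auto simp: q successively_append_iff hd_append successively_Cons last_append)
    then show False by (simp add: q)
  qed
  \<comment> \<open>A chord would allow the walk to skip the vertices strictly between its
    ends.\<close>
  have short: "j = Suc i" if ij: "i < j" "j < length p" "adjacent G (p ! i) (p ! j)" for i j
  proof -
    let ?q = "take (Suc i) p @ drop j p"
    have "successively (adjacent G) (take (Suc i) p @ drop (Suc i) p)"
      "successively (adjacent G) (take j p @ drop j p)" using p by auto
    then have "successively (adjacent G) (take (Suc i) p)" "successively (adjacent G) (drop j p)"
      unfolding successively_append_iff by blast+
    moreover have "last (take (Suc i) p) = p ! i" "hd (drop j p) = p ! j"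
      using ij by (auto simp: take_Suc_conv_app_nth hd_drop_conv_nth)
    ultimately have "successively (adjacent G) ?q"
      using ij by (simp add: successively_append_iff)
    then have "length p \<le> length ?q"
      using ij p by (intro min) (auto simp: hd_append dest: in_set_takeD in_set_dropD)
    then show ?thesis using ij by simp
  qed
  show ?thesis
    unfolding induced_path_def is_path_def
  proof (intro conjI allI impI)
    show "adjacent G (p ! i) (p ! Suc i)" if "Suc i < length p" for i
      using p(2) that by (simp add: successively_conv_nth)
    show "j = Suc i \<or> i = Suc j" if "i < length p" "j < length p" "adjacent G (p ! i) (p ! j)" for i j
      using short[of i j] short[of j i] that adjacent_neq[OF G that(3)]
      by (metis linorder_neqE_nat adjacent_commute)
  qed (use p d in auto)
qed

text \<open>Being a reflexive closure, it relates every vertex to itself, also outside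
  \<open>S\<close>; this is why several facts below assume in addition that the first vertex belongs
  to \<open>S\<close>.\<close>

definition joined :: "'a ugraph \<Rightarrow> 'a set \<Rightarrow> ('a \<times> 'a) set" where
  "joined G S = {(x, y). x \<in> S \<and> y \<in> S \<and> adjacent G x y}\<^sup>*"

lemma joined_walk:
  assumes "(x, y) \<in> joined G S" "x \<in> S"
  shows "\<exists>p. p \<noteq> [] \<and> hd p = x \<and> last p = y \<and> set p \<subseteq> S \<and> successively (adjacent G) p"
  using assms(1) unfolding joined_def
proof (induction rule: rtrancl_induct)
  case base
  then show ?case using assms(2) by (intro exI[of _ "[x]"]) auto
next
  case (step y z)
  then obtain p where "p \<noteq> []" "hd p = x" "last p = y" "set p \<subseteq> S" "successively (adjacent G) p" by blast
  then show ?case using step(2) by (intro exI[of _ "p @ [z]"]) (auto simp: successively_append_iff)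
qed

lemma joined_induced_path:
  assumes "simple_graph G" "(x, y) \<in> joined G S" "x \<in> S" "S \<subseteq> verts G"
  shows "\<exists>p. induced_path G p \<and> hd p = x \<and> last p = y \<and> set p \<subseteq> S"
proof -
  let ?Q = "\<lambda>p. p \<noteq> [] \<and> hd p = x \<and> last p = y \<and> set p \<subseteq> S \<and> successively (adjacent G) p"
  obtain p where "?Q p" "\<And>q. ?Q q \<Longrightarrow> length p \<le> length q"
    using joined_walk[OF assms(2,3)] ex_has_least_nat[of ?Q _ length] by blast
  moreover from this have "induced_path G p"
    using assms(1,4) by (intro shortest_walk_induced) auto
  ultimately show ?thesis by blast
qed

lemma joined_mono: "S \<subseteq> T \<Longrightarrow> joined G S \<subseteq> joined G T"
  unfolding joined_def by (rule rtrancl_mono) auto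

lemma joined_trans: "(x, y) \<in> joined G S \<Longrightarrow> (y, z) \<in> joined G S \<Longrightarrow> (x, z) \<in> joined G S"
  unfolding joined_def by (rule rtrancl_trans)

lemma joined_edge: "x \<in> S \<Longrightarrow> y \<in> S \<Longrightarrow> adjacent G x y \<Longrightarrow> (x, y) \<in> joined G S"
  unfolding joined_def by (rule r_into_rtrancl) auto

lemma joined_refl: "(x, x) \<in> joined G S"
  unfolding joined_def by simp

lemma joined_sym: "(x, y) \<in> joined G S \<Longrightarrow> (y, x) \<in> joined G S"
  unfolding joined_def
  by (rule symD[OF sym_rtrancl]) (auto intro!: symI simp: adjacent_commute)

text \<open>The walk is followed until it enters \<open>M\<close> for the first time; everything
  before that moment lies in \<open>S - M\<close>.\<close>

lemma joined_first_hit: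
  assumes "(x, y) \<in> joined G S" "x \<notin> M" "x \<in> S" "y \<in> M"
  shows "\<exists>v a. a \<in> M \<inter> S \<and> v \<in> S - M \<and> adjacent G v a \<and> (x, v) \<in> joined G (S - M)"
proof -
  have "y \<notin> M \<and> (x, y) \<in> joined G (S - M) \<and> y \<in> S \<or>
    (\<exists>v a. a \<in> M \<inter> S \<and> v \<in> S - M \<and> adjacent G v a \<and> (x, v) \<in> joined G (S - M))"
    using assms(1) unfolding joined_def[of G S]
  proof (induction rule: rtrancl_induct)
    case base
    then show ?case using assms by (simp add: joined_refl)
  next
    case (step y z)
    then show ?case using joined_trans[of x y G "S - M" z] joined_edge[of y "S - M" z G] by blast
  qed
  then show ?thesis using assms(4) by blast
qed


text \<open>Rotation puts \<open>a\<close> first. If one of the arcs were empty, \<open>b\<close>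
  would be a neighbour of \<open>a\<close>.\<close>

lemma hole_arcs:
  assumes G: "simple_graph G" and c: "hole G c" "a \<in> set c" "b \<in> set c" "a \<noteq> b" "\<not> adjacent G a b"
  obtains A1 A2 where "hole G (a # A1 @ b # A2)" "set c = set (a # A1 @ b # A2)" "A1 \<noteq> []" "A2 \<noteq> []"
proof -
  obtain xs ys where xy: "c = xs @ a # ys" using c(2) by (meson split_list)
  then have h: "hole G (a # ys @ xs)" using hole_rotate[OF G, of xs "a # ys"] c(1) by simp
  have "b \<in> set (ys @ xs)" using c(3,4) xy by auto
  then obtain A1 A2 where A: "ys @ xs = A1 @ b # A2" by (meson split_list)
  have h: "hole G (a # A1 @ b # A2)" using h A by simp
  have *: "\<forall>y\<in>set (A1 @ b # A2). adjacent G a y \<longleftrightarrow> y = hd (A1 @ b # A2) \<or> y = last (A1 @ b # A2)"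
    using hole_append[OF G, of "[a]" "A1 @ b # A2"] h by auto
  then have "A1 \<noteq> []" "A2 \<noteq> []" using c(5) by auto
  moreover have "set c = set (a # A1 @ b # A2)" using arg_cong[OF A, of set] xy by auto
  ultimately show ?thesis using that h by blast
qed

text \<open>A shortest path outside a hole that attaches to two nonadjacent vertices of
  the hole spans, together with the hole, one of the four obstructions.\<close>

lemma hole_attachment:
  assumes us: "universally_signable G" and hc: "hole G c" and S: "S \<inter> set c = {}" "S \<subseteq> verts G"
    and vw: "(v, w) \<in> joined G S" "v \<in> S"
    and ab: "a \<in> set c" "b \<in> set c" "adjacent G a v" "adjacent G b w" "a \<noteq> b" "\<not> adjacent G a b"
  shows False
proof -
  have G: "simple_graph G" using us by (simp add: universally_signable_def)
  define far where "far x y \<longleftrightarrow> x \<in> set c \<and> y \<in> set c \<and> x \<noteq> y \<and> \<not> adjacent G x y" for x y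
  have far_sym: "far x y \<Longrightarrow> far y x" for x y by (auto simp: far_def adjacent_commute)
  \<comment> \<open>The far pair and the surrounding set are left free here: minimality over all far
    pairs is what forbids far attachments at a smaller distance along the path. The original
    \<open>a\<close> and \<open>b\<close> only show that such walks exist.\<close>
  define Q where "Q p \<longleftrightarrow> p \<noteq> [] \<and> set p \<subseteq> verts G - set c \<and> successively (adjacent G) p \<and>
    (\<exists>x y. far x y \<and> adjacent G x (hd p) \<and> adjacent G y (last p))" for p
  obtain p where "p \<noteq> []" "hd p = v" "last p = w" "set p \<subseteq> S" "successively (adjacent G) p"
    using joined_walk[OF vw] by blast
  then have "Q p" unfolding Q_def using S ab by (auto simp: far_def)
  then obtain vs where vs: "Q vs" and min: "\<And>q. Q q \<Longrightarrow> length vs \<le> length q"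
    using ex_has_least_nat[of Q p length] by blast
  obtain a b where far: "far a b" and att_ab: "adjacent G a (hd vs)" "adjacent G b (last vs)"
    using vs by (auto simp: Q_def)
  have ab: "a \<in> set c" "b \<in> set c" "a \<noteq> b" "\<not> adjacent G a b" using far by (auto simp: far_def)
  define k where "k = length vs"
  have k: "0 < k" and vsC: "set vs \<inter> set c = {}" and vsne: "vs \<noteq> []"
    using vs by (auto simp: Q_def k_def)
  have hd0: "hd vs = vs ! 0" and lastk: "last vs = vs ! (k - 1)"
    using vsne by (simp_all add: hd_conv_nth last_conv_nth k_def)
  have ip: "induced_path G vs"
  proof (rule shortest_walk_induced[OF G])
    show "length vs \<le> length q" if "q \<noteq> []" "successively (adjacent G) q" "set q \<subseteq> set vs"
      "hd q = hd vs" "last q = last vs" for q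
      using vs that by (intro min) (auto simp: Q_def)
  qed (use vs in \<open>auto simp: Q_def\<close>)
  then have dvs: "distinct vs" by (simp add: induced_path_def is_path_def)
  define ats where "ats i x \<longleftrightarrow> x \<in> set c \<and> i < k \<and> adjacent G x (vs ! i)" for i x
  \<comment> \<open>The segment from \<open>i\<close> to \<open>j\<close> has fewer than
    \<open>k\<close> vertices, so by minimality its ends see no far pair.\<close>
  have near1: "\<not> far x y" if at: "ats i x" "ats j y" "i \<le> j" "j - i < k - 1" for i j x y
  proof
    assume f: "far x y"
    let ?q = "take (Suc j - i) (drop i vs)"
    have l: "length ?q = Suc j - i" "?q \<noteq> []" using at by (auto simp: ats_def k_def)
    have "vs = take i vs @ ?q @ drop (Suc j - i) (drop i vs)" by (simp only: append_take_drop_id)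
    moreover have "successively (adjacent G) vs" using vs by (simp add: Q_def)
    ultimately have "successively (adjacent G) (take i vs @ ?q @ drop (Suc j - i) (drop i vs))" by (simp only:)
    then have "successively (adjacent G) ?q" unfolding successively_append_iff by blast
    moreover have "set ?q \<subseteq> set vs" by (meson set_drop_subset set_take_subset subset_trans)
    then have "set ?q \<subseteq> verts G - set c" using vs by (auto simp only: Q_def)
    moreover have "hd ?q = vs ! i" "last ?q = vs ! j"
      using l at by (auto simp: hd_conv_nth last_conv_nth ats_def k_def)
    moreover have "adjacent G x (vs ! i)" "adjacent G y (vs ! j)" using at by (simp_all add: ats_def)
    ultimately have "Q ?q" using l(2) f unfolding Q_def by metis
    then have "k \<le> Suc j - i" using min[of ?q] l(1) by (simp add: k_def)
    then show False using at(3,4) by arith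
  qed
  have near: "x = y \<or> adjacent G x y" if "ats i x" "ats j y" "i < j + (k - 1)" "j < i + (k - 1)" for i j x y
  proof -
    have "\<not> far x y"
    proof (cases "i \<le> j")
      case True
      then show ?thesis using near1[OF that(1,2)] that(3,4) by linarith
    next
      case False
      then have "\<not> far y x" using near1[OF that(2,1)] that(3,4) by linarith
      then show ?thesis using far_sym by blast
    qed
    then show ?thesis using that(1,2) unfolding far_def ats_def by blast
  qed
  have at_a: "ats 0 a" and at_b: "ats (k - 1) b"
    using k ab att_ab hd0 lastk by (auto simp: ats_def)
  have att: "adjacent G x v \<longleftrightarrow> (\<exists>i. ats i x \<and> v = vs ! i)" if "x \<in> set c" "v \<in> set vs" for x v
    using that by (auto simp: ats_def k_def in_set_conv_nth)
  have idx: "i = j" if "vs ! i = vs ! j" "i < k" "j < k" for i j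
    using that dvs by (simp add: nth_eq_iff_index_eq k_def)
  obtain A1 A2 where h: "hole G (a # A1 @ b # A2)" and setc: "set c = set (a # A1 @ b # A2)"
    and ne: "A1 \<noteq> []" "A2 \<noteq> []"
    using hole_arcs[OF G hc ab] by blast
  have d: "distinct (a # A1 @ b # A2)" using h by (auto simp: hole_def is_cycle_def)
  note app = hole_append[OF G] and rot = hole_rotate[OF G]
  have h2: "hole G (b # A2 @ a # A1)" using rot[of "a # A1" "b # A2"] h by simp
  have ends: "hd A1 \<in> set A1" "last A1 \<in> set A1" "hd A2 \<in> set A2" "last A2 \<in> set A2" using ne by simp_all
  have nb_a: "adjacent G a y \<longleftrightarrow> y = hd A1 \<or> y = last A2" if "y \<in> set c" for y
  proof (cases "y = a")
    case True
    then show ?thesis using adjacent_neq[OF G, of a a] d ends by auto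
  next
    case False
    then have "y \<in> set (A1 @ b # A2)" using that setc by auto
    moreover have "hole G ([a] @ (A1 @ b # A2))" using h by simp
    ultimately show ?thesis using ne by (subst (asm) app) auto
  qed
  have nb_b: "adjacent G b y \<longleftrightarrow> y = last A1 \<or> y = hd A2" if "y \<in> set c" for y
  proof (cases "y = b")
    case True
    then show ?thesis using adjacent_neq[OF G, of b b] d ends by auto
  next
    case False
    then have "y \<in> set (A2 @ a # A1)" using that setc by auto
    moreover have "hole G ([b] @ (A2 @ a # A1))" using h2 by simp
    ultimately show ?thesis using ne by (subst (asm) app) auto
  qed
  show False
  proof (cases "k = 1")
    case True
    \<comment> \<open>A third neighbour of the single vertex on the hole would give a wheel.\<close>
    have "\<forall>x\<in>set c. adjacent G (hd vs) x \<longrightarrow> x = a \<or> x = b"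
    proof (intro ballI impI)
      fix x assume "x \<in> set c" "adjacent G (hd vs) x"
      moreover have "hd vs \<notin> set c" "hd vs \<in> verts G"
        using vs hd_in_set[OF vsne] unfolding Q_def by blast+
      moreover have "last vs = hd vs" using True hd0 lastk by simp
      ultimately show "x = a \<or> x = b"
        using no_wheel3[OF us hc, of "hd vs" a b x] ab att_ab by (auto simp: adjacent_commute)
    qed
    moreover obtain u where u: "vs = [u]" using True by (auto simp: k_def length_Suc_conv)
    ultimately have "adjacent G x v \<longleftrightarrow> x = a \<and> v = hd vs \<or> x = b \<and> v = last vs"
      if "x \<in> set c" "v \<in> set vs" for x v
      using that att_ab adjacent_commute[of G x u] by auto
    then show False by (rule attach_theta[OF us ip vsC hc h setc ne])
  next
    case False
    then have k2: "2 \<le> k" using k by simp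
    have only_a: "i = 0" if "ats i a" for i
    proof (rule ccontr)
      assume "i \<noteq> 0"
      moreover have "i < k" using that by (simp add: ats_def)
      ultimately show False using near[OF that at_b] ab(3,4) k2 by linarith
    qed
    have only_b: "i = k - 1" if "ats i b" for i
    proof (rule ccontr)
      assume "i \<noteq> k - 1"
      moreover have "i < k" using that by (simp add: ats_def)
      ultimately show False using near[OF at_a that] ab(3,4) k2 by linarith
    qed
    show False
    \<comment> \<open>Either some attached vertex \<open>y\<close> is close to all attachments, or
      it turns out that attachments occur only at the two ends of the path.\<close>
    proof (cases "\<exists>y i0. ats i0 y \<and> (\<forall>i x. ats i x \<longrightarrow> y = x \<or> adjacent G y x)")
      case True
      then obtain y i0 where y0: "ats i0 y" and y: "\<And>i x. ats i x \<Longrightarrow> y = x \<or> adjacent G y x" by blast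
      have yc: "y \<in> set c" using y0 by (simp add: ats_def)
      \<comment> \<open>Since \<open>a\<close> and \<open>b\<close> are both attached,
        \<open>y\<close> is a common neighbour of them. Hence one of the arcs is just
        \<open>y\<close>, which can be exchanged for \<open>vs\<close>.\<close>
      have ya: "adjacent G y a" "adjacent G y b"
        using y[OF at_a] y[OF at_b] ab by (auto simp: adjacent_commute)
      then have yne: "y \<noteq> a" "y \<noteq> b" using adjacent_neq[OF G] by blast+
      have only: "x = a \<and> i = 0 \<or> x = b \<and> i = k - 1" if "ats i x" "x \<noteq> y" for i x
        using y[OF that(1)] that hole_degree[OF G hc ab(1,2) _ yc ya, of x] only_a only_b ab
        by (auto simp: ats_def)
      have att': "adjacent G x v \<longleftrightarrow> x = a \<and> v = hd vs \<or> x = b \<and> v = last vs"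
        if "x \<in> set c" "x \<noteq> y" "v \<in> set vs" for x v
        using att[OF that(1,3)] only[of _ x] that att_ab hd0 lastk by auto
      obtain v where v: "v \<in> set vs" "adjacent G y v" using y0 nth_mem[of i0 vs] unfolding ats_def k_def by blast
      have "y = hd A1 \<or> y = last A2" "y = last A1 \<or> y = hd A2"
        using nb_a[OF yc] nb_b[OF yc] ya by (auto simp: adjacent_commute)
      then consider "y = hd A1" "y = last A1" | "y = hd A2" "y = last A2"
        using d ne by (metis Un_iff disjoint_iff distinct.simps(2) distinct_append hd_in_set last_in_set set_ConsD list.set_intros(2))
      then show False
      proof cases
        case 1
        then have A1: "A1 = [y]" using ne d by (cases A1) (auto split: if_splits)
        have "hole G (y # b # A2 @ [a])" using rot[of "[a]" "y # b # A2"] h A1 by simp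
        then show False
        proof (rule attach_wheel[OF us ip vsC hc _ _ v])
          show "set c = set (y # b # A2 @ [a])" using setc A1 by auto
          fix x v assume x: "x \<in> set (b # A2 @ [a])" and v: "v \<in> set vs"
          then have "x \<in> set c" "x \<noteq> y" using setc A1 d by auto
          then show "adjacent G x v \<longleftrightarrow> x = last (b # A2 @ [a]) \<and> v = hd vs \<or> x = hd (b # A2 @ [a]) \<and> v = last vs"
            using att'[OF _ _ v] by simp
        qed
      next
        case 2
        then have A2: "A2 = [y]" using ne d by (cases A2) (auto split: if_splits)
        have "hole G (y # a # A1 @ [b])" using rot[of "[y]" "a # A1 @ [b]"] rot[of "a # A1 @ [b]" "[y]"] h A2 by simp
        then have "hole G (rev (y # a # A1 @ [b]))" by (rule hole_rev[OF G])
        then have "hole G (y # b # rev A1 @ [a])" using rot[of "b # rev A1 @ [a]" "[y]"] by simp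
        then show False
        proof (rule attach_wheel[OF us ip vsC hc _ _ v])
          show "set c = set (y # b # rev A1 @ [a])" using setc A2 by auto
          fix x v assume x: "x \<in> set (b # rev A1 @ [a])" and v: "v \<in> set vs"
          then have "x \<in> set c" "x \<noteq> y" using setc A2 d by auto
          then show "adjacent G x v \<longleftrightarrow> x = last (b # rev A1 @ [a]) \<and> v = hd vs \<or> x = hd (b # rev A1 @ [a]) \<and> v = last vs"
            using att'[OF _ _ v] by simp
        qed
      qed
    next
      case noy: False
      \<comment> \<open>A position strictly inside the path differs by less than
        \<open>k - 1\<close> from every position, so by \<open>near\<close> a vertex attached there
        would be close to all attachments.\<close>
      have at_ends: "i = 0 \<or> i = k - 1" if "ats i x" for i x
      proof (rule ccontr)
        assume "\<not> ?thesis"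
        then have "x = x' \<or> adjacent G x x'" if "ats j x'" for j x'
          using that \<open>ats i x\<close> by (intro near[of i x j x']) (auto simp: ats_def)
        then show False using noy that by blast
      qed
      \<comment> \<open>A vertex attached at both ends would again be close to all attachments, as
        these occur only at the ends.\<close>
      have disj: "\<not> (ats 0 x \<and> ats (k - 1) x)" for x
      proof
        assume x: "ats 0 x \<and> ats (k - 1) x"
        have "x = x' \<or> adjacent G x x'" if "ats j x'" for j x'
          using at_ends[OF that] near[of 0 x j x'] near[of "k - 1" x j x'] x that k2 by auto
        then show False using noy x by blast
      qed
      have X: "x = a \<or> adjacent G a x" if "ats 0 x" for x using near[OF at_a that] k2 by auto
      have Y: "x = b \<or> adjacent G b x" if "ats (k - 1) x" for x using near[OF at_b that] k2 by auto
      have attXY: "adjacent G x v \<longleftrightarrow> ats 0 x \<and> v = hd vs \<or> ats (k - 1) x \<and> v = last vs"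
        if "x \<in> set c" "v \<in> set vs" for x v
        using att[OF that] at_ends[of _ x] hd0 lastk by auto
      \<comment> \<open>Attachments at one end are pairwise adjacent, and a hole has no triangle. So
        besides \<open>a\<close> there is at most one, a neighbour of \<open>a\<close> on the hole.
        The choice \<open>x = a\<close> stands for none.\<close>
      have setX: "\<exists>x\<in>{a, hd A1, last A2}. \<forall>z. ats 0 z \<longleftrightarrow> z = a \<or> z = x"
      proof (cases "\<exists>x. ats 0 x \<and> x \<noteq> a")
        case True
        then obtain x where x: "ats 0 x" "x \<noteq> a" by blast
        have "z = a \<or> z = x" if "ats 0 z" for z
        proof (rule ccontr)
          assume "\<not> ?thesis"
          then have "adjacent G x z" "adjacent G a x" "adjacent G a z"
            using near[OF x(1) that] X[OF x(1)] X[OF that] x(2) k2 by auto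
          moreover have "x \<in> set c" "z \<in> set c" using x(1) that by (simp_all add: ats_def)
          ultimately show False using hole_no_triangle[OF G hc ab(1)] by blast
        qed
        then have "\<forall>z. ats 0 z \<longleftrightarrow> z = a \<or> z = x" using x(1) at_a by metis
        moreover have "x \<in> set c" using x(1) by (simp add: ats_def)
        then have "x \<in> {a, hd A1, last A2}" using X[OF x(1)] nb_a[of x] by simp
        ultimately show ?thesis by (rule bexI)
      next
        case False
        then have "\<forall>z. ats 0 z \<longleftrightarrow> z = a \<or> z = a" using at_a by metis
        then show ?thesis by (intro bexI[of _ a]) simp_all
      qed
      have setY: "\<exists>y\<in>{b, last A1, hd A2}. \<forall>z. ats (k - 1) z \<longleftrightarrow> z = b \<or> z = y"
      proof (cases "\<exists>x. ats (k - 1) x \<and> x \<noteq> b")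
        case True
        then obtain x where x: "ats (k - 1) x" "x \<noteq> b" by blast
        have "z = b \<or> z = x" if "ats (k - 1) z" for z
        proof (rule ccontr)
          assume "\<not> ?thesis"
          then have "adjacent G x z" "adjacent G b x" "adjacent G b z"
            using near[OF x(1) that] Y[OF x(1)] Y[OF that] x(2) k2 by auto
          moreover have "x \<in> set c" "z \<in> set c" using x(1) that by (simp_all add: ats_def)
          ultimately show False using hole_no_triangle[OF G hc ab(2)] by blast
        qed
        then have "\<forall>z. ats (k - 1) z \<longleftrightarrow> z = b \<or> z = x" using x(1) at_b by metis
        moreover have "x \<in> set c" using x(1) by (simp add: ats_def)
        then have "x \<in> {b, last A1, hd A2}" using Y[OF x(1)] nb_b[of x] by simp
        ultimately show ?thesis by (rule bexI)
      next
        case False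
        then have "\<forall>z. ats (k - 1) z \<longleftrightarrow> z = b \<or> z = b" using at_b by metis
        then show ?thesis by (intro bexI[of _ b]) simp_all
      qed
      obtain x where x: "x \<in> {a, hd A1, last A2}" and at0: "\<And>z. ats 0 z \<longleftrightarrow> z = a \<or> z = x"
        using setX by blast
      obtain y where y: "y \<in> {b, last A1, hd A2}" and atk: "\<And>z. ats (k - 1) z \<longleftrightarrow> z = b \<or> z = y"
        using setY by blast
      have xy: "x \<noteq> y" using disj at0 atk by blast
      note XY = attXY[unfolded at0 atk]
      have k2': "2 \<le> length vs" using k2 by (simp add: k_def)
      have two: "2 \<le> length A" if "A \<noteq> []" "hd A \<noteq> last A" for A :: "'a list"
        using that by (cases A) (auto simp: Suc_le_eq)
      \<comment> \<open>If only the first end sees an edge of the hole, the path is reversed so that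
        its head faces the apex \<open>b\<close>.\<close>
      have rv: "induced_path G (rev vs)" "set (rev vs) \<inter> set c = {}" "2 \<le> length (rev vs)"
        using induced_path_rev[OF G ip] vsC k2' by auto
      have XYr: "adjacent G x' v \<longleftrightarrow> (x' = a \<or> x' = x) \<and> v = last (rev vs) \<or> (x' = b \<or> x' = y) \<and> v = hd (rev vs)"
        if "x' \<in> set c" "v \<in> set (rev vs)" for x' v
        using XY[of x' v] that by (auto simp: hd_rev last_rev)
      have h3: "hole G (A1 @ b # A2 @ [a])" "hole G (A2 @ a # A1 @ [b])"
        using rot[of "[a]" "A1 @ b # A2"] rot[of "[b]" "A2 @ a # A1"] h h2 by simp_all
      show False
      \<comment> \<open>Each end sees one vertex or an edge of the hole. With no edge this is a
        theta, with one edge a pyramid, with two edges a prism.\<close>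
      proof (cases "x = a"; cases "y = b")
        assume "x = a" "y = b"
        then show False using XY by (intro attach_theta[OF us ip vsC hc h setc ne]) auto
      next
        assume xa: "x = a" and "y \<noteq> b"
        then consider "y = last A1" | "y = hd A2" using y by auto
        then show False
        proof cases
          case 1
          show False
            by (rule attach_pyramid[OF us ip vsC hc, of "b # A2" a A1])
              (use h2 setc ne k2' XY xa 1 in auto)
        next
          case 2
          show False
            by (rule attach_pyramid[OF us ip vsC hc, of A2 a "A1 @ [b]"])
              (use h3 setc ne k2' XY xa 2 in auto)
        qed
      next
        assume "x \<noteq> a" and yb: "y = b"
        then consider "x = hd A1" | "x = last A2" using x by auto
        then show False
        proof cases
          case 1
          show False
            by (rule attach_pyramid[OF us rv(1,2) hc, of A1 b "A2 @ [a]"])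
              (use h3 setc ne rv XYr yb 1 in auto)
        next
          case 2
          show False
            by (rule attach_pyramid[OF us rv(1,2) hc, of "a # A1" b A2])
              (use h setc ne rv XYr yb 2 in auto)
        qed
      next
        assume "x \<noteq> a" "y \<noteq> b"
        then consider "x = hd A1" "y = last A1" | "x = hd A1" "y = hd A2" |
            "x = last A2" "y = last A1" | "x = last A2" "y = hd A2" using x y by auto
        then show False
        proof cases
          \<comment> \<open>Here and in the last case both further attachments lie on the same arc,
            and \<open>xy\<close> ensures that this arc has at least two vertices.\<close>
          case 1
          show False
            by (rule attach_prism[OF us ip vsC hc, of A1 "b # A2 @ [a]"])
              (use h3 setc ne k2' XY 1 two[of A1] xy in auto)
        next
          case 2
          show False
            by (rule attach_prism[OF us ip vsC hc, of "A1 @ [b]" "A2 @ [a]"])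
              (use h3 setc ne k2' XY 2 xy in \<open>auto simp: Suc_le_eq\<close>)
        next
          case 3
          show False
            by (rule attach_prism[OF us ip vsC hc, of "a # A1" "b # A2"])
              (use h setc ne k2' XY 3 xy in \<open>auto simp: Suc_le_eq\<close>)
        next
          case 4
          show False
            by (rule attach_prism[OF us ip vsC hc, of "a # A1 @ [b]" A2])
              (use h setc ne k2' XY 4 two[of A2] xy in \<open>auto\<close>)
        qed
      qed
    qed
  qed
qed

lemma induced_path_split_ends:
  assumes "simple_graph G" "induced_path G p" "hd p = x" "last p = y" "x \<noteq> y" "\<not> adjacent G x y"
  obtains m where "p = x # m @ [y]" "m \<noteq> []"
proof -
  have "p \<noteq> []" using assms(2) by (simp add: induced_path_def is_path_def)
  then obtain q where "p = x # q" using assms(3) by (cases p) auto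
  moreover from this have "q \<noteq> []" using assms(4,5) by auto
  ultimately have q: "p = x # q" "q \<noteq> []" by auto
  have "last q = y" using q assms(4) by simp
  then have "q = butlast q @ [y]" by (metis q(2) append_butlast_last_id)
  then have p: "p = x # butlast q @ [y]" using q by simp
  moreover have "butlast q \<noteq> []"
  proof
    assume "butlast q = []"
    then have "p = [x] @ [y]" using p by simp
    then show False using assms(1,2,6) induced_path_append[OF assms(1), of "[x]" "[y]"] by auto
  qed
  ultimately show ?thesis using that by blast
qed

text \<open>The paths through \<open>K\<close> and \<open>L\<close> close up to a
  hole through \<open>d1\<close> and \<open>d2\<close>, and \<open>d3\<close> connects its two sides.\<close>

lemma separator_clique_or_pair:
  assumes us: "universally_signable G" and KL: "K \<subseteq> verts G" "L \<subseteq> verts G" "K \<inter> L = {}"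
    and conn: "\<And>x y. x \<in> K \<Longrightarrow> y \<in> K \<Longrightarrow> (x, y) \<in> joined G K" "\<And>x y. x \<in> L \<Longrightarrow> y \<in> L \<Longrightarrow> (x, y) \<in> joined G L"
    and anti: "\<And>x y. x \<in> K \<Longrightarrow> y \<in> L \<Longrightarrow> \<not> adjacent G x y"
    and d: "\<And>d. d \<in> {d1, d2, d3} \<Longrightarrow> d \<in> verts G - K - L \<and> (\<exists>k\<in>K. adjacent G d k) \<and> (\<exists>l\<in>L. adjacent G d l)"
    and dist: "d1 \<noteq> d2" "d1 \<noteq> d3" "d2 \<noteq> d3"
  shows "adjacent G d1 d2"
proof (rule ccontr)
  assume nadj: "\<not> adjacent G d1 d2"
  have G: "simple_graph G" using us by (simp add: universally_signable_def)
  \<comment> \<open>A shortest path between \<open>d1\<close> and \<open>d2\<close> through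
    \<open>M\<close> has its interior in \<open>M\<close>, and the interior is nonempty because the
    ends are not adjacent.\<close>
  have path: "\<exists>m. induced_path G (d1 # m @ [d2]) \<and> m \<noteq> [] \<and> set m \<subseteq> M"
    if M: "M \<subseteq> verts G" "\<And>x y. x \<in> M \<Longrightarrow> y \<in> M \<Longrightarrow> (x, y) \<in> joined G M"
     "\<exists>k\<in>M. adjacent G d1 k" "\<exists>k\<in>M. adjacent G d2 k" for M
  proof -
    obtain k1 k2 where k: "k1 \<in> M" "adjacent G d1 k1" "k2 \<in> M" "adjacent G d2 k2" using M by blast
    let ?S = "insert d1 (insert d2 M)"
    have "(k1, k2) \<in> joined G ?S" using M(2)[of k1 k2] k joined_mono[of M ?S G] by blast
    then have "(d1, d2) \<in> joined G ?S"
      using k joined_edge[of d1 ?S k1 G] joined_edge[of k2 ?S d2 G] joined_trans[of d1 k1 G ?S k2]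
        joined_trans[of d1 k2 G ?S d2] by (simp add: adjacent_commute)
    moreover have "?S \<subseteq> verts G" using M d by auto
    ultimately obtain p where p: "induced_path G p" "hd p = d1" "last p = d2" "set p \<subseteq> ?S"
      using joined_induced_path[OF G] by blast
    then obtain m where m: "p = d1 # m @ [d2]" "m \<noteq> []"
      using induced_path_split_ends[OF G _ _ _ dist(1) nadj] by metis
    then have "distinct (d1 # m @ [d2])" using p by (simp add: induced_path_def is_path_def)
    then show ?thesis using m p by (intro exI[of _ m]) auto
  qed
  obtain m1 where m1: "induced_path G (d1 # m1 @ [d2])" "m1 \<noteq> []" "set m1 \<subseteq> K"
    using path[of K] KL(1) conn(1) d by blast
  obtain m2 where m2: "induced_path G (d1 # m2 @ [d2])" "m2 \<noteq> []" "set m2 \<subseteq> L"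
    using path[of L] KL(2) conn(2) d by blast
  let ?c = "(d1 # m1 @ [d2]) @ rev m2"
  have e1: "adjacent G d1 y \<longleftrightarrow> y = hd m2" if "y \<in> set m2" for y
    using induced_path_append[OF G, of "[d1]" "m2 @ [d2]"] m2 that by auto
  have e2: "adjacent G y d2 \<longleftrightarrow> y = last m2" if "y \<in> set m2" for y
    using induced_path_append[OF G, of "d1 # m2" "[d2]"] m2 that by auto
  have ip2: "induced_path G m2"
    using induced_path_append[OF G, of "[d1]" "m2 @ [d2]"] induced_path_append[OF G, of "m2" "[d2]"] m2 by auto
  have hc: "hole G ?c"
  proof (subst hole_append[OF G], simp, use m2 in simp, intro conjI ballI)
    show "4 \<le> length (d1 # m1 @ [d2]) + length (rev m2)" using m1 m2 by (cases m1; cases m2) auto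
    show "induced_path G (rev m2)" using ip2 by (rule induced_path_rev[OF G])
    show "set (d1 # m1 @ [d2]) \<inter> set (rev m2) = {}"
      using m1 m2 KL d by auto
    show "adjacent G x y \<longleftrightarrow> x = last (d1 # m1 @ [d2]) \<and> y = hd (rev m2) \<or>
       x = hd (d1 # m1 @ [d2]) \<and> y = last (rev m2)"
      if "x \<in> set (d1 # m1 @ [d2])" "y \<in> set (rev m2)" for x y
    proof -
      have "y \<in> L" "y \<in> set m2" and x: "x \<in> insert d1 (insert d2 (set m1))" using that m2 by auto
      then consider "x = d1" | "x = d2" | "x \<in> K" using m1(3) by auto
      then show ?thesis
      proof cases
        case 1
        then show ?thesis using e1[OF \<open>y \<in> set m2\<close>] dist m2 by (auto simp: hd_rev last_rev)
      next
        case 2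
        then show ?thesis using e2[OF \<open>y \<in> set m2\<close>] dist m2
          by (auto simp: hd_rev last_rev adjacent_commute[of G d2])
      next
        case 3
        then show ?thesis using anti[OF 3 \<open>y \<in> L\<close>] d by auto
      qed
    qed
  qed (use m1 in auto)
  \<comment> \<open>From \<open>d3\<close> one enters the connected set \<open>M\<close> and stops
    just before the first vertex of \<open>m\<close>; until then no vertex of the hole is
    met.\<close>
  have reach: "\<exists>v a. a \<in> set m \<and> adjacent G v a \<and> (d3, v) \<in> joined G (verts G - set ?c)"
    if M: "M \<subseteq> verts G" "\<And>x y. x \<in> M \<Longrightarrow> y \<in> M \<Longrightarrow> (x, y) \<in> joined G M" "\<exists>k\<in>M. adjacent G d3 k"
      "d3 \<notin> M" "set m \<subseteq> M" "m \<noteq> []" "insert d3 M - set m \<subseteq> verts G - set ?c" for M m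
  proof -
    obtain k where k: "k \<in> M" "adjacent G d3 k" using M by blast
    let ?S = "insert d3 M"
    have "(k, hd m) \<in> joined G ?S" using M(2)[of k "hd m"] M k joined_mono[of M ?S G] hd_in_set[of m] by blast
    then have "(d3, hd m) \<in> joined G ?S"
      using joined_edge[of d3 ?S k G] k joined_trans[of d3 k G ?S "hd m"] by simp
    moreover have "d3 \<notin> set m" using M(4,5) by blast
    ultimately obtain v a where "a \<in> set m" "adjacent G v a" "(d3, v) \<in> joined G (?S - set m)"
      using joined_first_hit[of d3 "hd m" G ?S "set m"] M by auto
    moreover have "joined G (?S - set m) \<subseteq> joined G (verts G - set ?c)"
      using M(7) by (rule joined_mono)
    ultimately show ?thesis by blast
  qed
  have d3: "d3 \<in> verts G" "d3 \<notin> K" "d3 \<notin> L" "d1 \<notin> K" "d1 \<notin> L" "d2 \<notin> K" "d2 \<notin> L" using d by auto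
  have "insert d3 K - set m1 \<subseteq> verts G - set ?c" "insert d3 L - set m2 \<subseteq> verts G - set ?c"
    using KL d3 m1(3) m2(3) dist by auto
  note sub = this
  obtain v a where v: "a \<in> set m1" "adjacent G v a" "(d3, v) \<in> joined G (verts G - set ?c)"
    using reach[of K m1, OF KL(1) conn(1) _ d3(2) m1(3,2) sub(1)] d by blast
  obtain w b where w: "b \<in> set m2" "adjacent G w b" "(d3, w) \<in> joined G (verts G - set ?c)"
    using reach[of L m2, OF KL(2) conn(2) _ d3(3) m2(3,2) sub(2)] d by blast
  \<comment> \<open>Through \<open>d3\<close> the two walks combine to one that avoids the hole and
    attaches to a vertex of \<open>K\<close> and to a vertex of \<open>L\<close>, which are not
    adjacent.\<close>
  have vw: "(v, w) \<in> joined G (verts G - set ?c)" using joined_trans[OF joined_sym[OF v(3)] w(3)] .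
  have "d3 \<in> verts G - set ?c" using d3 m1 m2 dist by auto
  then have "v \<in> verts G - set ?c" using v(3) unfolding joined_def by (auto elim: rtranclE)
  moreover have "a \<in> K" "b \<in> L" using v(1) w(1) m1(3) m2(3) by blast+
  then have "a \<noteq> b" "\<not> adjacent G a b" using KL(3) anti by blast+
  ultimately show False
    using hole_attachment[OF us hc, of "verts G - set ?c" v w a b] vw v w by (auto simp: adjacent_commute)
qed

section \<open>Contracting breadth-first layers\<close>

subsection \<open>Walks and distances\<close>

definition adj_rel :: "'a ugraph \<Rightarrow> ('a \<times> 'a) set" where
  "adj_rel G = {(u, v). adjacent G u v}"

definition reaches :: "'a ugraph \<Rightarrow> nat \<Rightarrow> 'a \<Rightarrow> 'a \<Rightarrow> bool" where
  "reaches G k u v \<longleftrightarrow> (\<exists>j\<le>k. (u, v) \<in> adj_rel G ^^ j)"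

lemma reaches_refl: "reaches G k u u"
  unfolding reaches_def by (intro exI[of _ 0]) auto

lemma reaches_adjacent: "adjacent G u v \<Longrightarrow> reaches G 1 u v"
  unfolding reaches_def by (intro exI[of _ 1]) (auto simp: adj_rel_def)

lemma reaches_mono: "reaches G k u v \<Longrightarrow> k \<le> l \<Longrightarrow> reaches G l u v"
  unfolding reaches_def by (meson order_trans)

lemma reaches_trans: "reaches G k u v \<Longrightarrow> reaches G l v w \<Longrightarrow> reaches G (k + l) u w"
  unfolding reaches_def by (metis add_mono relcompI relpow_add)

lemma relpow_sym: "R\<inverse> = R \<Longrightarrow> (x, y) \<in> R ^^ k \<Longrightarrow> (y, x) \<in> R ^^ k"
proof (induction k arbitrary: y)
  case (Suc k)
  then obtain z where "(z, x) \<in> R ^^ k" "(z, y) \<in> R" by auto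
  then show ?case using Suc.prems(1) relpow_Suc_I2 by (metis converseI)
qed auto

lemma reaches_sym: "reaches G k u v \<Longrightarrow> reaches G k v u"
proof -
  have "(adj_rel G)\<inverse> = adj_rel G" by (auto simp: adj_rel_def adjacent_commute)
  then show "reaches G k u v \<Longrightarrow> reaches G k v u"
    unfolding reaches_def using relpow_sym by metis
qed

lemma reaches_adjacent_trans: "reaches G k u v \<Longrightarrow> adjacent G v w \<Longrightarrow> reaches G (Suc k) u w"
  using reaches_trans[OF _ reaches_adjacent] by fastforce

lemma relpow_walk_list:
  assumes "(u, v) \<in> adj_rel G ^^ k"
  shows "\<exists>p. length p = Suc k \<and> hd p = u \<and> last p = v \<and> successively (adjacent G) p"
  using assms
proof (induction k arbitrary: v)
  case 0
  then show ?case by (intro exI[of _ "[u]"]) auto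
next
  case (Suc k)
  then obtain w where w: "(u, w) \<in> adj_rel G ^^ k" "adjacent G w v" by (auto simp: adj_rel_def)
  then obtain p where "length p = Suc k" "hd p = u" "last p = w" "successively (adjacent G) p"
    using Suc.IH by blast
  then show ?case using w(2)
    by (intro exI[of _ "p @ [v]"]) (auto simp: successively_append_iff hd_append)
qed

lemma walk_list_verts:
  assumes "simple_graph G" "successively (adjacent G) p" "hd p \<in> verts G"
  shows "set p \<subseteq> verts G"
  using assms(2,3)
  by (induction p rule: induct_list012) (auto dest: adjacent_verts[OF assms(1)])

text \<open>The distance ranges over paths, and a shortest walk between the given ends is a
  path.\<close>

lemma graph_dist_le_walk:
  assumes G: "simple_graph G" and u: "u \<in> verts G" and w: "(u, v) \<in> adj_rel G ^^ k"
  shows "graph_dist G u v \<le> enat k"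
proof -
  let ?Q = "\<lambda>p. p \<noteq> [] \<and> hd p = u \<and> last p = v \<and> successively (adjacent G) p"
  obtain p where p: "length p = Suc k" "?Q p" using relpow_walk_list[OF w] by fastforce
  then obtain q where q: "?Q q" "\<And>q'. ?Q q' \<Longrightarrow> length q \<le> length q'"
    using ex_has_least_nat[of ?Q p length] by blast
  then have "induced_path G q"
    using u walk_list_verts[OF G, of q] by (intro shortest_walk_induced[OF G]) auto
  then have "is_path_between G u q v"
    using q by (simp add: is_path_between_def induced_path_def)
  then have "graph_dist G u v \<le> enat (length q - 1)"
    unfolding graph_dist_def by (intro INF_lower) simp
  also have "\<dots> \<le> enat k" using q(2)[of p] p by simp
  finally show ?thesis .
qed

lemma graph_dist_le_reaches:
  "simple_graph G \<Longrightarrow> u \<in> verts G \<Longrightarrow> reaches G k u v \<Longrightarrow> graph_dist G u v \<le> enat k"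
  unfolding reaches_def by (meson enat_ord_simps(1) graph_dist_le_walk order_trans)

text \<open>A finite infimum of extended natural numbers is attained.\<close>

lemma graph_dist_walk:
  assumes "graph_dist G u v = enat k"
  shows "(u, v) \<in> adj_rel G ^^ k"
proof -
  let ?A = "(\<lambda>p. enat (length p - 1)) ` {p. is_path_between G u p v}"
  have "Inf ?A = enat k" using assms by (simp add: graph_dist_def)
  moreover from this have "?A \<noteq> {}" by (auto simp: Inf_enat_def split: if_splits)
  ultimately have "enat k \<in> ?A" by (metis (no_types, lifting) Inf_enat_def LeastI ex_in_conv)
  then obtain p where p: "is_path_between G u p v" "k = length p - 1" by auto
  then show ?thesis
    unfolding relpow_fun_conv
    by (intro exI[of _ "\<lambda>i. p ! i"])
      (auto simp: is_path_between_def is_path_def adj_rel_def hd_conv_nth last_conv_nth)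
qed

lemma graph_dist_le_add:
  assumes "\<And>k. (u, v) \<in> adj_rel H ^^ k \<Longrightarrow> graph_dist G u v \<le> enat (k + c)"
  shows "graph_dist G u v \<le> graph_dist H u v + enat c"
proof (cases "graph_dist H u v")
  case (enat k)
  then show ?thesis using assms[OF graph_dist_walk[OF enat]] by simp
qed simp

subsection \<open>Breadth-first layers\<close>

text \<open>The layers are characterised by local conditions on parents and edges, the ones that the
  search establishes. Together they force \<open>lay\<close> to be the distance from vertex
  0.\<close>

locale bfs_layers =
  fixes G :: "nat ugraph" and lay par :: "nat \<Rightarrow> nat"
  assumes us: "universally_signable G"
    and root: "0 \<in> verts G" "lay 0 = 0"
    and par_adj: "v \<in> verts G \<Longrightarrow> v \<noteq> 0 \<Longrightarrow> adjacent G v (par v)"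
    and par_lay: "v \<in> verts G \<Longrightarrow> v \<noteq> 0 \<Longrightarrow> lay v = Suc (lay (par v))"
    and lay_edge: "adjacent G u v \<Longrightarrow> lay u \<le> Suc (lay v)"
begin

lemma simple: "simple_graph G" using us by (simp add: universally_signable_def)

lemma adj_sym: "adjacent G u v \<Longrightarrow> adjacent G v u" by (simp add: adjacent_commute)

lemma adj_verts: "adjacent G u v \<Longrightarrow> u \<in> verts G \<and> v \<in> verts G"
  by (rule adjacent_verts[OF simple])

definition above :: "nat \<Rightarrow> nat set" where
  "above r = {w \<in> verts G. r \<le> lay w}"

definition below :: "nat \<Rightarrow> nat \<Rightarrow> bool" where
  "below v u \<longleftrightarrow> adjacent G v u \<and> lay v = Suc (lay u)"

lemma below_verts: "below v u \<Longrightarrow> v \<in> verts G \<and> u \<in> verts G"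
  unfolding below_def using adj_verts by blast

lemma below_par: "v \<in> verts G \<Longrightarrow> v \<noteq> 0 \<Longrightarrow> below v (par v)"
  by (simp add: below_def par_adj par_lay)

lemma lay_0: "v \<in> verts G \<Longrightarrow> lay v = 0 \<longleftrightarrow> v = 0"
  using root(2) par_lay[of v] by (metis Zero_not_Suc)

lemma lay_Suc_ne_0: "lay v = Suc k \<Longrightarrow> v \<noteq> 0"
  using root(2) by (metis Zero_not_Suc)

text \<open>All vertices of a walk from \<open>l\<close> lie in the component of \<open>l\<close>,
  so the component is connected by walks of its own.\<close>

lemma joined_component:
  assumes "l \<in> S" "(l, x) \<in> joined G S"
  shows "(l, x) \<in> joined G {w. (l, w) \<in> joined G S}"
  using assms(2) unfolding joined_def[of G S]
proof (induction rule: rtrancl_induct)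
  case base
  then show ?case by (simp add: joined_refl)
next
  case (step y z)
  then have "(l, y) \<in> joined G S" "(l, z) \<in> joined G S"
    unfolding joined_def by (auto intro: rtrancl_into_rtrancl)
  then have "(y, z) \<in> joined G {w. (l, w) \<in> joined G S}" using step(2) by (intro joined_edge) auto
  then show ?case using step(3) joined_trans unfolding joined_def[of G S] by fast
qed

lemma joined_subset: "(x, y) \<in> joined G S \<Longrightarrow> x \<in> S \<Longrightarrow> y \<in> S"
  unfolding joined_def by (auto elim: rtranclE)

lemma joined_root:
  assumes "x \<in> verts G" "lay x < r"
  shows "(0, x) \<in> joined G {w \<in> verts G. lay w < r}"
  using assms
proof (induction "lay x" arbitrary: x)
  case 0
  then show ?case using lay_0 by (simp add: joined_refl)
next
  case (Suc k)
  then have x: "x \<noteq> 0" using lay_Suc_ne_0 by metis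
  let ?L = "{w \<in> verts G. lay w < r}"
  have "lay (par x) = k" "par x \<in> verts G" using Suc x par_lay par_adj adj_verts by fastforce+
  then have "(0, par x) \<in> joined G ?L" "(par x, x) \<in> joined G ?L"
    using Suc x adj_sym[OF par_adj] by (auto intro!: joined_edge)
  then show ?case by (rule joined_trans)
qed

text \<open>\<open>K\<close> is the component of \<open>l\<close> in the layers above
  \<open>r\<close>, and \<open>L\<close> consists of the layers below \<open>r\<close>, connected
  through the root. Every \<open>d\<close> sees \<open>K\<close> by assumption and \<open>L\<close>
  through its parent.\<close>

lemma lower_neighbours_clique_or_pair:
  assumes l: "l \<in> above (Suc r)"
    and d: "\<And>d. d \<in> {d1, d2, d3} \<Longrightarrow> lay d = r \<and> (\<exists>w. adjacent G d w \<and> (l, w) \<in> joined G (above (Suc r)))"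
    and dist: "d1 \<noteq> d2" "d1 \<noteq> d3" "d2 \<noteq> d3"
  shows "adjacent G d1 d2"
proof -
  define K L where "K = {w. (l, w) \<in> joined G (above (Suc r))}" and "L = {w \<in> verts G. lay w < r}"
  have K: "x \<in> verts G" "Suc r \<le> lay x" "(l, x) \<in> joined G K" if "x \<in> K" for x
    using joined_subset[OF _ l, of x] joined_component[OF l, of x] that unfolding K_def above_def by blast+
  have L: "x \<in> verts G" "lay x < r" "(0, x) \<in> joined G L" if "x \<in> L" for x
    using joined_root[of x r] that unfolding L_def by blast+
  have dV: "d \<in> verts G" "lay d = r" "\<exists>w\<in>K. adjacent G d w" if "d \<in> {d1, d2, d3}" for d
    using d[OF that] adj_verts unfolding K_def by blast+
  \<comment> \<open>Layer 0 contains only the root, whereas \<open>d1\<close> and \<open>d2\<close>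
    differ.\<close>
  have "r \<noteq> 0"
    using dist(1) lay_0[of d1] lay_0[of d2] dV(1,2)[of d1] dV(1,2)[of d2] by auto
  show ?thesis
  proof (rule separator_clique_or_pair[where K = K and L = L])
    show "K \<subseteq> verts G" "L \<subseteq> verts G" using K(1) L(1) by blast+
    show "K \<inter> L = {}" using K(2) L(2) by fastforce
    show "(x, y) \<in> joined G K" if "x \<in> K" "y \<in> K" for x y
      using joined_trans[OF joined_sym[OF K(3)[OF that(1)]] K(3)[OF that(2)]] .
    show "(x, y) \<in> joined G L" if "x \<in> L" "y \<in> L" for x y
      using joined_trans[OF joined_sym[OF L(3)[OF that(1)]] L(3)[OF that(2)]] .
    show "\<not> adjacent G x y" if "x \<in> K" "y \<in> L" for x y
      using lay_edge[of x y] K(2)[OF that(1)] L(2)[OF that(2)] by linarith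
    show "d \<in> verts G - K - L \<and> (\<exists>k\<in>K. adjacent G d k) \<and> (\<exists>l\<in>L. adjacent G d l)"
      if "d \<in> {d1, d2, d3}" for d
    proof -
      have "d \<noteq> 0" using dV(2)[OF that] \<open>r \<noteq> 0\<close> root by metis
      then have "below d (par d)" using below_par dV(1)[OF that] by simp
      then have "par d \<in> L" "adjacent G d (par d)"
        using below_verts[of d "par d"] dV(2)[OF that] by (simp_all add: L_def below_def)
      moreover have "d \<notin> K" "d \<notin> L" using K(2)[of d] L(2)[of d] dV(2)[OF that] by auto
      ultimately show ?thesis using dV[OF that] by blast
    qed
  qed (use us dist in auto)
qed

end

subsection \<open>Contracting the clusters\<close>

text \<open>\<open>two l\<close> is a lower neighbour of the cluster \<open>l\<close> other than \<open>par l\<close>, if there is one, and \<open>rp l\<close> a vertex of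
  the cluster with such a lower neighbour.\<close>

locale clustering = bfs_layers +
  fixes lab two rp :: "nat \<Rightarrow> nat"
  assumes lab_in: "v \<in> verts G \<Longrightarrow> lab v \<in> verts G"
    and lab_lab: "v \<in> verts G \<Longrightarrow> lab (lab v) = lab v"
    and lab_lay: "v \<in> verts G \<Longrightarrow> lay (lab v) = lay v"
    and lab_same: "adjacent G u v \<Longrightarrow> lay u = lay v \<Longrightarrow> lab u = lab v"
    and lab_below: "below v u \<Longrightarrow> below v' u' \<Longrightarrow> lab v = lab v' \<Longrightarrow> lab u = lab u'"
    and lab_joined: "v \<in> verts G \<Longrightarrow> (lab v, v) \<in> joined G (above (lay v))"
    and two_below: "below v u \<Longrightarrow> \<exists>w. lab w = lab v \<and> below w (two (lab v))"
    and two_ne: "below v u \<Longrightarrow> u \<noteq> par (lab v) \<Longrightarrow> two (lab v) \<noteq> par (lab v)"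
    and rp: "below v u \<Longrightarrow> u \<noteq> par (lab v) \<Longrightarrow> lab (rp (lab v)) = lab v \<and>
      (\<exists>u'. below (rp (lab v)) u' \<and> u' \<noteq> par (lab v))"
begin

text \<open>In a cluster that is not merged every vertex has a single lower neighbour; it keeps one representative
  above each of \<open>par l\<close> and \<open>two l\<close>. Merged clusters have bounded diameter and keep one representative.\<close>

definition merged :: "nat \<Rightarrow> bool" where
  "merged l \<longleftrightarrow> (\<exists>v u. lab v = l \<and>
     (adjacent G v u \<and> lay u = lay v \<and> par u \<noteq> par v \<or>
      below v u \<and> (u \<noteq> par v \<or> u \<noteq> par l \<and> u \<noteq> two l)))"

definition rho :: "nat \<Rightarrow> nat" where
  "rho v = (if merged (lab v) \<or> par v = par (lab v) then lab v else rp (lab v))"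

text \<open>The instances with \<open>x = v\<close> keep the contracted vertices in the graph,
  attached to representatives one layer down.\<close>

definition contraction :: "nat ugraph" where
  "contraction = \<lparr> verts = verts G, edges = {{x, rho u} | x v u. below v u \<and> (x = v \<or> x = rho v)} \<rparr>"

lemma same_lab_lay: "u \<in> verts G \<Longrightarrow> v \<in> verts G \<Longrightarrow> lab u = lab v \<Longrightarrow> lay u = lay v"
  by (metis lab_lay)

lemma lab_0: "lab 0 = 0"
  using root lab_lay[of 0] lab_in[of 0] lay_0[of "lab 0"] by metis

lemma not_merged_below: "\<not> merged (lab v) \<Longrightarrow> below v u \<Longrightarrow> u = par v"
  unfolding merged_def by blast

lemma not_merged_two: "\<not> merged (lab v) \<Longrightarrow> below v u \<Longrightarrow> u = par (lab v) \<or> u = two (lab v)"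
  unfolding merged_def by blast

text \<open>The interesting part is idempotence at \<open>rp l\<close>: it has a lower neighbour
  other than \<open>par l\<close>, and in an unmerged cluster this can only be its own
  parent.\<close>

lemma rho_props:
  assumes v: "v \<in> verts G"
  shows "lab (rho v) = lab v \<and> rho v \<in> verts G \<and> lay (rho v) = lay v \<and> rho (rho v) = rho v"
proof (cases "merged (lab v) \<or> par v = par (lab v)")
  case True
  then show ?thesis using v lab_in lab_lab lab_lay by (simp add: rho_def)
next
  case False
  then have r: "rho v = rp (lab v)" by (simp add: rho_def)
  have "v \<noteq> 0" using False lab_0 by metis
  then have b: "below v (par v)" using v below_par by simp
  obtain u where u: "below (rp (lab v)) u" "u \<noteq> par (lab v)" and l: "lab (rp (lab v)) = lab v"
    using rp[OF b] False by auto
  then have "u = par (rp (lab v))" using not_merged_below[of "rp (lab v)" u] False by simp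
  then have "rho (rp (lab v)) = rp (lab v)" using u l False by (simp add: rho_def)
  then show ?thesis using r l below_verts[OF u(1)] same_lab_lay[of "rp (lab v)" v] v by auto
qed

lemmas rho_lab = rho_props[THEN conjunct1]
  and rho_in = rho_props[THEN conjunct2, THEN conjunct1]
  and rho_lay = rho_props[THEN conjunct2, THEN conjunct2, THEN conjunct1]
  and rho_idem = rho_props[THEN conjunct2, THEN conjunct2, THEN conjunct2]

lemma rho_merged: "merged (lab v) \<Longrightarrow> rho v = lab v"
  by (simp add: rho_def)

text \<open>In an unmerged cluster the only lower neighbours are \<open>par l\<close> and
  \<open>two l\<close>, and the representative records which of them a vertex has. The two
  representatives differ because their parents do.\<close>

lemma rho_same_par:
  assumes v: "v \<in> verts G" "w \<in> verts G" and nc: "\<not> merged (lab v)" and eq: "lab v = lab w" "rho v = rho w"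
  shows "par v = par w"
proof (cases "v = 0")
  case True
  then show ?thesis using v eq same_lab_lay[of v w] lay_0[of w] root by simp
next
  case False
  then have "w \<noteq> 0" using v eq same_lab_lay[of v w] lay_0[of v] root by metis
  have *: "par x = par (lab v) \<and> rho x = lab v \<or> par x = two (lab v) \<and> par x \<noteq> par (lab v) \<and> rho x = rp (lab v)"
    if "x \<in> verts G" "x \<noteq> 0" "lab x = lab v" for x
    using not_merged_two[of x "par x"] that nc below_par[of x] by (auto simp: rho_def)
  have "rp (lab v) \<noteq> lab v" if x: "x \<in> verts G" "x \<noteq> 0" "lab x = lab v" "par x \<noteq> par (lab v)" for x
  proof
    assume e: "rp (lab v) = lab v"
    have "below x (par x)" using x below_par by simp
    then obtain u where u: "below (lab v) u" "u \<noteq> par (lab v)" using rp[of x "par x"] x e by auto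
    then show False using not_merged_below[of "lab v" u] nc v(1) lab_lab by simp
  qed
  then show ?thesis using *[of v] *[of w] v eq False \<open>w \<noteq> 0\<close> by metis
qed

lemma rho_same_layer:
  assumes "adjacent G u v" "lay u = lay v"
  shows "rho u = rho v"
proof -
  have l: "lab u = lab v" using assms by (rule lab_same)
  have "merged (lab v) \<or> par u = par v"
    unfolding merged_def using assms adj_sym by metis
  then show ?thesis using l by (auto simp: rho_def)
qed

text \<open>The bound is 1 + 3 + 1: down to a lower neighbour, across, and up again. Lower
  neighbours are pairwise adjacent unless there are exactly two, and in that case the reason for
  merging connects these within three steps.\<close>

lemma merged_reaches:
  assumes c: "merged (lab a)" and ab: "a \<in> verts G" "b \<in> verts G" "lab a = lab b"
  shows "reaches G 5 a b"
proof (cases "a = 0")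
  case True
  then have "b = 0" using ab same_lab_lay[of a b] lay_0[of b] root by simp
  then show ?thesis using True by (simp add: reaches_refl)
next
  case False
  define l where "l = lab a"
  have nz: "v \<noteq> 0" if "v \<in> verts G" "lab v = l" for v
    using that ab False same_lab_lay[of a v] lay_0[of a] root unfolding l_def by metis
  have lp: "below v (par v)" if "v \<in> verts G" "lab v = l" for v using that nz below_par by simp
  define low where "low d \<longleftrightarrow> (\<exists>v. lab v = l \<and> below v d)" for d
  have la: "l \<in> verts G" "lab l = l" using ab lab_in lab_lab by (auto simp: l_def)
  have tri: "adjacent G d1 d2" if "low d1" "low d2" "low d3" "d1 \<noteq> d2" "d1 \<noteq> d3" "d2 \<noteq> d3" for d1 d2 d3
  proof (rule lower_neighbours_clique_or_pair[of l "lay (par l)" d1 d2 d3])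
    have ll: "Suc (lay (par l)) = lay l" using lp[OF la] by (simp add: below_def)
    then show "l \<in> above (Suc (lay (par l)))" using la by (simp add: above_def)
    show "lay d = lay (par l) \<and> (\<exists>w. adjacent G d w \<and> (l, w) \<in> joined G (above (Suc (lay (par l)))))"
      if d: "d \<in> {d1, d2, d3}" for d
    proof -
      have "low d" using d \<open>low d1\<close> \<open>low d2\<close> \<open>low d3\<close> by auto
      then obtain v where v: "lab v = l" "below v d" by (auto simp: low_def)
      then have "v \<in> verts G" "lay v = lay l" using below_verts la same_lab_lay[of v l] by auto
      moreover have "adjacent G d v" "lay v = Suc (lay d)"
        using v(2) by (simp_all add: below_def adjacent_commute[of G d])
      ultimately show ?thesis using v(1) lab_joined[of v] ll by auto
    qed
  qed (use that in auto)
  have near: "reaches G 3 d1 d2" if d: "low d1" "low d2" for d1 d2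
  proof (cases "d1 = d2 \<or> adjacent G d1 d2")
    case True
    then show ?thesis using reaches_refl[of G 3 d1] reaches_mono[OF reaches_adjacent, of G d1 d2 3] by auto
  next
    case far: False
    have only: "d = d1 \<or> d = d2" if "low d" for d
      using tri[OF d that] far by auto
    obtain v u where v: "lab v = l" and vu: "adjacent G v u \<and> lay u = lay v \<and> par u \<noteq> par v \<or>
        below v u \<and> (u \<noteq> par v \<or> u \<noteq> par l \<and> u \<noteq> two l)"
      using c by (auto simp: merged_def l_def)
    have vV: "v \<in> verts G" using vu adj_verts below_verts by blast
    have pv: "low (par v)" "adjacent G v (par v)" using lp[OF vV v] v unfolding low_def by (blast, simp add: below_def)
    show ?thesis
    proof (cases "adjacent G v u \<and> lay u = lay v \<and> par u \<noteq> par v")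
      \<comment> \<open>The route is \<open>par v\<close>, \<open>v\<close>, \<open>u\<close>,
        \<open>par u\<close>.\<close>
      case True
      then have u: "u \<in> verts G" "lab u = l" using adj_verts lab_same v by metis+
      then have "low (par u)" "adjacent G u (par u)" using lp[OF u] u(2) unfolding low_def by (blast, simp add: below_def)
      then have "reaches G 3 (par v) (par u)" "reaches G 3 (par u) (par v)"
        using reaches_adjacent_trans[OF reaches_adjacent_trans[OF reaches_adjacent, of G "par v" v u], of "par u"]
          reaches_sym[of G 3 "par v" "par u"] True pv(2)
        by (simp_all add: numeral_eq_Suc adjacent_commute[of G "par v" v])
      then show ?thesis using only[OF \<open>low (par u)\<close>] only[OF pv(1)] True by metis
    next
      case False
      then have b: "below v u" and u: "u \<noteq> par v \<or> u \<noteq> par l \<and> u \<noteq> two l" using vu by auto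
      have lu: "low u" using b v by (auto simp: low_def)
      show ?thesis
      proof (cases "u = par v")
        case True
        then have u: "u \<noteq> par l" "u \<noteq> two l" using u by auto
        \<comment> \<open>Now \<open>u\<close>, \<open>par l\<close> and \<open>two l\<close> would
          be three different lower neighbours, although only \<open>d1\<close> and \<open>d2\<close>
          are possible.\<close>
        have "two l \<noteq> par l" using two_ne[OF b] u v by simp
        moreover have "low (two l)" using two_below[OF b] v by (auto simp: low_def)
        moreover have "low (par l)" using lp[OF la] la by (auto simp: low_def)
        ultimately show ?thesis using only[of u] only[of "two l"] only[of "par l"] lu u by metis
      next
        case False
        have "adjacent G v u" using b by (simp add: below_def)
        then have "reaches G 2 (par v) u"
          using pv(2) reaches_adjacent_trans[OF reaches_adjacent, of G "par v" v u]
          by (simp add: numeral_eq_Suc adjacent_commute[of G "par v" v])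
        then have "reaches G 3 (par v) u" by (rule reaches_mono) simp
        then have "reaches G 3 (par v) u" "reaches G 3 u (par v)" by (auto intro: reaches_sym)
        then show ?thesis using only[OF lu] only[OF pv(1)] False by metis
      qed
    qed
  qed
  have a: "below a (par a)" "below b (par b)" using lp[of a] lp[of b] ab by (auto simp: l_def)
  then have "low (par a)" "low (par b)" using ab unfolding low_def l_def by metis+
  then have "reaches G 3 (par a) (par b)" by (rule near)
  moreover have "reaches G 1 a (par a)" by (rule reaches_adjacent) (use a(1) in \<open>simp add: below_def\<close>)
  ultimately have "reaches G 4 a (par b)" using reaches_trans[of G 1 a "par a" 3 "par b"] by simp
  moreover have "adjacent G (par b) b" using a(2) by (simp add: below_def adjacent_commute[of G b])
  ultimately show ?thesis using reaches_adjacent_trans[of G 4 a "par b" b] by simp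
qed

text \<open>In an unmerged cluster a vertex and its representative share their parent and are two
  steps apart; the 5 is the price of the merged clusters.\<close>

lemma rho_reaches: "v \<in> verts G \<Longrightarrow> reaches G 5 v (rho v)"
proof (cases "merged (lab v) \<or> v = 0")
  assume v: "v \<in> verts G"
  case True
  then show ?thesis
  proof
    assume m: "merged (lab v)"
    have "reaches G 5 v (lab v)" using merged_reaches[OF m v lab_in[OF v]] lab_lab[OF v] by simp
    then show ?thesis using m by (simp add: rho_def)
  next
    assume "v = 0"
    then show ?thesis using lab_0 by (simp add: rho_def reaches_refl)
  qed
next
  assume v: "v \<in> verts G"
  case False
  have "par v = par (rho v)"
    using rho_same_par[OF v rho_in[OF v] _ rho_lab[OF v, symmetric] rho_idem[OF v, symmetric]] False by blast
  moreover have "rho v \<noteq> 0" using rho_lay[OF v] lay_0[OF v] root False by metis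
  ultimately have "adjacent G v (par v)" "adjacent G (par v) (rho v)"
    using par_adj[of v] par_adj[of "rho v"] rho_in[OF v] v False
    by (simp_all add: adjacent_commute[of G "par (rho v)"])
  then have "reaches G 2 v (rho v)"
    using reaches_adjacent_trans[OF reaches_adjacent] by (simp add: numeral_eq_Suc)
  then show ?thesis by (rule reaches_mono) simp
qed

section \<open>Descending chains of representatives\<close>

definition down :: "(nat \<times> nat) set" where
  "down = {(rho v, rho u) | v u. below v u}"

lemma downE:
  assumes "(x, y) \<in> down"
  obtains v u where "below v u" "x = rho v" "y = rho u"
  using assms by (auto simp: down_def)

lemma down_rep: "(x, y) \<in> down \<Longrightarrow> x \<in> verts G \<and> y \<in> verts G \<and> rho x = x \<and> rho y = y"
  by (elim downE) (auto simp: below_verts rho_in rho_idem)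

text \<open>Two traces of the chain are kept. \<open>anc\<close> descends along \<open>par\<close>
  from \<open>x\<close> without any error, but only its cluster is controlled. \<open>t\<close> has
  the current element of the chain as its representative, at error at most 5. In a merged cluster
  the error is reset by switching from \<open>anc\<close> to the required vertex; in an unmerged
  cluster \<open>t\<close> has the parent that the chain uses and just follows it. Hence errors do
  not accumulate.\<close>

lemma down_descend:
  assumes "(x, w) \<in> down ^^ j" "x \<in> verts G" "rho x = x"
  shows "\<exists>t anc. t \<in> verts G \<and> rho t = w \<and> reaches G (j + 5) x t \<and>
    anc \<in> verts G \<and> lab anc = lab w \<and> reaches G j x anc"
  using assms(1)
proof (induction j arbitrary: w)
  case 0
  then show ?case using assms(2,3) by (auto intro: reaches_refl)
next
  case (Suc j)
  then obtain w0 where w0: "(x, w0) \<in> down ^^ j" "(w0, w) \<in> down" by auto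
  then obtain t anc where t: "t \<in> verts G" "rho t = w0" "reaches G (j + 5) x t"
    and anc: "anc \<in> verts G" "lab anc = lab w0" "reaches G j x anc" using Suc.IH by blast
  obtain v u where vu: "below v u" "w0 = rho v" "w = rho u" using w0(2) by (rule downE)
  have V: "v \<in> verts G" "u \<in> verts G" using below_verts[OF vu(1)] by auto
  have l: "lab anc = lab v" "lab t = lab v" using anc vu t V rho_lab by metis+
  then have "anc \<noteq> 0" using same_lab_lay[OF anc(1) V(1)] vu(1) lay_Suc_ne_0[of anc] by (simp add: below_def)
  then have pa: "below anc (par anc)" using anc below_par by simp
  have "lab (par anc) = lab w" using lab_below[OF pa vu(1) l(1)] vu V rho_lab by simp
  moreover have "par anc \<in> verts G" "reaches G (Suc j) x (par anc)"
    using pa below_verts reaches_adjacent_trans[OF anc(3)] by (auto simp: below_def)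
  moreover have "reaches G (Suc j + 5) x u"
  proof (cases "merged (lab v)")
    case True
    then have "reaches G 5 anc v" using merged_reaches[of anc v] l anc V by simp
    then have "reaches G (j + 5) x v" using reaches_trans[OF anc(3)] by blast
    then show ?thesis using reaches_adjacent_trans vu(1) by (fastforce simp: below_def)
  next
    case False
    have "par t = par v" using rho_same_par[of t v] t V l False vu by simp
    moreover have "u = par v" using not_merged_below[OF False vu(1)] .
    moreover have "t \<noteq> 0" using same_lab_lay[OF t(1) V(1)] l vu(1) lay_Suc_ne_0[of t] by (simp add: below_def)
    ultimately have "adjacent G t u" using par_adj[OF t(1)] by simp
    then show ?thesis using reaches_adjacent_trans[OF t(3)] by simp
  qed
  ultimately show ?case using V vu by blast
qed

text \<open>Another 5 steps lead from \<open>t\<close> to its representative.\<close>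

lemma down_reaches:
  assumes "(x, w) \<in> down ^^ j" "x \<in> verts G" "rho x = x"
  shows "reaches G (j + 10) x w"
proof -
  obtain t where "t \<in> verts G" "rho t = w" "reaches G (j + 5) x t" using down_descend[OF assms] by blast
  then show ?thesis using rho_reaches[of t] reaches_trans[of G "j + 5" x t 5 w] by (simp add: add.assoc)
qed

definition twins :: "nat \<Rightarrow> nat \<Rightarrow> bool" where
  "twins a b \<longleftrightarrow> a \<in> verts G \<and> b \<in> verts G \<and> a \<noteq> b \<and> lab a = lab b \<and> rho a = a \<and> rho b = b"

text \<open>A cluster \<open>l\<close> has no representatives other than \<open>l\<close> and
  \<open>rp l\<close>.\<close>

lemma twins_unique: "twins a c \<Longrightarrow> twins b c \<Longrightarrow> a = b"
  unfolding twins_def rho_def by metis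

lemma twins_not_merged: "twins a b \<Longrightarrow> \<not> merged (lab b)"
  unfolding twins_def using rho_merged by metis

text \<open>All lower neighbours of a cluster lie in one cluster.\<close>

lemma down_twins: "(y, a) \<in> down \<Longrightarrow> (y, b) \<in> down \<Longrightarrow> a \<noteq> b \<Longrightarrow> twins a b"
proof -
  assume ya: "(y, a) \<in> down" and yb: "(y, b) \<in> down" and ne: "a \<noteq> b"
  obtain v u where vu: "below v u" "y = rho v" "a = rho u" using ya by (rule downE)
  obtain v' u' where vu': "below v' u'" "y = rho v'" "b = rho u'" using yb by (rule downE)
  have "lab v = lab v'" using vu vu' below_verts rho_lab by metis
  then have "lab u = lab u'" using lab_below vu vu' by blast
  then have "lab a = lab b" using vu vu' below_verts rho_lab by metis
  then show "twins a b" using ya yb ne down_rep by (simp add: twins_def)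
qed

text \<open>Twins have their lower neighbours in a common cluster, so a chain from one of them is
  accompanied step by step from the other. If the two meet they continue together, otherwise they
  end in twins again.\<close>

lemma twins_chain:
  assumes "twins a b" "(b, c) \<in> down ^^ n"
  shows "(a, c) \<in> down ^^ n \<or> (\<exists>c'. (a, c') \<in> down ^^ n \<and> twins c' c)"
  using assms
proof (induction n arbitrary: a b)
  case 0
  then show ?case by auto
next
  case (Suc n)
  obtain b' where b': "(b, b') \<in> down" "(b', c) \<in> down ^^ n" using Suc.prems(2) by (meson relpow_Suc_E2)
  obtain v u where vu: "below v u" "b = rho v" "b' = rho u" using b'(1) by (rule downE)
  have ab: "a \<in> verts G" "b \<in> verts G" "lab a = lab b" "rho a = a" "rho b = b"
    using Suc.prems(1) by (auto simp: twins_def)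
  have V: "v \<in> verts G" "u \<in> verts G" using below_verts[OF vu(1)] by auto
  have lv: "lab v = lab b" using vu V rho_lab by simp
  have nc: "\<not> merged (lab v)" using twins_not_merged[OF Suc.prems(1)] lv by simp
  have "lay a = lay v" using same_lab_lay[of a v] ab V lv by simp
  then have "a \<noteq> 0" using vu(1) lay_Suc_ne_0[of a] by (simp add: below_def)
  then have pa: "below a (par a)" using ab below_par by simp
  then have da: "(a, rho (par a)) \<in> down" unfolding down_def using ab(4) by force
  have "lab (par a) = lab u" using lab_below[OF pa vu(1)] ab lv by simp
  then have lab': "lab (rho (par a)) = lab b'" using rho_lab below_verts[OF pa] V vu by simp
  show ?case
  proof (cases "rho (par a) = b'")
    case True
    then show ?thesis using da b'(2) relpow_Suc_I2 by metis
  next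
    case False
    then have "twins (rho (par a)) b'" using lab' down_rep[OF da] down_rep[OF b'(1)] by (simp add: twins_def)
    then show ?thesis using Suc.IH[OF _ b'(2)] da relpow_Suc_I2 by metis
  qed
qed

text \<open>Shortest walks have at most one peak: below a peak the walk runs parallel to a second chain of
  representatives, so between two peaks there is a shortcut.\<close>

definition zigzag :: "nat \<Rightarrow> nat \<Rightarrow> nat \<Rightarrow> bool" where
  "zigzag k x y \<longleftrightarrow> (\<exists>i j p q a b c. (x, a) \<in> down ^^ i \<and> (b, a) \<in> down ^^ j \<and> (b, c) \<in> down ^^ p \<and>
     (y, c) \<in> down ^^ q \<and> i + j + p + q \<le> k)"

lemma zigzagI: "(x, a) \<in> down ^^ i \<Longrightarrow> (b, a) \<in> down ^^ j \<Longrightarrow> (b, c) \<in> down ^^ p \<Longrightarrow>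
     (y, c) \<in> down ^^ q \<Longrightarrow> i + j + p + q \<le> k \<Longrightarrow> zigzag k x y"
  unfolding zigzag_def by blast

lemma down_up_walk: "(x, a) \<in> down ^^ i \<Longrightarrow> (x, a) \<in> (down \<union> down\<inverse>) ^^ i \<and> (a, x) \<in> (down \<union> down\<inverse>) ^^ i"
proof
  assume d: "(x, a) \<in> down ^^ i"
  show *: "(x, a) \<in> (down \<union> down\<inverse>) ^^ i" using d by (induction i arbitrary: a) auto
  have "(down \<union> down\<inverse>)\<inverse> = down \<union> down\<inverse>" by auto
  then show "(a, x) \<in> (down \<union> down\<inverse>) ^^ i" using * by (rule relpow_sym)
qed

text \<open>Induction on the length, appending a step from \<open>y\<close> to \<open>z\<close>. An
  upward step prolongs the last descent from its top, and a downward step into \<open>y1\<close>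
  undoes part of it. In the remaining case \<open>z\<close> is the twin of \<open>y1\<close>, and
  the peak \<open>b\<close> has successors \<open>b1\<close> towards \<open>a\<close> and
  \<open>b2\<close> towards \<open>c\<close>. If \<open>b1\<close> also leads to \<open>c\<close>,
  the peak can be lowered to \<open>b1\<close>, and the shorter walk is treated by the induction
  hypothesis. Otherwise \<open>b1\<close> and \<open>b2\<close> are twins, and the chain from
  \<open>b1\<close> ends in the twin \<open>c'\<close> of \<open>c\<close>. The chain from
  \<open>z\<close> ends in \<open>c\<close> or in \<open>c'\<close>, and in both cases a short
  enough zigzag to \<open>z\<close> results.\<close>

lemma walk_zigzag:
  "(x, z) \<in> (down \<union> down\<inverse>) ^^ k \<Longrightarrow> zigzag k x z"
proof (induction k arbitrary: x z rule: less_induct)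
  case (less k)
  let ?W = "down \<union> down\<inverse>"
  show ?case
  proof (cases k)
    case 0
    then show ?thesis using less.prems zigzagI[of x x 0 x 0 x 0 x 0] by simp
  next
    case (Suc m)
    then obtain y where xy: "(x, y) \<in> ?W ^^ m" and yz: "(y, z) \<in> ?W" using less.prems by auto
    obtain i j p q a b c where i: "(x, a) \<in> down ^^ i" and j: "(b, a) \<in> down ^^ j"
      and p: "(b, c) \<in> down ^^ p" and q: "(y, c) \<in> down ^^ q" and le: "i + j + p + q \<le> m"
      using less.IH[OF _ xy] Suc unfolding zigzag_def by blast
    show ?thesis
    proof (cases "(y, z) \<in> down")
      case False
      then have "(z, c) \<in> down ^^ Suc q" using yz q relpow_Suc_I2[of z y down c q] by blast
      then show ?thesis by (rule zigzagI[OF i j p]) (use le Suc in simp)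
    next
      case yz: True
      show ?thesis
      proof (cases q)
        case 0
        then have "(b, z) \<in> down ^^ Suc p" using p q yz by auto
        then show ?thesis using zigzagI[OF i j, of z "Suc p" z 0] le Suc 0 by simp
      next
        case (Suc q')
        then obtain y1 where y1: "(y, y1) \<in> down" "(y1, c) \<in> down ^^ q'" using q by (meson relpow_Suc_E2)
        \<comment> \<open>Any rerouting that leaves a walk shorter than \<open>k\<close>, including
          the final step to \<open>z\<close>, is settled by the induction hypothesis.\<close>
        have step: "zigzag k x z" if w: "(x, a) \<in> down ^^ i'" "(b', a) \<in> down ^^ j'" "(b', c') \<in> down ^^ p'"
          "(y, c') \<in> down ^^ q''" "Suc (i' + j' + p' + q'') < k" for b' c' i' j' p' q''
        proof -
          have "(x, z) \<in> ?W ^^ Suc (i' + j' + p' + q'')"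
            using down_up_walk[OF w(1)] down_up_walk[OF w(2)] down_up_walk[OF w(3)] down_up_walk[OF w(4)] yz
            by (auto simp: relpow_add)
          then have "zigzag (Suc (i' + j' + p' + q'')) x z" using less.IH w(5) by blast
          then show ?thesis using w(5) unfolding zigzag_def by (meson less_imp_le order_trans)
        qed
        show ?thesis
        proof (cases "y1 = z")
          case True
          then show ?thesis using zigzagI[OF i j p, of z q'] y1 le \<open>k = Suc m\<close> Suc by simp
        next
          case y1z: False
          show ?thesis
          proof (cases p)
            case 0
            then have "(y, a) \<in> down ^^ (q + j)" using p q j by (auto simp: relpow_add)
            moreover have "(y, z) \<in> down ^^ 1" using yz by simp
            ultimately show ?thesis using zigzagI[OF i, of y "q + j" z 1 z 0] le 0 \<open>k = Suc m\<close> by simp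
          next
            case (Suc p')
            then obtain b2 where b2: "(b, b2) \<in> down" "(b2, c) \<in> down ^^ p'" using p by (meson relpow_Suc_E2)
            show ?thesis
            proof (cases j)
              case 0
              then have "(x, c) \<in> down ^^ (i + p)" using i j p by (auto simp: relpow_add)
              moreover have "(y, z) \<in> down ^^ 1" using yz by simp
              ultimately show ?thesis using zigzagI[of x c "i + p" y q z 1 z 0] q le 0 \<open>k = Suc m\<close> by simp
            next
              case (Suc j')
              then obtain b1 where b1: "(b, b1) \<in> down" "(b1, a) \<in> down ^^ j'" using j by (meson relpow_Suc_E2)
              show ?thesis
              proof (cases "(b1, c) \<in> down ^^ p'")
                case True
                then show ?thesis
                  using step[OF i b1(2) True q] le \<open>k = Suc m\<close> \<open>j = Suc j'\<close> \<open>p = Suc p'\<close> by simp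
              next
                case False
                then have "b1 \<noteq> b2" using b2 by auto
                then have "twins b1 b2" using down_twins b1 b2 by blast
                then obtain c' where c': "(b1, c') \<in> down ^^ p'" "twins c' c"
                  using twins_chain[OF _ b2(2)] False by blast
                have "twins z y1" using down_twins yz y1 y1z by blast
                from twins_chain[OF this y1(2)] show ?thesis
                proof
                  assume "(z, c) \<in> down ^^ q'"
                  then show ?thesis using zigzagI[OF i j p] le \<open>k = Suc m\<close> \<open>q = Suc q'\<close> by simp
                next
                  assume "\<exists>c''. (z, c'') \<in> down ^^ q' \<and> twins c'' c"
                  then have "(z, c') \<in> down ^^ q'" using c'(2) twins_unique by blast
                  then show ?thesis using zigzagI[OF i b1(2) c'(1)] le
                    \<open>k = Suc m\<close> \<open>q = Suc q'\<close> \<open>p = Suc p'\<close> \<open>j = Suc j'\<close> by simp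
                qed
              qed
            qed
          qed
        qed
      qed
    qed
  qed
qed

text \<open>There are four monotone pieces, each with error 10.\<close>

lemma zigzag_reaches:
  assumes "zigzag k x y" "x \<in> verts G" "rho x = x" "y \<in> verts G" "rho y = y"
  shows "reaches G (k + 40) x y"
proof -
  obtain i j p q a b c where i: "(x, a) \<in> down ^^ i" and j: "(b, a) \<in> down ^^ j"
      and p: "(b, c) \<in> down ^^ p" and q: "(y, c) \<in> down ^^ q" and le: "i + j + p + q \<le> k"
    using assms(1) unfolding zigzag_def by blast
  have rep: "v \<in> verts G \<and> rho v = v" if "(u, v) \<in> down ^^ n" "u \<in> verts G" "rho u = u" for u v n
    using that by (cases n) (auto dest: down_rep)
  have a: "a \<in> verts G \<and> rho a = a" using rep[OF i assms(2,3)] .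
  have b: "b \<in> verts G \<and> rho b = b"
  proof (cases j)
    case (Suc j')
    then obtain y where "(b, y) \<in> down" using j by (meson relpow_Suc_E2)
    then show ?thesis using down_rep by blast
  qed (use a j in auto)
  have "reaches G (i + 10) x a" "reaches G (j + 10) a b" "reaches G (p + 10) b c" "reaches G (q + 10) c y"
    using down_reaches[OF i] down_reaches[OF j] down_reaches[OF p] down_reaches[OF q] a b assms reaches_sym by auto
  then have "reaches G ((i + 10) + (j + 10) + (p + 10) + (q + 10)) x y" by (meson reaches_trans)
  then show ?thesis using le by (elim reaches_mono) simp
qed

section \<open>Distances in the contraction\<close>

lemma contraction_adjacent:
  "adjacent contraction x y \<longleftrightarrow> (\<exists>v u. below v u \<and> (x \<in> {v, rho v} \<and> y = rho u \<or> y \<in> {v, rho v} \<and> x = rho u))"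
  unfolding adjacent_def contraction_def by (auto simp: doubleton_eq_iff)

text \<open>Each edge of the contraction becomes an edge between representatives under
  \<open>rho\<close>, so the length of the walk is kept. The 50 is 40 for the zigzag and 5 at each
  end.\<close>

lemma contraction_walk_reaches:
  assumes w: "(x, y) \<in> adj_rel contraction ^^ k" and V: "x \<in> verts G" "y \<in> verts G"
  shows "reaches G (k + 50) x y"
proof -
  have "(rho x, rho y) \<in> (down \<union> down\<inverse>) ^^ k"
    using w
  proof (induction k arbitrary: y)
    case 0
    then show ?case by auto
  next
    case (Suc k)
    then obtain z where z: "(x, z) \<in> adj_rel contraction ^^ k" "adjacent contraction z y" by (auto simp: adj_rel_def)
    then have "(rho z, rho y) \<in> down \<union> down\<inverse>"
      unfolding contraction_adjacent down_def using below_verts rho_idem by auto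
    then show ?case using Suc.IH[OF z(1)] by auto
  qed
  then have "reaches G (k + 40) (rho x) (rho y)"
    using walk_zigzag zigzag_reaches rho_in rho_idem V by simp
  then have "reaches G (5 + (k + 40) + 5) x y"
    using rho_reaches[OF V(1)] reaches_sym[OF rho_reaches[OF V(2)]] by (meson reaches_trans)
  then show ?thesis by (rule reaches_mono) simp
qed

text \<open>Under \<open>rho\<close> an edge inside a layer collapses and any other edge becomes an
  edge of the contraction. A vertex is two steps away from its representative, through the
  representative of its parent; this accounts for the 4.\<close>

lemma walk_contraction_reaches:
  assumes w: "(x, y) \<in> adj_rel G ^^ k" and V: "x \<in> verts G" "y \<in> verts G"
  shows "reaches contraction (k + 4) x y"
proof -
  have "reaches contraction k (rho x) (rho y)"
    using w
  proof (induction k arbitrary: y)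
    case 0
    then show ?case by (auto simp: reaches_refl)
  next
    case (Suc k)
    then obtain z where z: "(x, z) \<in> adj_rel G ^^ k" "adjacent G z y" by (auto simp: adj_rel_def)
    have "rho z = rho y \<or> adjacent contraction (rho z) (rho y)"
    proof (cases "lay z = lay y")
      case True
      then show ?thesis using rho_same_layer z by simp
    next
      case False
      then have "below z y \<or> below y z"
        using lay_edge[OF z(2)] lay_edge[OF adj_sym[OF z(2)]] z(2) adj_sym[OF z(2)] by (auto simp: below_def)
      then show ?thesis unfolding contraction_adjacent by auto
    qed
    then show ?case using Suc.IH[OF z(1)] reaches_adjacent_trans reaches_mono[of contraction k _ _ "Suc k"] by fastforce
  qed
  moreover have "reaches contraction 2 v (rho v)" if v: "v \<in> verts G" for v
  proof (cases "v = 0")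
    case True
    then have "rho v = v" using lab_0 by (simp add: rho_def)
    then show ?thesis by (simp add: reaches_refl)
  next
    case False
    then have "below v (par v)" using below_par v by simp
    then have "adjacent contraction v (rho (par v))" "adjacent contraction (rho (par v)) (rho v)"
      unfolding contraction_adjacent by auto
    then show ?thesis using reaches_adjacent_trans[OF reaches_adjacent] by (simp add: numeral_eq_Suc)
  qed
  ultimately have "reaches contraction (2 + k + 2) x y"
    using reaches_sym V by (meson reaches_trans)
  then show ?thesis by (rule reaches_mono) simp
qed

lemma simple_contraction: "simple_graph contraction"
proof -
  have "e \<subseteq> verts G \<and> card e = 2" if ee: "e \<in> edges contraction" for e
  proof -
    obtain x v u where e: "e = {x, rho u}" "below v u" "x = v \<or> x = rho v"
      using ee unfolding contraction_def by auto
    have "lay x = Suc (lay (rho u))" "x \<in> verts G" "rho u \<in> verts G"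
      using e below_verts[OF e(2)] rho_lay rho_in by (auto simp: below_def)
    moreover from this have "x \<noteq> rho u" by auto
    ultimately show ?thesis using e by simp
  qed
  then show ?thesis using simple by (simp add: simple_graph_def contraction_def)
qed

theorem contraction_dist:
  assumes V: "x \<in> verts G" "y \<in> verts G"
  shows "graph_dist G x y \<le> graph_dist contraction x y + enat 50"
    and "graph_dist contraction x y \<le> graph_dist G x y + enat 50"
proof -
  show "graph_dist G x y \<le> graph_dist contraction x y + enat 50"
    using contraction_walk_reaches V simple by (intro graph_dist_le_add graph_dist_le_reaches) auto
  have "reaches contraction (k + 50) x y" if "(x, y) \<in> adj_rel G ^^ k" for k
    using walk_contraction_reaches[OF that V] by (rule reaches_mono) simp
  then show "graph_dist contraction x y \<le> graph_dist G x y + enat 50"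
    using V simple_contraction by (intro graph_dist_le_add graph_dist_le_reaches) (auto simp: contraction_def)
qed

end

subsection \<open>Tree-width\<close>

lemma connected_graphI:
  assumes G: "simple_graph G" and r: "r \<in> verts G"
    and j: "\<And>v. v \<in> verts G \<Longrightarrow> (v, r) \<in> joined G (verts G)"
  shows "connected_graph G"
  unfolding connected_graph_def
proof (intro conjI ballI)
  show "verts G \<noteq> {}" using r by auto
  fix u v assume uv: "u \<in> verts G" "v \<in> verts G"
  have "(u, v) \<in> joined G (verts G)" using joined_trans[OF j[OF uv(1)] joined_sym[OF j[OF uv(2)]]] .
  then obtain p where "induced_path G p" "hd p = u" "last p = v"
    using joined_induced_path[OF G _ uv(1) subset_refl] by blast
  then show "\<exists>p. is_path_between G u p v"
    by (intro exI[of _ p]) (simp add: is_path_between_def induced_path_def)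
qed

lemma simple_induced_subgraph: "simple_graph G \<Longrightarrow> simple_graph (induced_subgraph G S)"
  by (auto simp: simple_graph_def induced_subgraph_def)

definition parent_tree :: "nat set \<Rightarrow> nat \<Rightarrow> (nat \<Rightarrow> nat) \<Rightarrow> nat ugraph" where
  "parent_tree V r f = \<lparr> verts = V, edges = {{v, f v} | v. v \<in> V - {r}} \<rparr>"

text \<open>The measure \<open>m\<close> excludes cycles: a vertex of largest measure on a cycle
  would have its parent as both of its neighbours. Descending along \<open>f\<close> gives
  connectivity.\<close>

lemma is_tree_parent_tree:
  fixes m :: "nat \<Rightarrow> nat"
  assumes V: "finite V" "r \<in> V" and f: "\<And>v. v \<in> V - {r} \<Longrightarrow> f v \<in> V \<and> m (f v) < m v"
  shows "is_tree (parent_tree V r f)"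
proof -
  let ?T = "parent_tree V r f"
  have VT: "verts ?T = V" by (simp add: parent_tree_def)
  have adj: "adjacent ?T u v \<longleftrightarrow> u \<in> V - {r} \<and> v = f u \<or> v \<in> V - {r} \<and> u = f v" for u v
    by (auto simp: adjacent_def parent_tree_def doubleton_eq_iff)
  have s: "simple_graph ?T"
    unfolding simple_graph_def
  proof (intro conjI ballI)
    show "finite (verts ?T)" using V VT by simp
    fix e assume "e \<in> edges ?T"
    then obtain v where v: "e = {v, f v}" "v \<in> V - {r}" by (auto simp: parent_tree_def)
    then show "e \<subseteq> verts ?T" using f[of v] VT by auto
    have "v \<noteq> f v" using f[OF v(2)] by auto
    then show "card e = 2" using v by simp
  qed
  have "(v, r) \<in> joined ?T V" if "v \<in> V" for v
    using that
  proof (induction "m v" arbitrary: v rule: less_induct)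
    case less
    show ?case
    proof (cases "v = r")
      case False
      then have v: "v \<in> V - {r}" using less.prems by simp
      then have "(v, f v) \<in> joined ?T V" using f[OF v] by (intro joined_edge) (auto simp: adj)
      moreover have "(f v, r) \<in> joined ?T V" using less.hyps f[OF v] by blast
      ultimately show ?thesis by (rule joined_trans)
    qed (simp add: joined_refl)
  qed
  then have c: "connected_graph ?T" using connected_graphI[OF s, of r] V VT by simp
  have "\<not> is_cycle ?T c" for c
  proof
    assume cyc: "is_cycle ?T c"
    let ?n = "length c"
    have n: "3 \<le> ?n" and d: "distinct c" and a: "\<And>i. i < ?n \<Longrightarrow> adjacent ?T (c ! i) (c ! (Suc i mod ?n))"
      using cyc by (auto simp: is_cycle_def)
    have ne: "set c \<noteq> {}" using n by auto
    have "Max (m ` set c) \<in> m ` set c" using ne by (intro Max_in) auto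
    then obtain x where x0: "x \<in> set c" "m x = Max (m ` set c)" by auto
    then have x: "x \<in> set c" "\<And>y. y \<in> set c \<Longrightarrow> m y \<le> m x" by simp_all
    obtain i where i: "i < ?n" "x = c ! i" using x(1) by (metis in_set_conv_nth)
    have up: "y = f x" if "y \<in> set c" "adjacent ?T x y \<or> adjacent ?T y x" for y
      using that x(2)[OF that(1)] f[of y] by (auto simp: adj)
    define j where "j = (if i = 0 then ?n - 1 else i - 1)"
    have j: "j < ?n" "Suc j mod ?n = i" using i n by (auto simp: j_def)
    have si: "Suc i mod ?n < ?n" using n by (intro mod_less_divisor) linarith
    have "c ! (Suc i mod ?n) = f x" using a[OF i(1)] i si by (intro up) auto
    moreover have "c ! j = f x" using a[OF j(1)] j i by (intro up) auto
    ultimately have "Suc i mod ?n = j" using nth_eq_iff_index_eq[OF d si j(1)] by metis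
    then show False using i n by (cases "Suc i = ?n") (auto simp: j_def split: if_splits)
  qed
  then show ?thesis using s c by (simp add: is_tree_def)
qed

text \<open>The decomposition tree lives on the vertices of \<open>H\<close> themselves. By
  \<open>Sf\<close> a member of \<open>S v\<close> can be followed from bag to bag along
  \<open>f\<close> until its own node is reached, so the nodes whose bags contain it form a
  subtree.\<close>

lemma tree_width_le_parent_tree:
  fixes H :: "nat ugraph" and m :: "nat \<Rightarrow> nat"
  assumes H: "simple_graph H" and r: "r \<in> verts H"
    and f: "\<And>v. v \<in> verts H - {r} \<Longrightarrow> f v \<in> verts H \<and> m (f v) < m v"
    and S: "\<And>v. v \<in> verts H \<Longrightarrow> S v \<subseteq> verts H \<and> card (insert v (S v)) \<le> Suc w"
    and Sr: "S r = {}"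
    and Sf: "\<And>v. v \<in> verts H - {r} \<Longrightarrow> S v \<subseteq> insert (f v) (S (f v))"
    and edge: "\<And>e. e \<in> edges H \<Longrightarrow> \<exists>v\<in>verts H. e \<subseteq> insert v (S v)"
  shows "tree_width H \<le> w"
proof -
  let ?V = "verts H" and ?T = "parent_tree (verts H) r f" and ?bag = "\<lambda>v. insert v (S v)"
  have fin: "finite ?V" using H by (simp add: simple_graph_def)
  have T: "is_tree ?T" using is_tree_parent_tree[OF fin r f] .
  have VT: "verts ?T = ?V" by (simp add: parent_tree_def)
  have "connected_graph (induced_subgraph ?T {t \<in> verts ?T. v \<in> ?bag t})" if v: "v \<in> ?V" for v
  proof -
    let ?B = "{t \<in> ?V. v \<in> ?bag t}"
    let ?X = "induced_subgraph ?T ?B"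
    have VX: "verts ?X = ?B" by (auto simp: induced_subgraph_def VT)
    have "(t, v) \<in> joined ?X ?B" if "t \<in> ?B" for t
      using that
    proof (induction "m t" arbitrary: t rule: less_induct)
      case less
      show ?case
      proof (cases "t = v")
        case False
        then have t: "t \<in> ?V - {r}" and "v \<in> S t" using less.prems Sr by auto
        then have ft: "f t \<in> ?B" using Sf[OF t] f[OF t] by auto
        have "adjacent ?T t (f t)" using t by (auto simp: adjacent_def parent_tree_def)
        then have "(t, f t) \<in> joined ?X ?B"
          using less.prems ft by (intro joined_edge) (simp_all add: adjacent_subgraph)
        moreover have "(f t, v) \<in> joined ?X ?B" using less.hyps f[OF t] ft by blast
        ultimately show ?thesis by (rule joined_trans)
      qed (simp add: joined_refl)
    qed
    then have "connected_graph ?X"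
      using connected_graphI[of ?X v] v VX simple_induced_subgraph[of ?T ?B] T by (simp add: is_tree_def)
    then show ?thesis by (simp add: VT)
  qed
  then have td: "tree_decomposition H ?T ?bag"
    unfolding tree_decomposition_def using T S edge by (auto simp: VT)
  have "Max ((\<lambda>t. card (?bag t)) ` verts ?T) \<le> Suc w"
    using fin r S by (subst Max_le_iff) (auto simp: VT)
  then have "decomposition_width ?T ?bag \<le> w" by (simp add: decomposition_width_def)
  moreover have "tree_width H \<le> decomposition_width ?T ?bag"
    unfolding tree_width_def using td by (intro Least_le) blast
  ultimately show ?thesis by simp
qed

context clustering
begin

definition has_two :: "nat \<Rightarrow> bool" where
  "has_two l \<longleftrightarrow> \<not> merged l \<and> (\<exists>v\<in>verts G. lab v = l \<and> par v \<noteq> par l)"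

definition reps :: "nat \<Rightarrow> nat set" where
  "reps l = (if has_two l then {l, rp l} else {l})"

definition second :: "nat \<Rightarrow> bool" where
  "second v \<longleftrightarrow> has_two (lab v) \<and> v = rp (lab v)"

text \<open>The tree node whose bag contains all representatives of the cluster.\<close>

definition node :: "nat \<Rightarrow> nat" where
  "node l = (if has_two l then rp l else l)"

lemma has_two_rp:
  assumes "has_two l"
  shows "rp l \<in> verts G" "lab (rp l) = l" "par (rp l) \<noteq> par l" "rp l \<noteq> l" "\<not> merged l"
proof -
  obtain v where v: "\<not> merged l" "v \<in> verts G" "lab v = l" "par v \<noteq> par l"
    using assms by (auto simp: has_two_def)
  have "v \<noteq> 0" using v lab_0 by metis
  then have "below v (par v)" using below_par v by simp
  then obtain u where u: "lab (rp l) = l" "below (rp l) u" "u \<noteq> par l" using rp[of v "par v"] v by auto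
  moreover have "u = par (rp l)" using not_merged_below[of "rp l" u] u v by simp
  ultimately show "rp l \<in> verts G" "lab (rp l) = l" "par (rp l) \<noteq> par l" "rp l \<noteq> l" "\<not> merged l"
    using below_verts v by auto
qed

lemma rho_reps: "v \<in> verts G \<Longrightarrow> rho v \<in> reps (lab v)"
  by (auto simp: rho_def reps_def has_two_def)

lemma reps_verts: "v \<in> verts G \<Longrightarrow> x \<in> reps (lab v) \<Longrightarrow> x \<in> verts G \<and> lab x = lab v"
  using has_two_rp[of "lab v"] lab_in[of v] lab_lab[of v] by (auto simp: reps_def split: if_splits)

lemma node_reps: "node l \<in> reps l"
  by (simp add: node_def reps_def)

lemma not_second_lab: "v \<in> verts G \<Longrightarrow> \<not> second (lab v)"
  using has_two_rp(4) lab_lab by (metis second_def)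

text \<open>In general the bag of a vertex consists of itself and the representatives of the cluster
  below. Two representatives of a cluster must share a bag; it is placed at \<open>rp l\<close>,
  together with the only vertex needed below \<open>rp l\<close>, and the tree parent of
  \<open>rp l\<close> is \<open>l\<close>.\<close>

theorem tree_width_contraction: "tree_width contraction \<le> 2"
proof -
  let ?S = "\<lambda>v. if v = 0 then {} else if second v then {lab v, rho (par v)} else reps (lab (par v))"
  let ?f = "\<lambda>v. if second v then lab v else node (lab (par v))"
  \<comment> \<open>Doubling makes room for \<open>rp l\<close> above \<open>l\<close>, which is in
    the same layer.\<close>
  let ?m = "\<lambda>v. 2 * lay v + (if second v then 1 else 0)"
  have V: "verts contraction = verts G" by (simp add: contraction_def)
  have pV: "par v \<in> verts G" if "v \<in> verts G" "v \<noteq> 0" for v using below_verts[OF below_par[OF that]] by simp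
  have s0: "\<not> second 0" using has_two_rp(4)[of 0] lab_0 by (auto simp: second_def)
  have l0: "lab v \<noteq> 0" if "v \<in> verts G" "v \<noteq> 0" for v
    using lab_lay[OF that(1)] lay_0[OF that(1)] root that(2) by metis
  have sub: "?S v \<subseteq> insert (?f v) (?S (?f v))" if v: "v \<in> verts G" "v \<noteq> 0" for v
  proof (cases "second v")
    case True
    have "lab (par v) = lab (par (lab v))"
      using lab_below[OF below_par[OF v] below_par[OF lab_in[OF v(1)] l0[OF v]]] lab_lab[OF v(1)] by simp
    then have "rho (par v) \<in> reps (lab (par (lab v)))" using rho_reps[OF pV[OF v]] by simp
    then show ?thesis using True l0[OF v] v not_second_lab by simp
  next
    case False
    let ?l = "lab (par v)"
    show ?thesis
    proof (cases "has_two ?l")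
      case True
      have "second (rp ?l)" using has_two_rp[OF True] True by (simp add: second_def)
      moreover from this have "rp ?l \<noteq> 0" using s0 by metis
      ultimately show ?thesis using False True has_two_rp(2)[OF True] v by (simp add: reps_def node_def)
    next
      case two: False
      then show ?thesis using False by (simp add: reps_def node_def)
    qed
  qed
  have S: "?S v \<subseteq> verts G \<and> card (insert v (?S v)) \<le> Suc 2" if v: "v \<in> verts G" for v
  proof -
    have "card (insert v (reps l)) \<le> 3" "card (insert v {l, x}) \<le> 3" for l x
      by (simp_all add: reps_def card_insert_if)
    moreover have "?S v \<subseteq> verts G" 
    proof (cases "v = 0")
      case False
      then show ?thesis
        using lab_in[OF v] rho_in[OF pV[OF v False]] reps_verts[OF pV[OF v False]] by (simp add: subset_iff)
    qed simp
    ultimately show ?thesis by (simp add: eval_nat_numeral)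
  qed
  have f: "?f v \<in> verts G \<and> ?m (?f v) < ?m v" if v: "v \<in> verts G" "v \<noteq> 0" for v
  proof (cases "second v")
    case True
    then show ?thesis using v lab_in lab_lay not_second_lab by simp
  next
    case False
    have n: "node (lab (par v)) \<in> verts G" "lab (node (lab (par v))) = lab (par v)"
      using reps_verts[OF pV[OF v] node_reps] by auto
    then have "lay (node (lab (par v))) = lay (par v)" using same_lab_lay pV[OF v] by blast
    then show ?thesis using False n par_lay[OF v] by simp
  qed
  have edge: "\<exists>v\<in>verts G. e \<subseteq> insert v (?S v)" if ee: "e \<in> edges contraction" for e
  proof -
    obtain x v u where e: "e = {x, rho u}" "below v u" "x = v \<or> x = rho v"
      using ee by (auto simp: contraction_def)
    have vu: "v \<in> verts G" "u \<in> verts G" using below_verts[OF e(2)] by auto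
    have x: "x \<in> verts G" "lab x = lab v" using e(3) vu rho_in rho_lab by auto
    then have "lay x = Suc (lay u)" using same_lab_lay[of x v] vu e(2) by (simp add: below_def)
    then have x0: "x \<noteq> 0" by (rule lay_Suc_ne_0)
    have "rho u \<in> ?S x"
    proof (cases "second x")
      case True
      then have nm: "\<not> merged (lab v)" using has_two_rp(5) x by (metis second_def)
      then have u: "u = par v" using not_merged_below e(2) by blast
      have "par x = par v"
      proof (cases "x = v")
        case False
        then have "x = rho v" using e(3) by simp
        then have "rho x = rho v" using rho_idem vu by simp
        then show ?thesis using rho_same_par[of x v] x vu nm by simp
      qed simp
      then show ?thesis using True x0 u by simp
    next
      case False
      have "lab (par x) = lab u" using lab_below[OF below_par[OF x(1) x0] e(2) x(2)] .
      then show ?thesis using False x0 rho_reps[OF vu(2)] by simp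
    qed
    then show ?thesis using e(1) x(1) by blast
  qed
  show ?thesis
    by (rule tree_width_le_parent_tree[OF simple_contraction, where r = 0 and f = ?f and m = ?m and S = ?S])
      (use V root f S sub edge in \<open>auto\<close>)
qed

end

section \<open>The program\<close>

subsection \<open>Weakest preconditions with time credits\<close>

text \<open>Total correctness with time as a resource: at most \<open>n\<close> steps may be spent,
  and the postcondition sees how many are left. Time bounds thus compose like assertions.\<close>

definition wp :: "com \<Rightarrow> (ram_state \<Rightarrow> nat \<Rightarrow> bool) \<Rightarrow> ram_state \<Rightarrow> nat \<Rightarrow> bool" where
  "wp P Q s n \<longleftrightarrow> (\<exists>t s'. exec P s t s' \<and> t \<le> n \<and> Q s' (n - t))"

primrec straight :: "com \<Rightarrow> bool" where
  "straight Skip \<longleftrightarrow> True"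
| "straight (Assign x e) \<longleftrightarrow> True"
| "straight (Put a i e) \<longleftrightarrow> True"
| "straight (Seq P Q) \<longleftrightarrow> straight P \<and> straight Q"
| "straight (Cond b P Q) \<longleftrightarrow> straight P \<and> straight Q"
| "straight (While b P) \<longleftrightarrow> False"

primrec cost :: "com \<Rightarrow> nat" where
  "cost Skip = 1"
| "cost (Assign x e) = 1"
| "cost (Put a i e) = 1"
| "cost (Seq P Q) = cost P + cost Q"
| "cost (Cond b P Q) = 1 + cost P + cost Q"
| "cost (While b P) = 0"

primrec effect :: "com \<Rightarrow> ram_state \<Rightarrow> ram_state" where
  "effect Skip s = s"
| "effect (Assign x e) s = s\<lparr>regs := (regs s)(x := aval e s)\<rparr>"
| "effect (Put a i e) s = s\<lparr>arrs := (arrs s)(a := (arrs s a)(aval i s := aval e s))\<rparr>"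
| "effect (Seq P Q) s = effect Q (effect P s)"
| "effect (Cond b P Q) s = (if bval b s then effect P s else effect Q s)"
| "effect (While b P) s = s"

lemma exec_straight: "straight P \<Longrightarrow> \<exists>t\<le>cost P. exec P s t (effect P s)"
proof (induction P arbitrary: s)
  case (Seq P Q)
  then obtain t u where "t \<le> cost P" "exec P s t (effect P s)" "u \<le> cost Q"
    "exec Q (effect P s) u (effect Q (effect P s))" by (meson straight.simps(4))
  then show ?case by (intro exI[of _ "t + u"]) (auto intro: exec.Seq)
next
  case (Cond b P Q)
  then obtain t u where t: "t \<le> cost P" "exec P s t (effect P s)" and u: "u \<le> cost Q" "exec Q s u (effect Q s)"
    by (meson straight.simps(5))
  show ?case
  proof (cases "bval b s")
    case True
    then show ?thesis using t by (intro exI[of _ "1 + t"]) (auto intro!: exec.CondTrue[of b s P t, simplified])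
  next
    case False
    then show ?thesis using u by (intro exI[of _ "1 + u"]) (auto intro!: exec.CondFalse[of b s Q u, simplified])
  qed
qed (auto intro: exec.intros exI[of _ 1])

text \<open>Loop-free code is run symbolically by \<open>effect\<close>. The steps left over are
  known only through a lower bound, as \<open>cost\<close> charges both branches of a
  conditional.\<close>

lemma wp_straight:
  "straight P \<Longrightarrow> cost P \<le> n \<Longrightarrow> (\<And>m. n \<le> m + cost P \<Longrightarrow> Q (effect P s) m) \<Longrightarrow> wp P Q s n"
  unfolding wp_def by (meson diff_le_mono2 exec_straight le_diff_conv order_trans)

lemma wp_Seq: "wp P (wp P' Q) s n \<Longrightarrow> wp (Seq P P') Q s n"
proof -
  assume "wp P (wp P' Q) s n"
  then obtain t s' u s'' where "exec P s t s'" "t \<le> n" "exec P' s' u s''" "u \<le> n - t" "Q s'' (n - t - u)"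
    by (auto simp: wp_def)
  then show ?thesis unfolding wp_def
    by (intro exI[of _ "t + u"] exI[of _ s'']) (auto intro: exec.Seq)
qed

lemma wp_Cond:
  assumes "1 \<le> n" "bval b s \<Longrightarrow> wp P Q s (n - 1)" "\<not> bval b s \<Longrightarrow> wp P' Q s (n - 1)"
  shows "wp (Cond b P P') Q s n"
proof (cases "bval b s")
  case True
  then obtain t s' where "exec P s t s'" "t \<le> n - 1" "Q s' (n - 1 - t)" using assms(2) by (auto simp: wp_def)
  then show ?thesis unfolding wp_def using exec.CondTrue[OF True, of P t s' P'] assms(1)
    by (intro exI[of _ "1 + t"] exI[of _ s']) auto
next
  case False
  then obtain t s' where "exec P' s t s'" "t \<le> n - 1" "Q s' (n - 1 - t)" using assms(3) by (auto simp: wp_def)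
  then show ?thesis unfolding wp_def using exec.CondFalse[OF False, of P' t s' P] assms(1)
    by (intro exI[of _ "1 + t"] exI[of _ s']) auto
qed

text \<open>Every test consumes a step, so the steps left are themselves the termination
  measure.\<close>

lemma wp_While:
  assumes "I s n" and "\<And>s n. I s n \<Longrightarrow> 1 \<le> n" and "\<And>s n. I s n \<Longrightarrow> bval b s \<Longrightarrow> wp P I s (n - 1)"
    and "\<And>s n. I s n \<Longrightarrow> \<not> bval b s \<Longrightarrow> Q s (n - 1)"
  shows "wp (While b P) Q s n"
  using assms(1)
proof (induction n arbitrary: s rule: less_induct)
  case (less n)
  have n: "1 \<le> n" using assms(2)[OF less.prems] .
  show ?case
  proof (cases "bval b s")
    case True
    then obtain t s' where t: "exec P s t s'" "t \<le> n - 1" "I s' (n - 1 - t)"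
      using assms(3)[OF less.prems] by (auto simp: wp_def)
    then obtain u s'' where u: "exec (While b P) s' u s''" "u \<le> n - 1 - t" "Q s'' (n - 1 - t - u)"
      using less.IH[of "n - 1 - t" s'] n by (auto simp: wp_def)
    show ?thesis unfolding wp_def
      using exec.WhileTrue[OF True t(1) u(1)] t u n by (intro exI[of _ "1 + t + u"] exI[of _ s'']) auto
  next
    case False
    then show ?thesis unfolding wp_def
      using exec.WhileFalse[OF False, of P] assms(4)[OF less.prems False] n by (intro exI[of _ 1] exI[of _ s]) auto
  qed
qed

text \<open>Registers 4, 5 and 6 hold the current vertex, a position in its adjacency list and the neighbour there.\<close>

definition for_nbrs :: "com \<Rightarrow> com" where
  "for_nbrs body = Seq (Assign 5 (Get 0 (Reg 4)))
     (While (Less (Reg 5) (Get 0 (Succ (Reg 4))))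
       (Seq (Assign 6 (Get 1 (Reg 5))) (Seq body (Assign 5 (Succ (Reg 5))))))"

definition for_edges :: "com \<Rightarrow> com" where
  "for_edges body = Seq (Assign 2 (Const 0))
     (While (Less (Reg 2) (Reg 0)) (Seq (Seq (Assign 4 (Reg 2)) (Assign 2 (Succ (Reg 2)))) (for_nbrs body)))"

text \<open>Registers 4 to 6 belong to the loop over neighbours. They are blanked out so that an
  invariant survives the assignments made by the loop itself.\<close>

definition aux :: "ram_state \<Rightarrow> nat \<Rightarrow> nat" where
  "aux s = (regs s)(4 := 0, 5 := 0, 6 := 0)"

lemma aux_upd [simp]:
  "aux (s\<lparr>arrs := a\<rparr>) = aux s"
  "regs s' = (regs s)(4 := x) \<Longrightarrow> aux s' = aux s"
  "regs s' = (regs s)(5 := x) \<Longrightarrow> aux s' = aux s"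
  "regs s' = (regs s)(6 := x) \<Longrightarrow> aux s' = aux s"
  by (auto simp: aux_def)

lemma aux_apply: "x \<noteq> 4 \<Longrightarrow> x \<noteq> 5 \<Longrightarrow> x \<noteq> 6 \<Longrightarrow> aux s x = regs s x"
  by (simp add: aux_def)

locale ram_input =
  fixes G :: "nat ugraph" and adj :: "nat list list"
  assumes us: "universally_signable G" and conn: "connected_graph G" and adjl: "adjacency_lists G adj"
begin

definition n :: nat where "n = length adj"
definition off :: "nat \<Rightarrow> nat" where "off v = length (concat (take v adj))"
definition nbs :: "nat \<Rightarrow> nat set" where "nbs v = {u. adjacent G v u}"
definition inp :: "(nat \<Rightarrow> nat \<Rightarrow> nat) \<Rightarrow> bool" where
  "inp ar \<longleftrightarrow> (\<forall>v\<le>n. ar 0 v = off v) \<and> ar 1 = array_of (concat adj)"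

lemma simple_G: "simple_graph G" using us by (simp add: universally_signable_def)

lemma verts_G: "verts G = {..<n}" using adjl by (simp add: adjacency_lists_def n_def)

lemma adjacent_less: "adjacent G u v \<Longrightarrow> u < n \<and> v < n"
  using adjacent_verts[OF simple_G] verts_G by auto

lemma n_pos: "0 < n"
  using conn verts_G by (auto simp: connected_graph_def)

lemma off_Suc: "v < n \<Longrightarrow> off (Suc v) = off v + length (adj ! v)"
  by (simp add: off_def n_def take_Suc_conv_app_nth)

lemma off_0: "off 0 = 0" by (simp add: off_def)

lemma off_mono: "u \<le> v \<Longrightarrow> off u \<le> off v"
  by (auto simp: off_def le_iff_add take_add)

lemma array_off:
  assumes "v < n" "off v \<le> k" "k < off (Suc v)"
  shows "array_of (concat adj) k = adj ! v ! (k - off v)"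
proof -
  have "adj = take v adj @ adj ! v # drop (Suc v) adj" using assms(1) by (simp add: n_def id_take_nth_drop)
  then have c: "concat adj = concat (take v adj) @ adj ! v @ concat (drop (Suc v) adj)"
    by (metis concat.simps(2) concat_append)
  have k: "k - off v < length (adj ! v)" using assms off_Suc by auto
  then show ?thesis
    using assms(2) unfolding array_of_def c by (auto simp: nth_append off_def)
qed

lemma nbs_eq: "v < n \<Longrightarrow> array_of (concat adj) ` {off v..<off (Suc v)} = nbs v"
proof -
  assume v: "v < n"
  have "nbs v = set (adj ! v)"
    using adjl v adjacent_less verts_G by (fastforce simp: adjacency_lists_def n_def nbs_def)
  also have "\<dots> = (\<lambda>i. adj ! v ! i) ` {..<length (adj ! v)}" by (auto simp: set_conv_nth)
  also have "\<dots> = (\<lambda>k. adj ! v ! (k - off v)) ` {off v..<off (Suc v)}"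
  proof -
    have "{..<length (adj ! v)} = (\<lambda>k. k - off v) ` {off v..<off (Suc v)}"
      unfolding off_Suc[OF v] by (auto simp: image_iff intro!: bexI[of _ "_ + off v"])
    then show ?thesis by (simp add: image_image)
  qed
  finally show ?thesis using array_off[OF v] by auto
qed

text \<open>There is one list entry per ordered pair of adjacent vertices, and an edge provides at
  most two such pairs.\<close>

lemma off_n: "off n \<le> 2 * card (edges G)"
proof -
  have fE: "finite (edges G)"
    using simple_G finite_subset[of "edges G" "Pow (verts G)"] by (auto simp: simple_graph_def)
  have fn: "finite (nbs v)" for v using adjacent_less finite_subset[of "nbs v" "{..<n}"] by (auto simp: nbs_def)
  have len: "length (adj ! v) = card (nbs v)" if "v < n" for v
  proof -
    have "nbs v = set (adj ! v)" "distinct (adj ! v)"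
      using adjl that adjacent_less verts_G by (fastforce simp: adjacency_lists_def n_def nbs_def)+
    then show ?thesis by (simp add: distinct_card)
  qed
  have "off k = (\<Sum>v<k. card (nbs v))" if "k \<le> n" for k
    using that by (induction k) (simp_all add: off_0 off_Suc len)
  then have "off n = card (SIGMA v:{..<n}. nbs v)" using fn by simp
  also have "\<dots> \<le> card (\<Union>e\<in>edges G. (e \<times> e - Id))"
  proof (rule card_mono)
    have "finite e" if "e \<in> edges G" for e using simple_G that finite_subset by (auto simp: simple_graph_def)
    then show "finite (\<Union>e\<in>edges G. (e \<times> e - Id))" using fE by auto
    show "(SIGMA v:{..<n}. nbs v) \<subseteq> (\<Union>e\<in>edges G. (e \<times> e - Id))"
      using adjacent_neq[OF simple_G] by (auto simp: nbs_def adjacent_def)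
  qed
  also have "\<dots> \<le> (\<Sum>e\<in>edges G. card (e \<times> e - Id))" by (rule card_UN_le[OF fE])
  also have "\<dots> \<le> (\<Sum>e\<in>edges G. 2)"
  proof (rule sum_mono)
    fix e assume "e \<in> edges G"
    then have "card e = 2" using simple_G by (simp add: simple_graph_def)
    then obtain x y where "e = {x, y}" by (metis card_2_iff)
    then have sub: "e \<times> e - Id \<subseteq> {(x, y), (y, x)}" by blast
    have "card {(x, y), (y, x)} \<le> 2"
      using card_length[of "[(x, y), (y, x)]"] unfolding list.set list.size by linarith
    moreover have "card (e \<times> e - Id) \<le> card {(x, y), (y, x)}" by (rule card_mono) (use sub in auto)
    ultimately show "card (e \<times> e - Id) \<le> 2" by linarith
  qed
  finally show ?thesis by simp
qed

text \<open>The invariant refers to the set of neighbours treated so far and hides array positions.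
  Beside the body a round takes three steps (test, load, increment); the 2 pays for the initial
  assignment and the last test.\<close>

lemma wp_for_nbrs:
  assumes body: "straight body" and v: "v < n" "regs s 4 = v"
    and J0: "J {} (arrs s) (aux s)"
    and Jinp: "\<And>X ar rg. J X ar rg \<Longrightarrow> inp ar"
    and Jstep: "\<And>X s w. J X (arrs s) (aux s) \<Longrightarrow> regs s 4 = v \<Longrightarrow> regs s 6 = w \<Longrightarrow> adjacent G v w \<Longrightarrow>
        J (insert w X) (arrs (effect body s)) (aux (effect body s)) \<and>
        regs (effect body s) 4 = v \<and> regs (effect body s) 5 = regs s 5"
    and m: "length (adj ! v) * (cost body + 3) + 2 + r \<le> m"
    and Q: "\<And>s m. J (nbs v) (arrs s) (aux s) \<Longrightarrow> regs s 4 = v \<Longrightarrow> r \<le> m \<Longrightarrow> Q s m"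
  shows "wp (for_nbrs body) Q s m"
  unfolding for_nbrs_def
proof (rule wp_Seq, rule wp_straight)
  let ?A = "array_of (concat adj)" and ?C = "cost body + 3"
  define I where "I s m \<longleftrightarrow> (\<exists>k. off v \<le> k \<and> k \<le> off (Suc v) \<and> regs s 5 = k \<and> regs s 4 = v \<and>
      J (?A ` {off v..<k}) (arrs s) (aux s) \<and> (off (Suc v) - k) * ?C + 1 + r \<le> m)" for s :: ram_state and m
  fix m' assume m': "m \<le> m' + cost (Assign 5 (Get 0 (Reg 4)))"
  let ?s = "effect (Assign 5 (Get 0 (Reg 4))) s"
  have "arrs s 0 v = off v" using Jinp[OF J0] v by (simp add: inp_def)
  then have "regs ?s 5 = off v" "regs ?s 4 = v" "J {} (arrs ?s) (aux ?s)"
    using v J0 aux_upd(3)[of ?s s] by auto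
  moreover have "length (adj ! v) * ?C + 1 + r \<le> m'" using m m' by simp
  ultimately have I0: "I ?s m'"
    unfolding I_def using off_Suc[OF v(1)] by (intro exI[of _ "off v"]) auto
  show "wp (While (Less (Reg 5) (Get 0 (Succ (Reg 4)))) (Seq (Assign 6 (Get 1 (Reg 5))) (Seq body (Assign 5 (Succ (Reg 5)))))) Q ?s m'"
  proof (rule wp_While[of I])
    show "I ?s m'" by (rule I0)
    show "1 \<le> m" if "I s m" for s m using that by (auto simp: I_def)
    have test: "bval (Less (Reg 5) (Get 0 (Succ (Reg 4)))) s \<longleftrightarrow> regs s 5 < off (Suc v)" if "I s m" for s m
      using that Jinp v by (auto simp: I_def inp_def)
    show "Q s (m - 1)" if "I s m" "\<not> bval (Less (Reg 5) (Get 0 (Succ (Reg 4)))) s" for s m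
    proof -
      have "regs s 5 = off (Suc v)" using that test[OF that(1)] by (auto simp: I_def)
      then show ?thesis using that(1) nbs_eq[OF v(1)] by (intro Q) (auto simp: I_def)
    qed
    show "wp (Seq (Assign 6 (Get 1 (Reg 5))) (Seq body (Assign 5 (Succ (Reg 5))))) I s (m - 1)"
      if Is: "I s m" and b: "bval (Less (Reg 5) (Get 0 (Succ (Reg 4)))) s" for s m
    proof (rule wp_straight)
      obtain k where k: "off v \<le> k" "regs s 5 = k" "regs s 4 = v" "J (?A ` {off v..<k}) (arrs s) (aux s)"
        "(off (Suc v) - k) * ?C + 1 + r \<le> m" using Is by (auto simp: I_def)
      have kl: "k < off (Suc v)" using test[OF Is] b k by simp
      then obtain d where d: "off (Suc v) = Suc (k + d)" using less_imp_Suc_add by blast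
      have dm: "d * ?C + ?C + 1 + r \<le> m" using k(5) d by (simp add: algebra_simps)
      show "straight (Seq (Assign 6 (Get 1 (Reg 5))) (Seq body (Assign 5 (Succ (Reg 5)))))" using body by simp
      show "cost (Seq (Assign 6 (Get 1 (Reg 5))) (Seq body (Assign 5 (Succ (Reg 5))))) \<le> m - 1" using dm by simp
      fix m2 assume m2: "m - 1 \<le> m2 + cost (Seq (Assign 6 (Get 1 (Reg 5))) (Seq body (Assign 5 (Succ (Reg 5)))))"
      let ?s1 = "effect (Assign 6 (Get 1 (Reg 5))) s"
      let ?s2 = "effect body ?s1" and ?s3 = "effect (Assign 5 (Succ (Reg 5))) (effect body ?s1)"
      have A1: "arrs s 1 = ?A" using Jinp[OF k(4)] by (simp add: inp_def)
      have nb: "adjacent G v (?A k)" using nbs_eq[OF v(1)] k(1) kl by (auto simp: nbs_def)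
      have s1: "aux ?s1 = aux s" "arrs ?s1 = arrs s" "regs ?s1 4 = v" "regs ?s1 5 = k" "regs ?s1 6 = ?A k"
        using k A1 aux_upd(4)[of ?s1 s] by auto
      have st: "J (insert (?A k) (?A ` {off v..<k})) (arrs ?s2) (aux ?s2)" "regs ?s2 4 = v" "regs ?s2 5 = k"
        using Jstep[of "?A ` {off v..<k}" ?s1 "?A k"] s1 k(4) nb by simp_all
      have s3: "aux ?s3 = aux ?s2" "arrs ?s3 = arrs ?s2" "regs ?s3 4 = v" "regs ?s3 5 = Suc k"
        using st aux_upd(3)[of ?s3 ?s2] by auto
      have "{off v..<Suc k} = insert k {off v..<k}" using k(1) by auto
      then have "?A ` {off v..<Suc k} = insert (?A k) (?A ` {off v..<k})" by simp
      then have "I ?s3 m2"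
        unfolding I_def using s3 st(1) k(1) kl d m2 dm by (intro exI[of _ "Suc k"]) simp
      then show "I (effect (Seq (Assign 6 (Get 1 (Reg 5))) (Seq body (Assign 5 (Succ (Reg 5))))) s) m2" by simp
    qed
  qed
qed (use m in auto)

text \<open>Apart from its neighbours every vertex takes 5 steps: the test, two assignments and the
  overhead 2 of \<open>for_nbrs\<close>. Edges are treated as ordered pairs, once from either
  end.\<close>

lemma wp_for_edges:
  assumes body: "straight body"
    and J0: "J {} (arrs s) (regs s 1)" "regs s 0 = n"
    and Jinp: "\<And>Z ar k. J Z ar k \<Longrightarrow> inp ar"
    and Jstep: "\<And>Z s v w. J Z (arrs s) (regs s 1) \<Longrightarrow> regs s 4 = v \<Longrightarrow> regs s 6 = w \<Longrightarrow> adjacent G v w \<Longrightarrow>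
        J (insert (v, w) Z) (arrs (effect body s)) (regs (effect body s) 1) \<and>
        (\<forall>x\<in>{0, 2, 4, 5}. regs (effect body s) x = regs s x)"
    and m: "off n * (cost body + 3) + n * 5 + 2 + r \<le> m"
    and Q: "\<And>s m. J {(v, w). adjacent G v w} (arrs s) (regs s 1) \<Longrightarrow> regs s 0 = n \<Longrightarrow> r \<le> m \<Longrightarrow> Q s m"
  shows "wp (for_edges body) Q s m"
  unfolding for_edges_def
proof (rule wp_Seq, rule wp_straight)
  let ?C = "cost body + 3"
  define I where "I s m \<longleftrightarrow> (\<exists>k\<le>n. regs s 2 = k \<and> regs s 0 = n \<and> J {(v, w). v < k \<and> adjacent G v w} (arrs s) (regs s 1) \<and>
      (off n - off k) * ?C + (n - k) * 5 + 1 + r \<le> m)" for s :: ram_state and m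
  fix m' assume m': "m \<le> m' + cost (Assign 2 (Const 0))"
  have I0: "I (effect (Assign 2 (Const 0)) s) m'"
    unfolding I_def using m m' J0 by (intro exI[of _ 0]) (auto simp: off_0)
  show "wp (While (Less (Reg 2) (Reg 0)) (Seq (Seq (Assign 4 (Reg 2)) (Assign 2 (Succ (Reg 2)))) (for_nbrs body))) Q
      (effect (Assign 2 (Const 0)) s) m'"
  proof (rule wp_While[of I])
    show "I (effect (Assign 2 (Const 0)) s) m'" by (rule I0)
    show "1 \<le> m" if "I s m" for s m using that by (auto simp: I_def)
    show "Q s (m - 1)" if Is: "I s m" and b: "\<not> bval (Less (Reg 2) (Reg 0)) s" for s m
    proof -
      obtain k where k: "k \<le> n" "regs s 2 = k" "regs s 0 = n" "J {(v, w). v < k \<and> adjacent G v w} (arrs s) (regs s 1)"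
        "1 + r \<le> m" using Is by (auto simp: I_def)
      have "k = n" using b k by simp
      then have "{(v, w). v < k \<and> adjacent G v w} = {(v, w). adjacent G v w}" using adjacent_less by auto
      then show ?thesis using k by (intro Q) auto
    qed
    show "wp (Seq (Seq (Assign 4 (Reg 2)) (Assign 2 (Succ (Reg 2)))) (for_nbrs body)) I s (m - 1)"
      if Is: "I s m" and b: "bval (Less (Reg 2) (Reg 0)) s" for s m
    proof (rule wp_Seq, rule wp_straight)
      obtain k where k: "regs s 2 = k" "regs s 0 = n" "J {(v, w). v < k \<and> adjacent G v w} (arrs s) (regs s 1)"
        "(off n - off k) * ?C + (n - k) * 5 + 1 + r \<le> m" using Is by (auto simp: I_def)
      have kn: "k < n" using b k by simp
      have "off (Suc k) \<le> off n" using kn by (intro off_mono) simp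
      then obtain d where d: "off n = off (Suc k) + d" using le_Suc_ex by blast
      obtain e where e: "n = Suc (k + e)" using kn less_imp_Suc_add by blast
      have dm: "d * ?C + length (adj ! k) * ?C + e * 5 + 6 + r \<le> m"
        using k(4) d e off_Suc[OF kn] by (simp add: algebra_simps)
      let ?P = "Seq (Assign 4 (Reg 2)) (Assign 2 (Succ (Reg 2)))"
      let ?s = "effect ?P s"
      show "straight ?P" by simp
      show "cost ?P \<le> m - 1" using dm by simp
      fix m2 assume "m - 1 \<le> m2 + cost ?P"
      then have m2: "length (adj ! k) * ?C + 2 + (d * ?C + e * 5 + 1 + r) \<le> m2" using dm by simp
      let ?J = "\<lambda>X ar rg. J ({(v, w). v < k \<and> adjacent G v w} \<union> {k} \<times> X) ar (rg 1) \<and> rg 0 = n \<and> rg 2 = Suc k"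
      show "wp (for_nbrs body) I ?s m2"
      proof (rule wp_for_nbrs[OF body kn, where J = ?J, OF _ _ _ _ m2])
        show "regs ?s 4 = k" using k by simp
        show "?J {} (arrs ?s) (aux ?s)" using k by (simp add: aux_apply)
        show "inp ar" if "?J X ar rg" for X ar rg using Jinp that by blast
        show "?J (insert w X) (arrs (effect body s)) (aux (effect body s)) \<and>
            regs (effect body s) 4 = k \<and> regs (effect body s) 5 = regs s 5"
          if h: "?J X (arrs s) (aux s)" "regs s 4 = k" "regs s 6 = w" "adjacent G k w" for X s w
          using Jstep[of "{(v, w). v < k \<and> adjacent G v w} \<union> {k} \<times> X" s k w] h by (simp add: aux_apply)
        show "I s m" if h: "?J (nbs k) (arrs s) (aux s)" "regs s 4 = k" "d * ?C + e * 5 + 1 + r \<le> m" for s m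
        proof -
          have "{(v, w). v < k \<and> adjacent G v w} \<union> {k} \<times> nbs k = {(v, w). v < Suc k \<and> adjacent G v w}"
            by (auto simp: nbs_def less_Suc_eq)
          then show ?thesis unfolding I_def using h d e by (intro exI[of _ "Suc k"]) (simp add: aux_apply)
        qed
      qed
    qed
  qed
qed (use m in auto)

end

subsection \<open>Breadth-first search\<close>

text \<open>Array 4 holds the layer plus one (zero for unvisited vertices), array 5 the parents, array 6 the queue.\<close>

definition bfs_body :: com where
  "bfs_body = Cond (Equal (Get 4 (Reg 6)) (Const 0))
     (Seq (Put 4 (Reg 6) (Succ (Get 4 (Reg 4)))) (Seq (Put 5 (Reg 6) (Reg 4))
       (Seq (Put 6 (Reg 3) (Reg 6)) (Assign 3 (Succ (Reg 3)))))) Skip"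

definition bfs_prog :: com where
  "bfs_prog = Seq (Seq (Put 4 (Const 0) (Const 1)) (Assign 3 (Const 1)))
     (While (Less (Reg 2) (Reg 3))
       (Seq (Seq (Assign 4 (Get 6 (Reg 2))) (Assign 2 (Succ (Reg 2)))) (for_nbrs bfs_body)))"

text \<open>Time is budgeted as a weight on the vertices not yet taken from a work list. Injectivity
  guarantees that the share of the next entry has not been spent before.\<close>

lemma sum_worklist:
  fixes w :: "nat \<Rightarrow> nat"
  assumes "inj_on f {..<t}" "h < t" "f h < n"
  shows "sum w ({..<n} - f ` {..<h}) = w (f h) + sum w ({..<n} - f ` {..<Suc h})"
proof -
  have "f h \<noteq> f i" if "i < h" for i
    using assms(1,2) that inj_onD[of f "{..<t}" h i] by auto
  then have "f h \<in> {..<n} - f ` {..<h}" using assms(3) by auto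
  moreover have "{..<n} - f ` {..<Suc h} = ({..<n} - f ` {..<h}) - {f h}" unfolding lessThan_Suc by blast
  ultimately show ?thesis using sum.remove[of "{..<n} - f ` {..<h}" "f h" w] by simp
qed

context ram_input
begin

text \<open>\<open>d\<close> counts the finished entries of the queue and \<open>t\<close> all
  entries.\<close>

definition bfs_core :: "nat \<Rightarrow> nat \<Rightarrow> (nat \<Rightarrow> nat) \<Rightarrow> (nat \<Rightarrow> nat) \<Rightarrow> (nat \<Rightarrow> nat) \<Rightarrow> bool" where
  "bfs_core d t L p q \<longleftrightarrow>
     inj_on q {..<t} \<and> q ` {..<t} = {v. L v \<noteq> 0} \<and> (\<forall>v. L v \<noteq> 0 \<longrightarrow> v < n) \<and> 0 < t \<and> q 0 = 0 \<and> L 0 = 1 \<and>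
     (\<forall>v. L v \<noteq> 0 \<longrightarrow> v \<noteq> 0 \<longrightarrow> adjacent G v (p v) \<and> L (p v) \<noteq> 0 \<and> L v = Suc (L (p v))) \<and>
     (\<forall>i j. i \<le> j \<longrightarrow> j < t \<longrightarrow> L (q i) \<le> L (q j)) \<and>
     (\<forall>i<d. \<forall>y. adjacent G (q i) y \<longrightarrow> L y \<noteq> 0 \<and> L y \<le> Suc (L (q i)))"

text \<open>By \<open>cap\<close> the value given to \<open>w\<close> is the largest in the queue,
  so appending \<open>w\<close> keeps the queue sorted by layers.\<close>

lemma bfs_visit:
  assumes c: "bfs_core d t L p q" and d: "d < t" "q d = v" and cap: "\<And>j. j < t \<Longrightarrow> L (q j) \<le> Suc (L v)"
    and w: "adjacent G v w" "L w = 0"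
  shows "bfs_core d (Suc t) (L(w := Suc (L v))) (p(w := v)) (q(t := w))"
    and "\<And>j. j < Suc t \<Longrightarrow> (L(w := Suc (L v))) ((q(t := w)) j) \<le> Suc ((L(w := Suc (L v))) v)"
proof -
  let ?L = "L(w := Suc (L v))" and ?p = "p(w := v)" and ?q = "q(t := w)"
  have inj: "inj_on q {..<t}" and im: "q ` {..<t} = {v. L v \<noteq> 0}" and less: "\<And>v. L v \<noteq> 0 \<Longrightarrow> v < n"
    and t: "0 < t" "q 0 = 0" "L 0 = 1"
    and par: "\<And>v. L v \<noteq> 0 \<Longrightarrow> v \<noteq> 0 \<Longrightarrow> adjacent G v (p v) \<and> L (p v) \<noteq> 0 \<and> L v = Suc (L (p v))"
    and mono: "\<And>i j. i \<le> j \<Longrightarrow> j < t \<Longrightarrow> L (q i) \<le> L (q j)"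
    and fin: "\<And>i y. i < d \<Longrightarrow> adjacent G (q i) y \<Longrightarrow> L y \<noteq> 0 \<and> L y \<le> Suc (L (q i))"
    using c unfolding bfs_core_def by blast+
  have qw: "q j \<noteq> w" "L (q j) \<noteq> 0" if "j < t" for j
    using im imageI[of j "{..<t}" q] that w(2) by auto
  have v: "L v \<noteq> 0" "v \<noteq> w" using qw[of d] d by auto
  have w0: "w \<noteq> 0" using t(3) w(2) by (metis zero_neq_one)
  show cap': "?L (?q j) \<le> Suc (?L v)" if "j < Suc t" for j
    using that cap qw[of j] v by (cases "j = t") auto
  show "bfs_core d (Suc t) ?L ?p ?q"
    unfolding bfs_core_def
  proof (intro conjI allI impI)
    have "inj_on ?q {..<t}" using inj by (rule inj_on_cong[THEN iffD1, rotated]) auto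
    moreover have "w \<notin> ?q ` {..<t}" using qw by auto
    ultimately show "inj_on ?q {..<Suc t}" by (simp add: lessThan_Suc)
    have "?q ` {..<t} = q ` {..<t}" by auto
    then show "?q ` {..<Suc t} = {v. ?L v \<noteq> 0}" using im by (auto simp: lessThan_Suc)
    show "u < n" if "?L u \<noteq> 0" for u using that less adjacent_less[OF w(1)] by (cases "u = w") auto
    show "0 < Suc t" "?q 0 = 0" "?L 0 = 1" using t w0 by auto
    fix u assume u: "?L u \<noteq> 0" "u \<noteq> 0"
    show "adjacent G u (?p u)" "?L (?p u) \<noteq> 0" "?L u = Suc (?L (?p u))"
      using par[of u] u v w adjacent_commute[of G w v] by (cases "u = w"; auto)+
  next
    fix i j assume ij: "i \<le> j" "j < Suc t"
    show "?L (?q i) \<le> ?L (?q j)"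
    proof (cases "j = t")
      case True
      then show ?thesis using cap'[of i] ij v by simp
    next
      case False
      then show ?thesis using mono[of i j] ij qw[of i] qw[of j] by simp
    qed
  next
    fix i y assume iy: "i < d" "adjacent G (?q i) y"
    have it: "?q i = q i" "q i \<noteq> w" using iy(1) d qw[of i] by auto
    then show "?L y \<noteq> 0" "?L y \<le> Suc (?L (?q i))" using fin[of i y] iy w(2) by auto
  qed
qed

definition bfs_done :: "(nat \<Rightarrow> nat) \<Rightarrow> (nat \<Rightarrow> nat) \<Rightarrow> (nat \<Rightarrow> nat) \<Rightarrow> bool" where
  "bfs_done L p q \<longleftrightarrow> q ` {..<n} = {..<n} \<and> (\<forall>v<n. L v \<noteq> 0) \<and> L 0 = 1 \<and>
     (\<forall>v<n. v \<noteq> 0 \<longrightarrow> adjacent G v (p v) \<and> L v = Suc (L (p v))) \<and>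
     (\<forall>i j. i \<le> j \<longrightarrow> j < n \<longrightarrow> L (q i) \<le> L (q j)) \<and>
     (\<forall>u v. adjacent G u v \<longrightarrow> L u \<le> Suc (L v))"

lemma connected_closed_set:
  assumes "0 \<in> S" "\<And>x y. x \<in> S \<Longrightarrow> adjacent G x y \<Longrightarrow> y \<in> S" "v < n"
  shows "v \<in> S"
proof -
  obtain p where p: "is_path_between G 0 p v"
    using conn assms(3) n_pos verts_G unfolding connected_graph_def by (metis lessThan_iff)
  then have "p ! i \<in> S" if "i < length p" for i
    using that
  proof (induction i)
    case 0
    then show ?case using p assms(1) by (simp add: is_path_between_def hd_conv_nth)
  next
    case (Suc i)
    then show ?case using p assms(2) by (auto simp: is_path_between_def is_path_def)
  qed
  then show ?thesis using p by (auto simp: is_path_between_def is_path_def last_conv_nth)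
qed

text \<open>Without open entries the visited set is closed under adjacency, and connectedness makes
  it everything.\<close>

lemma bfs_finished:
  assumes "bfs_core t t L p q"
  shows "bfs_done L p q" "t = n"
proof -
  have inj: "inj_on q {..<t}" and im: "q ` {..<t} = {v. L v \<noteq> 0}" and less: "\<And>v. L v \<noteq> 0 \<Longrightarrow> v < n"
    and t: "0 < t" "q 0 = 0" "L 0 = 1"
    and par: "\<And>v. L v \<noteq> 0 \<Longrightarrow> v \<noteq> 0 \<Longrightarrow> adjacent G v (p v) \<and> L (p v) \<noteq> 0 \<and> L v = Suc (L (p v))"
    and mono: "\<And>i j. i \<le> j \<Longrightarrow> j < t \<Longrightarrow> L (q i) \<le> L (q j)"
    and fin: "\<And>i y. i < t \<Longrightarrow> adjacent G (q i) y \<Longrightarrow> L y \<noteq> 0 \<and> L y \<le> Suc (L (q i))"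
    using assms unfolding bfs_core_def by blast+
  have cl: "L y \<noteq> 0 \<and> L y \<le> Suc (L x)" if "L x \<noteq> 0" "adjacent G x y" for x y
  proof -
    have "x \<in> q ` {..<t}" using im that(1) by simp
    then show ?thesis using fin that(2) by auto
  qed
  have all: "L v \<noteq> 0" if "v < n" for v
    using connected_closed_set[of "{v. L v \<noteq> 0}" v] cl t(3) that by simp
  have im': "q ` {..<t} = {..<n}" using im all less by auto
  then show "t = n" using card_image[OF inj] by simp
  then show "bfs_done L p q"
    unfolding bfs_done_def
    using im' all t par mono cl adjacent_less adjacent_commute[of G] by metis
qed

definition inp0 :: "(nat \<Rightarrow> nat \<Rightarrow> nat) \<Rightarrow> bool" where
  "inp0 ar \<longleftrightarrow> inp ar \<and> (\<forall>a\<ge>7. ar a = (\<lambda>_. 0))"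

lemma wp_bfs_prog:
  assumes s: "inp0 (arrs s)" "regs s 0 = n" "regs s 2 = 0" "arrs s 4 = (\<lambda>_. 0)" "arrs s 6 = (\<lambda>_. 0)"
    and m: "(\<Sum>v<n. length (adj ! v) * (cost bfs_body + 3) + 5) + 3 + r \<le> m"
    and Q: "\<And>s m. inp0 (arrs s) \<Longrightarrow> regs s 0 = n \<Longrightarrow> regs s 2 = n \<Longrightarrow>
      bfs_done (arrs s 4) (arrs s 5) (arrs s 6) \<Longrightarrow> r \<le> m \<Longrightarrow> Q s m"
  shows "wp bfs_prog Q s m"
  unfolding bfs_prog_def
proof (rule wp_Seq, rule wp_straight)
  let ?C = "cost bfs_body + 3"
  let ?w = "\<lambda>v. length (adj ! v) * ?C + 5"
  \<comment> \<open>This bound is kept apart from \<open>bfs_core\<close> because position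
    \<open>h\<close> holds a queue entry only while \<open>h < t\<close>.\<close>
  define cap where "cap h t L q \<longleftrightarrow> (\<forall>j<t. L (q j) \<le> Suc (L (q h)))" for h t :: nat and L q :: "nat \<Rightarrow> nat"
  define I where "I s m \<longleftrightarrow> (\<exists>h t. regs s 2 = h \<and> regs s 3 = t \<and> h \<le> t \<and> regs s 0 = n \<and> inp0 (arrs s) \<and>
      bfs_core h t (arrs s 4) (arrs s 5) (arrs s 6) \<and> (h < t \<longrightarrow> cap h t (arrs s 4) (arrs s 6)) \<and>
      sum ?w ({..<n} - arrs s 6 ` {..<h}) + 1 + r \<le> m)" for s :: ram_state and m
  let ?Init = "Seq (Put 4 (Const 0) (Const 1)) (Assign 3 (Const 1))"
  let ?P = "Seq (Assign 4 (Get 6 (Reg 2))) (Assign 2 (Succ (Reg 2)))"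
  fix m' assume m': "m \<le> m' + cost ?Init"
  have "{x. x = (0::nat)} = {0}" by auto
  \<comment> \<open>The root need not be written into the queue: array 6 is zero at the start, so
    position 0 already holds vertex 0.\<close>
  then have "bfs_core 0 1 ((\<lambda>_. 0)(0 := 1)) (arrs s 5) (\<lambda>_. 0)"
    unfolding bfs_core_def using n_pos by (auto simp: inj_on_def)
  moreover have "sum ?w {..<n} + 1 + r \<le> m'" using m m' by simp
  moreover have "inp0 (arrs (effect ?Init s))" using s(1) by (simp add: inp0_def inp_def)
  ultimately have I0: "I (effect ?Init s) m'"
    unfolding I_def using s by - (rule exI[of _ 0], rule exI[of _ 1], simp add: cap_def)
  show "wp (While (Less (Reg 2) (Reg 3)) (Seq ?P (for_nbrs bfs_body))) Q (effect ?Init s) m'"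
  proof (rule wp_While[of I])
    show "I (effect ?Init s) m'" by (rule I0)
    show "1 \<le> m" if "I s m" for s m using that by (auto simp: I_def)
    show "Q s (m - 1)" if Is: "I s m" and b: "\<not> bval (Less (Reg 2) (Reg 3)) s" for s m
    proof -
      obtain h where h: "regs s 2 = h" "regs s 3 = h" "regs s 0 = n" "inp0 (arrs s)"
        "bfs_core h h (arrs s 4) (arrs s 5) (arrs s 6)" "1 + r \<le> m"
        using Is b by (auto simp: I_def)
      then show ?thesis using bfs_finished[OF h(5)] by (intro Q) auto
    qed
    show "wp (Seq ?P (for_nbrs bfs_body)) I s (m - 1)"
      if Is: "I s m" and b: "bval (Less (Reg 2) (Reg 3)) s" for s m
    proof (rule wp_Seq, rule wp_straight)
      obtain h t where h: "regs s 2 = h" "regs s 3 = t" "h < t" "regs s 0 = n" "inp0 (arrs s)"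
        "bfs_core h t (arrs s 4) (arrs s 5) (arrs s 6)" "cap h t (arrs s 4) (arrs s 6)"
        "sum ?w ({..<n} - arrs s 6 ` {..<h}) + 1 + r \<le> m"
        using Is b by (auto simp: I_def)
      define v where "v = arrs s 6 h"
      have inj: "inj_on (arrs s 6) {..<t}" and im: "arrs s 6 ` {..<t} = {v. arrs s 4 v \<noteq> 0}"
        and ln: "\<And>v. arrs s 4 v \<noteq> 0 \<Longrightarrow> v < n" using h(6) unfolding bfs_core_def by blast+
      have vn: "v < n" using imageI[of h "{..<t}" "arrs s 6"] h(3) im ln by (simp add: v_def)
      have sm: "sum ?w ({..<n} - arrs s 6 ` {..<h}) = ?w v + sum ?w ({..<n} - arrs s 6 ` {..<Suc h})"
        using sum_worklist[OF inj h(3)] vn by (simp add: v_def)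
      let ?R = "sum ?w ({..<n} - arrs s 6 ` {..<Suc h}) + 1 + r"
      show "straight ?P" by simp
      show "cost ?P \<le> m - 1" using h(8) sm by simp
      fix m2 assume "m - 1 \<le> m2 + cost ?P"
      then have m2: "length (adj ! v) * ?C + 2 + ?R \<le> m2" using h(8) sm by simp
      let ?J = "\<lambda>X ar rg. inp0 ar \<and> rg 0 = n \<and> rg 2 = Suc h \<and> h < rg 3 \<and> ar 6 h = v \<and>
         (\<forall>i\<le>h. ar 6 i = arrs s 6 i) \<and>
         bfs_core h (rg 3) (ar 4) (ar 5) (ar 6) \<and> cap h (rg 3) (ar 4) (ar 6) \<and> (\<forall>y\<in>X. ar 4 y \<noteq> 0)"
      show "wp (for_nbrs bfs_body) I (effect ?P s) m2"
      proof (rule wp_for_nbrs[OF _ vn, where J = ?J, OF _ _ _ _ _ m2])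
        show "straight bfs_body" by (simp add: bfs_body_def)
        show "regs (effect ?P s) 4 = v" using h by (simp add: v_def)
        show "?J {} (arrs (effect ?P s)) (aux (effect ?P s))" using h by (simp add: aux_apply v_def)
        show "inp ar" if "?J X ar rg" for X ar rg using that by (simp add: inp0_def)
        show "?J (insert w X) (arrs (effect bfs_body s)) (aux (effect bfs_body s)) \<and>
            regs (effect bfs_body s) 4 = v \<and> regs (effect bfs_body s) 5 = regs s 5"
          if J: "?J X (arrs s) (aux s)" and r: "regs s 4 = v" "regs s 6 = w" and vw: "adjacent G v w" for X s w
        proof (cases "arrs s 4 w = 0")
          case True
          let ?t = "regs s 3"
          have t: "h < ?t" "arrs s 6 h = v" "bfs_core h ?t (arrs s 4) (arrs s 5) (arrs s 6)"
            and cp: "\<And>j. j < ?t \<Longrightarrow> arrs s 4 (arrs s 6 j) \<le> Suc (arrs s 4 v)"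
            using J by (auto simp: aux_apply cap_def)
          note new = bfs_visit[OF t(3,1,2) cp vw True]
          show ?thesis using J r True new t
            by (simp add: bfs_body_def aux_apply inp0_def inp_def cap_def)
        next
          case False
          then show ?thesis using J r by (simp add: bfs_body_def aux_apply)
        qed
        show "I s' m" if J: "?J (nbs v) (arrs s') (aux s')" and r: "?R \<le> m" for s' m
        proof -
          let ?t = "regs s' 3"
          have t: "h < ?t" "arrs s' 6 h = v" "bfs_core h ?t (arrs s' 4) (arrs s' 5) (arrs s' 6)"
            and cp: "\<And>j. j < ?t \<Longrightarrow> arrs s' 4 (arrs s' 6 j) \<le> Suc (arrs s' 4 v)"
            and nb: "\<And>y. adjacent G v y \<Longrightarrow> arrs s' 4 y \<noteq> 0"
            using J by (auto simp: aux_apply cap_def nbs_def)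
          have im: "arrs s' 6 ` {..<?t} = {v. arrs s' 4 v \<noteq> 0}"
            and mono: "\<And>i j. i \<le> j \<Longrightarrow> j < ?t \<Longrightarrow> arrs s' 4 (arrs s' 6 i) \<le> arrs s' 4 (arrs s' 6 j)"
            using t(3) by (auto simp: bfs_core_def)
          have "arrs s' 4 y \<le> Suc (arrs s' 4 v)" if "adjacent G v y" for y
          proof -
            have "y \<in> arrs s' 6 ` {..<?t}" using nb[OF that] im by simp
            then show ?thesis using cp by auto
          qed
          then have "bfs_core (Suc h) ?t (arrs s' 4) (arrs s' 5) (arrs s' 6)"
            using t nb unfolding bfs_core_def by (auto simp: less_Suc_eq)
          \<comment> \<open>The next entry is in a layer at least as high as the finished one, so
            the bound carries over.\<close>
          moreover have "cap (Suc h) ?t (arrs s' 4) (arrs s' 6)" if "Suc h < ?t"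
            unfolding cap_def using cp mono[of h "Suc h"] that t(2) by (meson Suc_le_mono le_SucI le_refl order_trans)
          moreover have "arrs s' 6 ` {..<Suc h} = arrs s 6 ` {..<Suc h}" using J by (auto simp: less_Suc_eq_le)
          ultimately show ?thesis unfolding I_def using J r t
            by - (rule exI[of _ "Suc h"], rule exI[of _ ?t], auto simp: aux_apply)
        qed
      qed
    qed
  qed
qed (use m in auto)

end

locale bfs_input = ram_input +
  fixes L p q :: "nat \<Rightarrow> nat"
  assumes bfs_done: "bfs_done L p q"
begin

definition lay :: "nat \<Rightarrow> nat" where "lay v = L v - 1"

lemma lay_eq: "v < n \<Longrightarrow> L v = Suc (lay v)"
  using bfs_done by (simp add: bfs_done_def lay_def)

lemma queue: "q ` {..<n} = {..<n}" "i \<le> j \<Longrightarrow> j < n \<Longrightarrow> lay (q i) \<le> lay (q j)"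
  using bfs_done by (simp_all add: bfs_done_def lay_def diff_le_mono)

sublocale bfs_layers G lay p
proof
  have p: "adjacent G v (p v)" "L v = Suc (L (p v))" if "v < n" "v \<noteq> 0" for v
    using bfs_done that by (auto simp: bfs_done_def)
  show "universally_signable G" by (rule us)
  show "0 \<in> verts G" using n_pos verts_G by simp
  show "lay 0 = 0" using bfs_done by (simp add: bfs_done_def lay_def)
  show "adjacent G v (p v)" if "v \<in> verts G" "v \<noteq> 0" for v using p that verts_G by simp
  show "lay v = Suc (lay (p v))" if "v \<in> verts G" "v \<noteq> 0" for v
    using p[of v] that verts_G lay_eq[of v] lay_eq[of "p v"] adjacent_less[of v "p v"] by simp
  show "lay u \<le> Suc (lay v)" if "adjacent G u v" for u v
    using bfs_done that adjacent_less[OF that] lay_eq[of u] lay_eq[of v] by (force simp: bfs_done_def)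
qed

end

subsection \<open>Clusters\<close>

text \<open>Array 7 holds the cluster label plus one (zero for unlabelled vertices), array 8 the vertices in the order of
  labelling, array 9 a second lower neighbour of each cluster. Instead of all pairs of lower neighbours of a
  cluster, only its two recorded ones are linked: by \<open>lower_neighbours_clique_or_pair\<close> all others are
  adjacent to both of them.\<close>

definition visit :: "aexp \<Rightarrow> com" where
  "visit e = Cond (Equal (Get 7 e) (Const 0))
     (Seq (Put 8 (Reg 3) e) (Seq (Assign 3 (Succ (Reg 3))) (Put 7 e (Succ (Reg 7))))) Skip"

abbreviation label_of :: "aexp \<Rightarrow> aexp" where
  "label_of e \<equiv> Minus (Get 7 e) (Const 1)"

definition search_body :: com where
  "search_body = Cond (Equal (Get 4 (Reg 6)) (Get 4 (Reg 4)))
     (visit (Reg 6))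
     (Cond (Less (Get 4 (Reg 4)) (Get 4 (Reg 6)))
       (Seq (visit (Get 5 (label_of (Reg 6)))) (visit (Get 9 (label_of (Reg 6)))))
       (Cond (Equal (Reg 6) (Get 5 (Reg 7))) Skip (Put 9 (Reg 7) (Reg 6))))"

definition search_loop :: com where
  "search_loop = While (Less (Reg 8) (Reg 3))
     (Seq (Seq (Assign 4 (Get 8 (Reg 8))) (Assign 8 (Succ (Reg 8)))) (for_nbrs search_body))"

definition search_init :: com where
  "search_init = Seq (Put 9 (Reg 7) (Get 5 (Reg 7))) (Seq (Put 8 (Reg 3) (Reg 7))
     (Seq (Assign 3 (Succ (Reg 3))) (Put 7 (Reg 7) (Succ (Reg 7)))))"

definition cluster_prog :: com where
  "cluster_prog = Seq (Seq (Assign 3 (Const 0)) (Assign 8 (Const 0)))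
     (While (Less (Const 0) (Reg 2))
       (Seq (Seq (Assign 2 (Minus (Reg 2) (Const 1))) (Assign 7 (Get 6 (Reg 2))))
         (Cond (Equal (Get 7 (Reg 7)) (Const 0)) (Seq search_init search_loop) Skip)))"

section \<open>Invariants of the cluster search\<close>

context bfs_input
begin

text \<open>What is guaranteed once the edge to \<open>y\<close> has been examined from
  \<open>u\<close>. As labels are stored plus one, \<open>M y - 1\<close> is the vertex that names
  the cluster of \<open>y\<close>.\<close>

definition ok :: "(nat \<Rightarrow> nat) \<Rightarrow> (nat \<Rightarrow> nat) \<Rightarrow> nat \<Rightarrow> nat \<Rightarrow> bool" where
  "ok M D u y \<longleftrightarrow> (lay y = lay u \<longrightarrow> M y = M u) \<and>
     (below y u \<longrightarrow> M y \<noteq> 0 \<and> M (p (M y - 1)) = M u \<and> M (D (M y - 1)) = M u) \<and>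
     (below u y \<longrightarrow> y \<noteq> p (M u - 1) \<longrightarrow> D (M u - 1) \<noteq> p (M u - 1))"

text \<open>\<open>ow\<close> is the order of labelling, with \<open>d\<close> finished entries out
  of \<open>t\<close>. The condition \<open>c \<noteq> 0\<close> exempts the root, which has no
  lower neighbour.\<close>

definition lab_core :: "nat \<Rightarrow> nat \<Rightarrow> (nat \<Rightarrow> nat) \<Rightarrow> (nat \<Rightarrow> nat) \<Rightarrow> (nat \<Rightarrow> nat) \<Rightarrow> bool" where
  "lab_core d t M ow D \<longleftrightarrow> inj_on ow {..<t} \<and> ow ` {..<t} = {v. M v \<noteq> 0} \<and> (\<forall>v. M v \<noteq> 0 \<longrightarrow> v < n) \<and>
     (\<forall>v. M v \<noteq> 0 \<longrightarrow> M (M v - 1) = M v \<and> lay (M v - 1) = lay v \<and> (M v - 1, v) \<in> joined G (above (lay v))) \<and>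
     (\<forall>c. c \<noteq> 0 \<longrightarrow> M c = Suc c \<longrightarrow> (\<exists>w. M w = Suc c \<and> below w (D c))) \<and>
     (\<forall>k<d. \<forall>y. adjacent G (ow k) y \<longrightarrow> ok M D (ow k) y)"

text \<open>Invariant while the cluster named \<open>l\<close> is explored. \<open>B\<close> is a
  frame: vertices that the outer loop must still know to be labelled afterwards.\<close>

definition search_inv :: "nat set \<Rightarrow> nat \<Rightarrow> nat \<Rightarrow> nat \<Rightarrow> (nat \<Rightarrow> nat) \<Rightarrow> (nat \<Rightarrow> nat) \<Rightarrow> (nat \<Rightarrow> nat) \<Rightarrow> bool" where
  "search_inv B l d t M ow D \<longleftrightarrow> lab_core d t M ow D \<and> d \<le> t \<and> M l = Suc l \<and> (\<forall>v. M v \<noteq> 0 \<longrightarrow> lay l \<le> lay v) \<and>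
     (\<forall>v<n. lay l < lay v \<longrightarrow> v \<in> ow ` {..<d}) \<and> (\<forall>k. d \<le> k \<longrightarrow> k < t \<longrightarrow> M (ow k) = Suc l) \<and> (\<forall>x\<in>B. M x \<noteq> 0)"

text \<open>All labels that \<open>ok\<close> relies on are required to be nonzero or to equal the
  nonzero label of \<open>u\<close>. They are therefore already set, and labelling a further vertex
  does not touch them.\<close>

lemma ok_label:
  assumes "ok M D u y" "M u \<noteq> 0" "M e = 0"
  shows "ok (M(e := x)) D u y"
  using assms unfolding ok_def by (metis fun_upd_other)

text \<open>The record of cluster \<open>l\<close> changes, and \<open>l\<close> is no higher than
  \<open>u\<close>, whereas the second clause of \<open>ok\<close> looks at a cluster above
  \<open>u\<close>. The third clause survives because \<open>w \<noteq> p l\<close>.\<close>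

lemma ok_two:
  assumes "ok M D u y" "M u \<noteq> 0" "lay l \<le> lay u" "w \<noteq> p l" "below y u \<Longrightarrow> lay (M y - 1) = lay y"
  shows "ok M (D(l := w)) u y"
proof -
  have "M y - 1 \<noteq> l" if "below y u" using assms(3,5) that by (auto simp: below_def)
  then show ?thesis using assms(1,4) unfolding ok_def by auto
qed

context
  fixes B l d t M ow D
  assumes inv: "search_inv B l d t M ow D"
begin

lemma search_facts:
  shows "inj_on ow {..<t}" "ow ` {..<t} = {v. M v \<noteq> 0}" "d \<le> t" "M l = Suc l" "l < n"
    and "\<And>v. M v \<noteq> 0 \<Longrightarrow> v < n"
    and "\<And>v. M v \<noteq> 0 \<Longrightarrow> M (M v - 1) = M v"
    and "\<And>v. M v \<noteq> 0 \<Longrightarrow> lay (M v - 1) = lay v"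
    and "\<And>v. M v \<noteq> 0 \<Longrightarrow> (M v - 1, v) \<in> joined G (above (lay v))"
    and "\<And>c. c \<noteq> 0 \<Longrightarrow> M c = Suc c \<Longrightarrow> \<exists>w. M w = Suc c \<and> below w (D c)"
    and "\<And>k y. k < d \<Longrightarrow> adjacent G (ow k) y \<Longrightarrow> ok M D (ow k) y"
    and "\<And>v. M v \<noteq> 0 \<Longrightarrow> lay l \<le> lay v"
    and "\<And>v. v < n \<Longrightarrow> lay l < lay v \<Longrightarrow> v \<in> ow ` {..<d}"
    and "\<And>k. d \<le> k \<Longrightarrow> k < t \<Longrightarrow> M (ow k) = Suc l"
    and "\<And>x. x \<in> B \<Longrightarrow> M x \<noteq> 0"
proof -
  note inv' = inv[unfolded search_inv_def lab_core_def]
  show "inj_on ow {..<t}" "ow ` {..<t} = {v. M v \<noteq> 0}" "d \<le> t" and Ml: "M l = Suc l"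
    using inv' by - (elim conjE, assumption)+
  have A: "\<forall>v. M v \<noteq> 0 \<longrightarrow> v < n"
    "\<forall>v. M v \<noteq> 0 \<longrightarrow> M (M v - 1) = M v \<and> lay (M v - 1) = lay v \<and> (M v - 1, v) \<in> joined G (above (lay v))"
    "\<forall>c. c \<noteq> 0 \<longrightarrow> M c = Suc c \<longrightarrow> (\<exists>w. M w = Suc c \<and> below w (D c))"
    "\<forall>k<d. \<forall>y. adjacent G (ow k) y \<longrightarrow> ok M D (ow k) y" "\<forall>v. M v \<noteq> 0 \<longrightarrow> lay l \<le> lay v"
    "\<forall>v<n. lay l < lay v \<longrightarrow> v \<in> ow ` {..<d}" "\<forall>k. d \<le> k \<longrightarrow> k < t \<longrightarrow> M (ow k) = Suc l" "\<forall>x\<in>B. M x \<noteq> 0"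
    using inv' by - (elim conjE, assumption)+
  show "M v \<noteq> 0 \<Longrightarrow> v < n" for v using A(1) by blast
  from this[of l] show "l < n" using Ml by simp
  show "M v \<noteq> 0 \<Longrightarrow> M (M v - 1) = M v" "M v \<noteq> 0 \<Longrightarrow> lay (M v - 1) = lay v"
    "M v \<noteq> 0 \<Longrightarrow> (M v - 1, v) \<in> joined G (above (lay v))" for v
    using A(2)[rule_format, of v] by blast+
  show "c \<noteq> 0 \<Longrightarrow> M c = Suc c \<Longrightarrow> \<exists>w. M w = Suc c \<and> below w (D c)" for c using A(3) by blast
  show "k < d \<Longrightarrow> adjacent G (ow k) y \<Longrightarrow> ok M D (ow k) y" for k y using A(4) by blast
  show "M v \<noteq> 0 \<Longrightarrow> lay l \<le> lay v" for v using A(5) by blast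
  show "v < n \<Longrightarrow> lay l < lay v \<Longrightarrow> v \<in> ow ` {..<d}" for v using A(6) by blast
  show "d \<le> k \<Longrightarrow> k < t \<Longrightarrow> M (ow k) = Suc l" for k using A(7) by blast
  show "x \<in> B \<Longrightarrow> M x \<noteq> 0" for x using A(8) by blast
qed

lemma search_o: "k < t \<Longrightarrow> M (ow k) \<noteq> 0"
  using search_facts(2) by blast

lemma search_visit:
  assumes e: "e < n" "M e = 0" "lay e = lay l" "(l, e) \<in> joined G (above (lay l))"
  shows "search_inv B l d (Suc t) (M(e := Suc l)) (ow(t := e)) D"
  unfolding search_inv_def lab_core_def
proof (intro conjI allI impI ballI)
  let ?M = "M(e := Suc l)" and ?ow = "ow(t := e)"
  note f = search_facts
  have oe: "ow k \<noteq> e" if "k < t" for k using search_o[OF that] e(2) by metis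
  have ol: "?ow ` {..<t} = ow ` {..<t}" "?ow ` {..<d} = ow ` {..<d}" using f(3) by auto
  have le: "l \<noteq> e" using f(4) e(2) by auto
  have "inj_on ?ow {..<t}" using f(1) by (rule inj_on_cong[THEN iffD1, rotated]) auto
  moreover have "e \<notin> ?ow ` {..<t}" using oe unfolding ol by auto
  ultimately show "inj_on ?ow {..<Suc t}" by (simp add: lessThan_Suc)
  show "?ow ` {..<Suc t} = {v. ?M v \<noteq> 0}"
    using f(2) ol(1) by (auto simp: lessThan_Suc)
  show "d \<le> Suc t" using f(3) by simp
  show "?M l = Suc l" using f(4) le by simp
  show "v < n" if "?M v \<noteq> 0" for v using that f(6) e(1) by (cases "v = e") auto
  show "?M (?M v - 1) = ?M v" if "?M v \<noteq> 0" for v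
    using that f(4) f(7)[of v] e(2) le by (cases "v = e") auto
  show "lay (?M v - 1) = lay v" if "?M v \<noteq> 0" for v
    using that f(8)[of v] e(3) by (cases "v = e") auto
  show "(?M v - 1, v) \<in> joined G (above (lay v))" if "?M v \<noteq> 0" for v
    using that f(9)[of v] e(3,4) by (cases "v = e") auto
  show "\<exists>w. ?M w = Suc c \<and> below w (D c)" if "c \<noteq> 0" "?M c = Suc c" for c
  proof -
    have "M c = Suc c" using that(2) le by (cases "c = e") auto
    from f(10)[OF that(1) this] obtain w where w: "M w = Suc c" "below w (D c)" by blast
    then have "w \<noteq> e" using e(2) by auto
    then show ?thesis using w by auto
  qed
  show "ok ?M D (?ow k) y" if "k < d" "adjacent G (?ow k) y" for k y
  proof -
    have k: "k < t" using that(1) f(3) by simp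
    then have "ok M D (ow k) y" using f(11) that by auto
    then show ?thesis using ok_label[of M D "ow k" y e "Suc l"] search_o[OF k] e(2) k by simp
  qed
  show "lay l \<le> lay v" if "?M v \<noteq> 0" for v using that f(12)[of v] e(3) by (cases "v = e") auto
  show "v \<in> ?ow ` {..<d}" if "v < n" "lay l < lay v" for v unfolding ol using f(13) that by blast
  show "?M (?ow k) = Suc l" if "d \<le> k" "k < Suc t" for k
    using f(14)[of k] that oe[of k] by (cases "k = t") auto
  show "?M x \<noteq> 0" if "x \<in> B" for x using f(15)[OF that] by simp
qed

lemma search_two:
  assumes v: "M v = Suc l" "below v w" "w \<noteq> p l"
  shows "search_inv B l d t M ow (D(l := w))"
  unfolding search_inv_def lab_core_def
proof (intro conjI allI impI ballI)
  note f = search_facts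
  show "\<exists>u. M u = Suc c \<and> below u ((D(l := w)) c)" if "c \<noteq> 0" "M c = Suc c" for c
    using f(10)[OF that] v by (cases "c = l") auto
  show "ok M (D(l := w)) (ow k) y" if "k < d" "adjacent G (ow k) y" for k y
  proof (rule ok_two[OF f(11)[OF that]])
    have k: "k < t" using that(1) f(3) by simp
    show "M (ow k) \<noteq> 0" by (rule search_o[OF k])
    show "lay l \<le> lay (ow k)" by (rule f(12)[OF search_o[OF k]])
    show "w \<noteq> p l" by (rule v(3))
    show "lay (M y - 1) = lay y" if "below y (ow k)"
    proof -
      have "M y \<noteq> 0" using f(11)[OF \<open>k < d\<close> \<open>adjacent G (ow k) y\<close>] that by (simp add: ok_def)
      then show ?thesis by (rule f(8))
    qed
  qed
qed (rule search_facts; assumption)+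

context
  fixes v
  assumes d: "d < t" and v: "ow d = v"
begin

lemma current: "M v = Suc l" "lay v = lay l" "v < n"
proof -
  show *: "M v = Suc l" using search_facts(14)[of d] d v by simp
  then show "lay v = lay l" "v < n" using search_facts(8)[of v] search_facts(6)[of v] by simp_all
qed

text \<open>In the order of labelling, positions from \<open>d\<close> on belong to \<open>l\<close>
  and earlier ones are finished.\<close>

lemma labelled_cases: "M e \<noteq> 0 \<Longrightarrow> M e = Suc l \<or> (\<forall>y. adjacent G e y \<longrightarrow> ok M D e y)"
proof -
  assume "M e \<noteq> 0"
  then have "e \<in> ow ` {..<t}" using search_facts(2) by blast
  then obtain k where k: "k < t" "e = ow k" by blast
  then show ?thesis using search_facts(14)[of k] search_facts(11)[of k] by (cases "k < d") auto
qed

text \<open>If \<open>e\<close> had a label other than that of \<open>l\<close> it would be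
  finished, and then its edge to \<open>v\<close> would have given \<open>v\<close> the same
  label.\<close>

lemma same_layer_target:
  assumes e: "adjacent G v e" "lay e = lay v"
  shows "e < n" "lay e = lay l" "(l, e) \<in> joined G (above (lay l))" "M e \<noteq> 0 \<Longrightarrow> M e = Suc l"
proof -
  show "e < n" using adjacent_less[OF e(1)] by simp
  show l: "lay e = lay l" using e(2) current(2) by simp
  have "(l, v) \<in> joined G (above (lay l))" using search_facts(9)[of v] current by simp
  moreover have "(v, e) \<in> joined G (above (lay l))"
    using e adjacent_less[OF e(1)] l current verts_G by (intro joined_edge) (auto simp: above_def)
  ultimately show "(l, e) \<in> joined G (above (lay l))" by (rule joined_trans)
  show "M e = Suc l" if "M e \<noteq> 0"
    using labelled_cases[OF that] current(1) e(2) adj_sym[OF e(1)] by (auto simp: ok_def)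
qed

text \<open>This justifies linking only the two recorded lower neighbours \<open>p c\<close> and
  \<open>D c\<close> of the cluster above. Suppose that \<open>e\<close> had another label than
  \<open>l\<close>. Then \<open>e\<close> is finished, so \<open>p c\<close> and \<open>D c\<close>
  share its label, and \<open>v\<close> is neither of them. As \<open>v\<close> is a further lower
  neighbour, a second one was recorded, so \<open>p c\<close>, \<open>D c\<close> and
  \<open>v\<close> are distinct. Three lower neighbours are pairwise adjacent, hence
  \<open>e\<close> is adjacent to \<open>v\<close> in the same layer and would have passed its label
  on.\<close>

lemma upper_target:
  assumes w: "below w v" and c: "c = M w - 1" and e: "e = p c \<or> e = D c"
  shows "M w \<noteq> 0" "e < n" "lay e = lay l" "(l, e) \<in> joined G (above (lay l))" "M e \<noteq> 0 \<Longrightarrow> M e = Suc l"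
proof -
  note f = search_facts
  have wv: "adjacent G w v" "lay w = Suc (lay l)" using w current(2) by (auto simp: below_def)
  have wn: "w < n" using adjacent_less[OF wv(1)] by simp
  \<comment> \<open>The higher layers are finished throughout the search of
    \<open>l\<close>.\<close>
  obtain k where k: "k < d" "w = ow k" using f(13)[of w] wn wv by auto
  show Mw: "M w \<noteq> 0" using search_o[of k] k d by simp
  have Mc: "M c = Suc c" "M w = Suc c" "lay c = lay w" using f(7,8)[OF Mw] Mw c by simp_all
  then have c0: "c \<noteq> 0" using wv(2) lay_Suc_ne_0 by metis
  have cn: "c < n" "c \<in> verts G" using f(6)[of c] Mc verts_G by auto
  have bc: "below c (p c)" using below_par[OF cn(2) c0] .
  obtain w' where w': "M w' = Suc c" "below w' (D c)" using f(10)[OF c0 Mc(1)] by blast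
  obtain x where x: "M x = Suc c" "below x e" using e bc w' Mc by blast
  have lx: "lay x = lay c" using f(8)[of x] x by simp
  have xe: "adjacent G x e" "lay x = Suc (lay e)" using x(2) by (auto simp: below_def)
  show en: "e < n" using adjacent_less[OF xe(1)] by simp
  show le: "lay e = lay l" using xe(2) lx Mc(3) wv(2) by simp
  have sub: "above (Suc (lay l)) \<subseteq> above (lay l)" by (auto simp: above_def)
  have jcx: "(c, x) \<in> joined G (above (Suc (lay l)))" if "M x = Suc c" for x
    using f(8)[of x] f(9)[of x] that Mc(3) wv(2) by simp
  have V: "v \<in> above (lay l)" "w \<in> above (lay l)" "x \<in> above (lay l)" "e \<in> above (lay l)"
    using current wv wn xe en le f(6)[of x] x verts_G by (auto simp: above_def)
  have j1: "(l, v) \<in> joined G (above (lay l))" using f(9)[of v] current by simp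
  have j2: "(v, w) \<in> joined G (above (lay l))" using V adj_sym[OF wv(1)] by (intro joined_edge)
  have j3: "(w, c) \<in> joined G (above (lay l))" using joined_sym[OF jcx[OF Mc(2)]] joined_mono[OF sub] by blast
  have j4: "(c, x) \<in> joined G (above (lay l))" using jcx[OF x(1)] joined_mono[OF sub] by blast
  have j5: "(x, e) \<in> joined G (above (lay l))" using V xe(1) by (intro joined_edge)
  show "(l, e) \<in> joined G (above (lay l))"
    by (rule joined_trans[OF j1 joined_trans[OF j2 joined_trans[OF j3 joined_trans[OF j4 j5]]]])
  assume Me: "M e \<noteq> 0"
  show "M e = Suc l"
  proof (rule ccontr)
    assume ne: "M e \<noteq> Suc l"
    then have oke: "ok M D e y" if "adjacent G e y" for y using labelled_cases[OF Me] that by blast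
    have okw: "ok M D w v" using f(11)[OF k(1)] k(2) wv(1) by simp
    have lv: "lay e = lay v" using le current(2) by simp
    have ve: "v \<noteq> e" using ne current(1) by auto
    have nadj: "\<not> adjacent G e v" using oke[of v] lv ne current(1) by (auto simp: ok_def)
    have "ok M D e x" using oke adj_sym[OF xe(1)] by blast
    then have tgt: "M (p c) = M e" "M (D c) = M e" using x by (auto simp: ok_def)
    then have vpD: "v \<noteq> p c" "v \<noteq> D c" using ne current(1) by auto
    then have Dp: "D c \<noteq> p c" using okw w Mc(2) by (simp add: ok_def)
    \<comment> \<open>\<open>e'\<close> is the other recorded lower neighbour; it only serves as the
      third vertex.\<close>
    obtain e' where e': "e' \<noteq> e" "e' = p c \<or> e' = D c" using e Dp by metis
    have low: "lay a = lay l \<and> (\<exists>b. adjacent G a b \<and> (c, b) \<in> joined G (above (Suc (lay l))))"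
      if ab: "below b a" "M b = Suc c" for a b
    proof
      have "lay b = lay c" using f(8)[of b] ab by simp
      then show "lay a = lay l" using ab(1) Mc(3) wv(2) by (simp add: below_def)
      show "\<exists>b. adjacent G a b \<and> (c, b) \<in> joined G (above (Suc (lay l)))"
        using jcx[OF ab(2)] ab(1) adj_sym unfolding below_def by blast
    qed
    have "adjacent G e v"
    proof (rule lower_neighbours_clique_or_pair[of c "lay l" e v e'])
      show "c \<in> above (Suc (lay l))" using cn Mc(3) wv(2) by (simp add: above_def)
      show "lay a = lay l \<and> (\<exists>b. adjacent G a b \<and> (c, b) \<in> joined G (above (Suc (lay l))))"
        if "a \<in> {e, v, e'}" for a
        using low[OF x(2,1)] low[OF w Mc(2)] low[OF bc Mc(1)] low[OF w'(2,1)] e'(2) that by blast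
    qed (use ve e' vpD in auto)
    then show False using nadj by simp
  qed
qed

end

end

definition nb_inv :: "nat set \<Rightarrow> nat \<Rightarrow> nat \<Rightarrow> nat \<Rightarrow> nat set \<Rightarrow> nat \<Rightarrow> (nat \<Rightarrow> nat) \<Rightarrow> (nat \<Rightarrow> nat) \<Rightarrow> (nat \<Rightarrow> nat) \<Rightarrow> bool" where
  "nb_inv B l d v X t M ow D \<longleftrightarrow> search_inv B l d t M ow D \<and> d < t \<and> ow d = v \<and> (\<forall>y\<in>X. ok M D v y)"

lemma nb_visit:
  assumes J: "nb_inv B l d v X t M ow D"
    and e: "e < n" "lay e = lay l" "(l, e) \<in> joined G (above (lay l))" "M e = 0"
  shows "nb_inv B l d v X (Suc t) (M(e := Suc l)) (ow(t := e)) D"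
proof -
  have s: "search_inv B l d t M ow D" and d: "d < t" and v: "ow d = v" and X: "\<And>y. y \<in> X \<Longrightarrow> ok M D v y"
    using J by (auto simp: nb_inv_def)
  have Mv: "M v \<noteq> 0" using current[OF s d v] by simp
  show ?thesis unfolding nb_inv_def
    using search_visit[OF s e(1,4,2,3)] d v ok_label[OF X Mv e(4)] by simp
qed

lemma effect_visit:
  "effect (visit e) s = (if arrs s 7 (aval e s) = 0 then effect (Seq (Put 8 (Reg 3) e)
     (Seq (Assign 3 (Succ (Reg 3))) (Put 7 e (Succ (Reg 7))))) s else s)"
  by (simp add: visit_def)

definition nb_state :: "nat set \<Rightarrow> nat \<Rightarrow> nat \<Rightarrow> nat \<Rightarrow> nat \<Rightarrow> nat set \<Rightarrow> (nat \<Rightarrow> nat \<Rightarrow> nat) \<Rightarrow> (nat \<Rightarrow> nat) \<Rightarrow> bool" where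
  "nb_state B i l d v X ar rg \<longleftrightarrow> inp ar \<and> (\<forall>a\<ge>10. ar a = (\<lambda>_. 0)) \<and> ar 4 = L \<and> ar 5 = p \<and> ar 6 = q \<and>
     rg 0 = n \<and> rg 2 = i \<and> rg 7 = l \<and> rg 8 = Suc d \<and> nb_inv B l d v X (rg 3) (ar 7) (ar 8) (ar 9)"

text \<open>\<open>visit\<close> evaluates its argument repeatedly while array 8 and register 3
  change; the assumptions \<open>x\<close> say that the value stays the same meanwhile.\<close>

lemma nb_state_visit:
  assumes J: "nb_state B i l d v X (arrs s) (aux s)"
    and x: "aval x s = e" "aval x (s\<lparr>arrs := (arrs s)(8 := (arrs s 8)(regs s 3 := e))\<rparr>) = e"
     "aval x (s\<lparr>arrs := (arrs s)(8 := (arrs s 8)(regs s 3 := e)), regs := (regs s)(3 := Suc (regs s 3))\<rparr>) = e"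
    and e: "e < n" "lay e = lay l" "(l, e) \<in> joined G (above (lay l))" "arrs s 7 e \<noteq> 0 \<Longrightarrow> arrs s 7 e = Suc l"
    and s': "s' = effect (visit x) s"
  shows "nb_state B i l d v X (arrs s') (aux s')" "\<forall>r\<in>{4, 5, 6}. regs s' r = regs s r"
    "arrs s' 7 e = Suc l" "\<And>y. arrs s 7 y \<noteq> 0 \<Longrightarrow> arrs s' 7 y = arrs s 7 y" "arrs s' 9 = arrs s 9"
proof -
  let ?s = "s\<lparr>regs := (regs s)(3 := Suc (regs s 3)),
    arrs := (arrs s)(8 := (arrs s 8)(regs s 3 := e), 7 := (arrs s 7)(e := Suc (regs s 7)))\<rparr>"
  have rl: "regs s 7 = l" using J by (simp add: nb_state_def aux_apply)
  have eff: "s' = (if arrs s 7 e = 0 then ?s else s)"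
    unfolding s' effect_visit using x by simp
  have J': "nb_inv B l d v X (regs s 3) (arrs s 7) (arrs s 8) (arrs s 9)"
    using J by (simp add: nb_state_def aux_apply)
  show "nb_state B i l d v X (arrs s') (aux s')"
  proof (cases "arrs s 7 e = 0")
    case True
    then show ?thesis
      using J eff nb_visit[OF J' e(1-3) True] rl by (simp add: nb_state_def aux_apply inp_def)
  next
    case False
    then show ?thesis using J eff by simp
  qed
  show "\<forall>r\<in>{4, 5, 6}. regs s' r = regs s r" using eff by auto
  show "arrs s' 7 e = Suc l" "\<And>y. arrs s 7 y \<noteq> 0 \<Longrightarrow> arrs s' 7 y = arrs s 7 y" "arrs s' 9 = arrs s 9"
    using eff e(4) rl by auto
qed

lemma nb_state_insert:
  assumes "nb_state B i l d v X ar rg" "ok (ar 7) (ar 9) v w"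
  shows "nb_state B i l d v (insert w X) ar rg"
  using assms by (simp add: nb_state_def nb_inv_def)

lemma search_body_step:
  assumes J: "nb_state B i l d v X (arrs s) (aux s)" and r: "regs s 4 = v" "regs s 6 = w" and vw: "adjacent G v w"
    and s': "s' = effect search_body s"
  shows "nb_state B i l d v (insert w X) (arrs s') (aux s') \<and> regs s' 4 = v \<and> regs s' 5 = regs s 5"
proof -
  have ar: "arrs s 4 = L" "arrs s 5 = p" "regs s 7 = l" using J by (simp_all add: nb_state_def aux_apply)
  have nb: "search_inv B l d (regs s 3) (arrs s 7) (arrs s 8) (arrs s 9)" "d < regs s 3" "arrs s 8 d = v"
    "\<And>y. y \<in> X \<Longrightarrow> ok (arrs s 7) (arrs s 9) v y"
    using J by (auto simp: nb_state_def nb_inv_def aux_apply)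
  note cur = current[OF nb(1-3)]
  have vwn: "v < n" "w < n" using adjacent_less[OF vw] by auto
  have L: "L v = Suc (lay v)" "L w = Suc (lay w)" using lay_eq vwn by auto
  consider "lay w = lay v" | "below w v" | "below v w"
    using lay_edge[OF vw] lay_edge[OF adj_sym[OF vw]] vw adj_sym[OF vw] unfolding below_def by linarith
  then show ?thesis
  proof cases
    case 1
    then have e: "s' = effect (visit (Reg 6)) s" using s' ar r L by (simp add: search_body_def)
    note tgt = same_layer_target[OF nb(1-3) vw 1]
    have "aval (Reg 6) s = w" using r by simp
    note vis = nb_state_visit[OF J this _ _ tgt e]
    have "arrs s' 7 v = Suc l" using vis(4)[of v] cur(1) r by simp
    then have "ok (arrs s' 7) (arrs s' 9) v w" using vis(3) 1 r by (simp add: ok_def below_def)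
    then show ?thesis using nb_state_insert vis(1,2) r by simp
  next
    case 2
    let ?c = "arrs s 7 w - 1"
    let ?xp = "Get 5 (label_of (Reg 6))" and ?xd = "Get 9 (label_of (Reg 6))"
    define s1 where "s1 = effect (visit ?xp) s"
    have e: "s' = effect (visit ?xd) s1" using s' ar r L 2 by (simp add: search_body_def s1_def below_def)
    note t1 = upper_target[OF nb(1-3) 2 refl disjI1[OF refl]]
    have "aval ?xp s = p ?c"
      "aval ?xp (s\<lparr>arrs := (arrs s)(8 := (arrs s 8)(regs s 3 := p ?c))\<rparr>) = p ?c"
      "aval ?xp (s\<lparr>arrs := (arrs s)(8 := (arrs s 8)(regs s 3 := p ?c)), regs := (regs s)(3 := Suc (regs s 3))\<rparr>) = p ?c"
      using ar r by simp_all
    note vis1 = nb_state_visit[OF J this t1(2-5) s1_def]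
    have v1: "nb_state B i l d v X (arrs s1) (aux s1)" "regs s1 4 = v" "regs s1 5 = regs s 5" "regs s1 6 = w"
      "arrs s1 7 (p ?c) = Suc l" "\<And>y. arrs s 7 y \<noteq> 0 \<Longrightarrow> arrs s1 7 y = arrs s 7 y" "arrs s1 9 = arrs s 9"
      using vis1(1,2,3,5) vis1(4) r by simp_all
    \<comment> \<open>The second visit starts from the state left by the first one, which may have
      labelled its target too, so the facts about the second target are derived for the new
      state.\<close>
    have nb1: "search_inv B l d (regs s1 3) (arrs s1 7) (arrs s1 8) (arrs s1 9)" "d < regs s1 3" "arrs s1 8 d = v"
      using v1(1) by (auto simp: nb_state_def nb_inv_def aux_apply)
    have w1: "arrs s1 7 w = arrs s 7 w" "arrs s 7 w \<noteq> 0" using t1(1) v1(6) by simp_all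
    let ?e = "arrs s 9 ?c"
    note t2 = upper_target[OF nb1 2 refl disjI2[OF refl], unfolded w1(1) v1(7)]
    have "aval ?xd s1 = ?e"
      "aval ?xd (s1\<lparr>arrs := (arrs s1)(8 := (arrs s1 8)(regs s1 3 := ?e))\<rparr>) = ?e"
      "aval ?xd (s1\<lparr>arrs := (arrs s1)(8 := (arrs s1 8)(regs s1 3 := ?e)), regs := (regs s1)(3 := Suc (regs s1 3))\<rparr>) = ?e"
      using v1(4,7) w1(1) by simp_all
    note vis2 = nb_state_visit[OF v1(1) this t2(2-5) e]
    have v2: "nb_state B i l d v X (arrs s') (aux s')" "regs s' 4 = v" "regs s' 5 = regs s 5"
      "arrs s' 7 (arrs s 9 ?c) = Suc l" "\<And>y. arrs s1 7 y \<noteq> 0 \<Longrightarrow> arrs s' 7 y = arrs s1 7 y" "arrs s' 9 = arrs s 9"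
      using vis2(1,2,3,5) vis2(4) v1(2,3,7) by simp_all
    have "arrs s' 7 w = arrs s 7 w" "arrs s' 7 v = Suc l" "arrs s' 7 (p ?c) = Suc l"
      using v2(5)[of w] v2(5)[of v] v2(5)[of "p ?c"] v1(5) v1(6)[of v] w1 cur(1) by simp_all
    then have "ok (arrs s' 7) (arrs s' 9) v w" using v2(4,6) w1(2) 2 by (simp add: ok_def below_def)
    then show ?thesis using nb_state_insert v2 by simp
  next
    case 3
    \<comment> \<open>Any lower neighbour other than \<open>p l\<close> may serve as the second one,
      so an earlier record is simply overwritten.\<close>
    then have e: "s' = (if w = p l then s else s\<lparr>arrs := (arrs s)(9 := (arrs s 9)(l := w))\<rparr>)"
      using s' ar r L by (simp add: search_body_def below_def)
    have okw: "ok (arrs s 7) D v w" if "w \<noteq> p l \<Longrightarrow> D l \<noteq> p l" for D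
      using 3 that cur(1) by (simp add: ok_def below_def)
    show ?thesis
    proof (cases "w = p l")
      case True
      then show ?thesis using e J okw[of "arrs s 9"] nb_state_insert r by simp
    next
      case False
      let ?D = "(arrs s 9)(l := w)"
      have "ok (arrs s 7) ?D v y" if "y \<in> X" for y
      proof (rule ok_two[OF nb(4)[OF that]])
        show "lay (arrs s 7 y - 1) = lay y" if "below y v"
          using nb(4)[OF \<open>y \<in> X\<close>] that search_facts(8)[OF nb(1), of y] by (simp add: ok_def)
      qed (use cur False in auto)
      then have "nb_inv B l d v X (regs s 3) (arrs s 7) (arrs s 8) ?D"
        unfolding nb_inv_def using search_two[OF nb(1) cur(1) 3 False] nb by simp
      then have "nb_state B i l d v X (arrs s') (aux s')"
        using e J False by (simp add: nb_state_def aux_apply inp_def)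
      then show ?thesis using e False okw[of ?D] nb_state_insert r by simp
    qed
  qed
qed

end

lemma effect_visit_order:
  "k < regs s 3 \<Longrightarrow> arrs (effect (visit e) s) 8 k = arrs s 8 k \<and> k < regs (effect (visit e) s) 3"
  by (simp add: visit_def)

text \<open>Visits only append to the order. The processed prefix, on which the remaining time
  budget depends, is thus unchanged.\<close>

lemma effect_search_body_order:
  "k < regs s 3 \<Longrightarrow> arrs (effect search_body s) 8 k = arrs s 8 k"
  by (simp add: search_body_def effect_visit_order del: effect.simps(4) add: effect.simps(4)[of "visit _"])

context bfs_input
begin

definition base :: "ram_state \<Rightarrow> bool" where
  "base s \<longleftrightarrow> inp (arrs s) \<and> (\<forall>a\<ge>10. arrs s a = (\<lambda>_. 0)) \<and> arrs s 4 = L \<and> arrs s 5 = p \<and> arrs s 6 = q \<and>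
     regs s 0 = n"

abbreviation search_weight :: "nat \<Rightarrow> nat" where
  "search_weight v \<equiv> length (adj ! v) * (cost search_body + 3) + 5"

lemma search_advance:
  assumes inv: "search_inv B l d t M ow D" and d: "d < t"
    and ok: "\<And>y. adjacent G (ow d) y \<Longrightarrow> ok M D (ow d) y"
  shows "search_inv B l (Suc d) t M ow D"
  unfolding search_inv_def lab_core_def
proof (intro conjI allI impI ballI)
  note f = search_facts[OF inv]
  show "ok M D (ow k) y" if "k < Suc d" "adjacent G (ow k) y" for k y
    using f(11)[of k y] ok[of y] that by (cases "k = d") auto
  show "v \<in> ow ` {..<Suc d}" if "v < n" "lay l < lay v" for v
    using f(13)[OF that] by (rule rev_subsetD) (intro image_mono, simp)
  show "M (ow k) = Suc l" if "Suc d \<le> k" "k < t" for k using f(14)[of k] that by simp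
  show "Suc d \<le> t" using d by simp
qed (rule search_facts[OF inv]; assumption)+

text \<open>The budget is a sum over all vertices not yet processed, and what remains of it is
  handed on to \<open>Q\<close>. In this way all searches together stay within one linear
  bound.\<close>

lemma wp_search_loop:
  assumes s: "base s" "regs s 2 = i" "regs s 7 = l"
      "search_inv B l (regs s 8) (regs s 3) (arrs s 7) (arrs s 8) (arrs s 9)"
    and m: "sum search_weight ({..<n} - arrs s 8 ` {..<regs s 8}) + 1 + r \<le> m"
    and Q: "\<And>s m. base s \<Longrightarrow> regs s 2 = i \<Longrightarrow> regs s 8 = regs s 3 \<Longrightarrow>
      search_inv B l (regs s 3) (regs s 3) (arrs s 7) (arrs s 8) (arrs s 9) \<Longrightarrow>
      sum search_weight ({..<n} - arrs s 8 ` {..<regs s 3}) + r \<le> m \<Longrightarrow> Q s m"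
  shows "wp search_loop Q s m"
  unfolding search_loop_def
proof -
  let ?C = "cost search_body + 3"
  let ?P = "Seq (Assign 4 (Get 8 (Reg 8))) (Assign 8 (Succ (Reg 8)))"
  define I where "I s m \<longleftrightarrow> base s \<and> regs s 2 = i \<and> regs s 7 = l \<and>
      search_inv B l (regs s 8) (regs s 3) (arrs s 7) (arrs s 8) (arrs s 9) \<and>
      sum search_weight ({..<n} - arrs s 8 ` {..<regs s 8}) + 1 + r \<le> m" for s :: ram_state and m
  show "wp (While (Less (Reg 8) (Reg 3)) (Seq ?P (for_nbrs search_body))) Q s m"
  proof (rule wp_While[of I])
    show "I s m" using s m by (simp add: I_def)
    show "1 \<le> m" if "I s m" for s m using that by (simp add: I_def)
    show "Q s (m - 1)" if Is: "I s m" and b: "\<not> bval (Less (Reg 8) (Reg 3)) s" for s m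
    proof -
      have "regs s 8 \<le> regs s 3" using Is search_facts(3) unfolding I_def by blast
      then have "regs s 8 = regs s 3" using b by simp
      then show ?thesis using Is by (intro Q) (auto simp: I_def)
    qed
    show "wp (Seq ?P (for_nbrs search_body)) I s (m - 1)"
      if Is: "I s m" and b: "bval (Less (Reg 8) (Reg 3)) s" for s m
    proof (rule wp_Seq, rule wp_straight)
      define d where "d = regs s 8"
      define v where "v = arrs s 8 d"
      have h: "base s" "regs s 2 = i" "regs s 7 = l" "d < regs s 3"
        and inv: "search_inv B l d (regs s 3) (arrs s 7) (arrs s 8) (arrs s 9)"
        and m: "sum search_weight ({..<n} - arrs s 8 ` {..<d}) + 1 + r \<le> m"
        using Is b by (auto simp: I_def d_def)
      have vn: "v < n" using current(3)[OF inv h(4)] by (simp add: v_def)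
      have sm: "sum search_weight ({..<n} - arrs s 8 ` {..<d}) =
          search_weight v + sum search_weight ({..<n} - arrs s 8 ` {..<Suc d})"
        using sum_worklist[OF search_facts(1)[OF inv] h(4)] vn by (simp add: v_def)
      let ?R = "sum search_weight ({..<n} - arrs s 8 ` {..<Suc d}) + 1 + r"
      show "straight ?P" by simp
      show "cost ?P \<le> m - 1" using m sm by simp
      fix m2 assume "m - 1 \<le> m2 + cost ?P"
      then have m2: "length (adj ! v) * ?C + 2 + ?R \<le> m2" using m sm by simp
      let ?J = "\<lambda>X ar rg. nb_state B i l d v X ar rg \<and> (\<forall>k\<le>d. ar 8 k = arrs s 8 k)"
      show "wp (for_nbrs search_body) I (effect ?P s) m2"
      proof (rule wp_for_nbrs[OF _ vn, where J = ?J, OF _ _ _ _ _ m2])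
        show "straight search_body" by (simp add: search_body_def visit_def)
        show "regs (effect ?P s) 4 = v" by (simp add: v_def d_def)
        show "?J {} (arrs (effect ?P s)) (aux (effect ?P s))"
          using h inv by (simp add: nb_state_def nb_inv_def base_def aux_apply v_def d_def[symmetric])
        show "inp ar" if "?J X ar rg" for X ar rg using that by (simp add: nb_state_def)
        show "?J (insert w X) (arrs (effect search_body s')) (aux (effect search_body s')) \<and>
            regs (effect search_body s') 4 = v \<and> regs (effect search_body s') 5 = regs s' 5"
          if J: "?J X (arrs s') (aux s')" and r: "regs s' 4 = v" "regs s' 6 = w" and vw: "adjacent G v w" for X s' w
        proof -
          have "d < regs s' 3" using J by (simp add: nb_state_def nb_inv_def aux_apply)
          then have "\<forall>k\<le>d. arrs (effect search_body s') 8 k = arrs s 8 k"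
            using effect_search_body_order[of _ s'] J by simp
          then show ?thesis using search_body_step[OF conjunct1[OF J] r vw refl] by simp
        qed
        show "I s' m" if J: "?J (nbs v) (arrs s') (aux s')" and r: "?R \<le> m" for s' m
        proof -
          let ?t = "regs s' 3"
          have st: "base s'" "regs s' 2 = i" "regs s' 7 = l" "regs s' 8 = Suc d" "d < ?t" "arrs s' 8 d = v"
            and inv': "search_inv B l d ?t (arrs s' 7) (arrs s' 8) (arrs s' 9)"
            and ok: "\<And>y. adjacent G v y \<Longrightarrow> ok (arrs s' 7) (arrs s' 9) v y"
            using J by (auto simp: nb_state_def nb_inv_def base_def aux_apply nbs_def)
          have "search_inv B l (Suc d) ?t (arrs s' 7) (arrs s' 8) (arrs s' 9)"
            using ok st(6) by (intro search_advance[OF inv' st(5)]) simp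
          moreover have "arrs s' 8 ` {..<Suc d} = arrs s 8 ` {..<Suc d}" using J by (auto simp: less_Suc_eq_le)
          ultimately show ?thesis unfolding I_def using st r by simp
        qed
      qed
    qed
  qed
qed

text \<open>A cluster is named after the first vertex found in it. Setting the record to
  \<open>p l\<close> means that no second lower neighbour is known yet.\<close>

lemma search_start:
  assumes c: "lab_core t t M ow D" and l: "l < n" "M l = 0"
    and lay: "\<And>v. M v \<noteq> 0 \<Longrightarrow> lay l \<le> lay v" "\<And>v. v < n \<Longrightarrow> lay l < lay v \<Longrightarrow> M v \<noteq> 0"
    and B: "\<And>x. x \<in> B \<Longrightarrow> M x \<noteq> 0"
  shows "search_inv B l t (Suc t) (M(l := Suc l)) (ow(t := l)) (D(l := p l))"
  unfolding search_inv_def lab_core_def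
proof (intro conjI allI impI ballI)
  let ?M = "M(l := Suc l)" and ?o = "ow(t := l)" and ?D = "D(l := p l)"
  note c' = c[unfolded lab_core_def]
  have A: "inj_on ow {..<t}" "ow ` {..<t} = {v. M v \<noteq> 0}" "\<forall>v. M v \<noteq> 0 \<longrightarrow> v < n"
    "\<forall>v. M v \<noteq> 0 \<longrightarrow> M (M v - 1) = M v \<and> lay (M v - 1) = lay v \<and> (M v - 1, v) \<in> joined G (above (lay v))"
    "\<forall>c. c \<noteq> 0 \<longrightarrow> M c = Suc c \<longrightarrow> (\<exists>w. M w = Suc c \<and> below w (D c))"
    "\<forall>k<t. \<forall>y. adjacent G (ow k) y \<longrightarrow> ok M D (ow k) y"
    using c' by - (elim conjE, assumption)+
  have ol: "ow k \<noteq> l" "M (ow k) \<noteq> 0" if "k < t" for k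
    using imageI[of k "{..<t}" ow] that l(2) A(2) by auto
  have oi: "?o ` {..<t} = ow ` {..<t}" by auto
  \<comment> \<open>The vertex naming a cluster is itself labelled, so the unlabelled
    \<open>l\<close> names none so far.\<close>
  have pl: "M v - 1 \<noteq> l" if "M v \<noteq> 0" for v
  proof
    assume "M v - 1 = l"
    then show False using A(4)[rule_format, OF that] that l(2) by simp
  qed
  have "inj_on ?o {..<t}" using A(1) by (rule inj_on_cong[THEN iffD1, rotated]) auto
  moreover have "l \<notin> ?o ` {..<t}" using ol unfolding oi by auto
  ultimately show "inj_on ?o {..<Suc t}" by (simp add: lessThan_Suc)
  show "?o ` {..<Suc t} = {v. ?M v \<noteq> 0}" using A(2) oi by (auto simp: lessThan_Suc)
  show "t \<le> Suc t" "?M l = Suc l" by simp_all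
  show "v < n" if "?M v \<noteq> 0" for v using that A(3) l(1) by (cases "v = l") auto
  show "?M (?M v - 1) = ?M v" "lay (?M v - 1) = lay v" "(?M v - 1, v) \<in> joined G (above (lay v))"
    if "?M v \<noteq> 0" for v
    using that A(4)[rule_format, of v] pl[of v] by (cases "v = l"; simp add: joined_refl)+
  show "\<exists>w. ?M w = Suc c \<and> below w (?D c)" if "c \<noteq> 0" "?M c = Suc c" for c
  proof (cases "c = l")
    case True
    then show ?thesis using below_par[of l] that(1) l(1) verts_G by (intro exI[of _ l]) simp
  next
    case False
    then have "M c = Suc c" using that(2) by simp
    from A(5)[rule_format, OF that(1) this] obtain w where "M w = Suc c" "below w (D c)" by blast
    moreover from this have "w \<noteq> l" using l(2) by auto
    ultimately show ?thesis using False by auto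
  qed
  show "ok ?M ?D (?o k) y" if "k < t" "adjacent G (?o k) y" for k y
  proof -
    define u where "u = ow k"
    have u: "?o k = u" "M u \<noteq> 0" "u \<noteq> l" using ol[OF that(1)] that(1) by (simp_all add: u_def)
    have "adjacent G u y" using that(2) u(1) by simp
    then have o: "ok M D u y" using A(6)[rule_format, OF that(1), of y] unfolding u_def by blast
    have 1: "?M y = ?M u" if "lay y = lay u"
    proof -
      have "M y = M u" using o that by (simp add: ok_def)
      moreover from this have "y \<noteq> l" using u(2) l(2) by metis
      ultimately show ?thesis using u(3) by simp
    qed
    have 2: "?M y \<noteq> 0 \<and> ?M (p (?M y - 1)) = ?M u \<and> ?M (?D (?M y - 1)) = ?M u" if "below y u"
    proof -
      have y: "M y \<noteq> 0" "M (p (M y - 1)) = M u" "M (D (M y - 1)) = M u" using o that by (auto simp: ok_def)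
      then have "y \<noteq> l" "p (M y - 1) \<noteq> l" "D (M y - 1) \<noteq> l" using u(2) l(2) by metis+
      then show ?thesis using y u pl[OF y(1)] by simp
    qed
    have 3: "below u y \<Longrightarrow> y \<noteq> p (?M u - 1) \<Longrightarrow> ?D (?M u - 1) \<noteq> p (?M u - 1)"
      using o u pl[OF u(2)] by (simp add: ok_def)
    show ?thesis unfolding u(1) unfolding ok_def using 1 2 3 by blast
  qed
  show "lay l \<le> lay v" if "?M v \<noteq> 0" for v using that lay(1)[of v] by (cases "v = l") auto
  show "v \<in> ?o ` {..<t}" if "v < n" "lay l < lay v" for v unfolding oi A(2) using lay(2)[OF that] by simp
  show "?M (?o k) = Suc l" if "t \<le> k" "k < Suc t" for k using that by simp
  show "?M x \<noteq> 0" if "x \<in> B" for x using B[OF that] by simp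
qed

definition clusters_done :: "(nat \<Rightarrow> nat) \<Rightarrow> (nat \<Rightarrow> nat) \<Rightarrow> bool" where
  "clusters_done M D \<longleftrightarrow>
     (\<forall>v<n. M v \<noteq> 0 \<and> M v - 1 < n \<and> M (M v - 1) = M v \<and> lay (M v - 1) = lay v \<and>
        (M v - 1, v) \<in> joined G (above (lay v))) \<and>
     (\<forall>c. c \<noteq> 0 \<longrightarrow> M c = Suc c \<longrightarrow> (\<exists>w. M w = Suc c \<and> below w (D c))) \<and>
     (\<forall>u y. adjacent G u y \<longrightarrow> ok M D u y)"

lemma clusters_finished:
  assumes c: "lab_core t t M ow D" and all: "\<And>j. j < n \<Longrightarrow> M (q j) \<noteq> 0"
  shows "clusters_done M D"
proof -
  note c' = c[unfolded lab_core_def]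
  have A: "ow ` {..<t} = {v. M v \<noteq> 0}" "\<forall>v. M v \<noteq> 0 \<longrightarrow> v < n"
    "\<forall>v. M v \<noteq> 0 \<longrightarrow> M (M v - 1) = M v \<and> lay (M v - 1) = lay v \<and> (M v - 1, v) \<in> joined G (above (lay v))"
    "\<forall>c. c \<noteq> 0 \<longrightarrow> M c = Suc c \<longrightarrow> (\<exists>w. M w = Suc c \<and> below w (D c))"
    "\<forall>k<t. \<forall>y. adjacent G (ow k) y \<longrightarrow> ok M D (ow k) y"
    using c' by - (elim conjE, assumption)+
  have M: "M v \<noteq> 0" if "v < n" for v
  proof -
    have "v \<in> q ` {..<n}" using queue(1) that by simp
    then show ?thesis using all by auto
  qed
  have "ok M D u y" if "adjacent G u y" for u y
  proof -
    have "M u \<noteq> 0" using M adjacent_less[OF that] by simp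
    then have "u \<in> ow ` {..<t}" using A(1) by simp
    then show ?thesis using A(5) that by auto
  qed
  moreover have "M v - 1 < n" if "v < n" for v
    using A(2)[rule_format, of "M v - 1"] A(3)[rule_format, OF M[OF that]] M[OF that] by simp
  ultimately show ?thesis unfolding clusters_done_def using M A(3,4) by blast
qed

text \<open>The queue is read backwards, so layers never increase. The 10 steps per vertex cover the
  test, two assignments, the conditional, the four steps of \<open>search_init\<close> and the last
  test of the search loop.\<close>

lemma wp_cluster_prog:
  assumes s: "base s" "regs s 2 = n" "arrs s 7 = (\<lambda>_. 0)" 
    and m: "n * 10 + sum search_weight {..<n} + 3 + r \<le> m"
    and Q: "\<And>s m. base s \<Longrightarrow> clusters_done (arrs s 7) (arrs s 9) \<Longrightarrow> r \<le> m \<Longrightarrow> Q s m"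
  shows "wp cluster_prog Q s m"
  unfolding cluster_prog_def
proof (rule wp_Seq, rule wp_straight)
  let ?Init = "Seq (Assign 3 (Const 0)) (Assign 8 (Const 0))"
  let ?P = "Seq (Assign 2 (Minus (Reg 2) (Const 1))) (Assign 7 (Get 6 (Reg 2)))"
  let ?body = "Seq ?P (Cond (Equal (Get 7 (Reg 7)) (Const 0)) (Seq search_init search_loop) Skip)"
  define I where "I s m \<longleftrightarrow> (\<exists>i t. base s \<and> regs s 2 = i \<and> i \<le> n \<and> regs s 3 = t \<and> regs s 8 = t \<and>
      lab_core t t (arrs s 7) (arrs s 8) (arrs s 9) \<and>
      (\<forall>j. i \<le> j \<longrightarrow> j < n \<longrightarrow> arrs s 7 (q j) \<noteq> 0) \<and> (\<forall>v. arrs s 7 v \<noteq> 0 \<longrightarrow> (\<forall>j<i. lay (q j) \<le> lay v)) \<and>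
      i * 10 + sum search_weight ({..<n} - arrs s 8 ` {..<t}) + 1 + r \<le> m)" for s :: ram_state and m
  fix m' assume m': "m \<le> m' + cost ?Init"
  have "lab_core 0 0 (\<lambda>_. 0) (arrs s 8) (arrs s 9)" by (simp add: lab_core_def)
  then have I0: "I (effect ?Init s) m'"
    unfolding I_def using s m m' by - (rule exI[of _ n], rule exI[of _ 0], simp add: base_def)
  show "wp (While (Less (Const 0) (Reg 2)) ?body) Q (effect ?Init s) m'"
  proof (rule wp_While[of I])
    show "I (effect ?Init s) m'" by (rule I0)
    show "1 \<le> m" if "I s m" for s m using that by (auto simp: I_def)
    show "Q s (m - 1)" if Is: "I s m" and b: "\<not> bval (Less (Const 0) (Reg 2)) s" for s m
    proof -
      obtain t where h: "base s" "lab_core t t (arrs s 7) (arrs s 8) (arrs s 9)"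
        "\<And>j. j < n \<Longrightarrow> arrs s 7 (q j) \<noteq> 0" "1 + r \<le> m" using Is b by (auto simp: I_def)
      then show ?thesis using clusters_finished[OF h(2,3)] by (intro Q) auto
    qed
    show "wp ?body I s (m - 1)" if Is: "I s m" and b: "bval (Less (Const 0) (Reg 2)) s" for s m
    proof (rule wp_Seq, rule wp_straight)
      obtain i t where h: "base s" "regs s 2 = Suc i" "i < n" "regs s 3 = t" "regs s 8 = t"
        "lab_core t t (arrs s 7) (arrs s 8) (arrs s 9)"
        and lb: "\<And>j. Suc i \<le> j \<Longrightarrow> j < n \<Longrightarrow> arrs s 7 (q j) \<noteq> 0"
        and ly: "\<And>v j. arrs s 7 v \<noteq> 0 \<Longrightarrow> j < Suc i \<Longrightarrow> lay (q j) \<le> lay v"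
        and m: "Suc i * 10 + sum search_weight ({..<n} - arrs s 8 ` {..<t}) + 1 + r \<le> m"
        using Is b by (auto simp: I_def gr0_conv_Suc)
      define l where "l = q i"
      have ln: "l < n" using queue(1) h(3) by (auto simp: l_def)
      let ?W = "sum search_weight ({..<n} - arrs s 8 ` {..<t})"
      show "straight ?P" by simp
      show "cost ?P \<le> m - 1" using m by simp
      fix m2 assume "m - 1 \<le> m2 + cost ?P"
      then have m2: "i * 10 + 8 + ?W + r \<le> m2" using m by simp
      let ?s = "effect ?P s"
      have s1: "base ?s" "regs ?s 2 = i" "regs ?s 7 = l" "regs ?s 3 = t" "regs ?s 8 = t" "arrs ?s = arrs s"
        using h by (simp_all add: base_def l_def)
      show "wp (Cond (Equal (Get 7 (Reg 7)) (Const 0)) (Seq search_init search_loop) Skip) I ?s m2"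
      proof (rule wp_Cond)
        show "1 \<le> m2" using m2 by simp
        assume "\<not> bval (Equal (Get 7 (Reg 7)) (Const 0)) ?s"
        then have Ml: "arrs s 7 l \<noteq> 0" using s1 by simp
        show "wp Skip I ?s (m2 - 1)"
        proof (rule wp_straight)
          show "cost Skip \<le> m2 - 1" using m2 by simp
          fix m3 assume "m2 - 1 \<le> m3 + cost Skip"
          then have "i * 10 + ?W + 1 + r \<le> m3" using m2 by simp
          moreover have "arrs s 7 (q j) \<noteq> 0" if "i \<le> j" "j < n" for j
            using lb[of j] Ml that by (cases "j = i") (auto simp: l_def)
          ultimately have "I ?s m3" unfolding I_def s1(6)
            using s1 h(3,6) ly by - (rule exI[of _ i], rule exI[of _ t], simp)
          then show "I (effect Skip ?s) m3" by simp
        qed simp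
      next
        assume "bval (Equal (Get 7 (Reg 7)) (Const 0)) ?s"
        then have Ml: "arrs s 7 l = 0" using s1 by simp
        \<comment> \<open>The frame: queue positions already passed must remain labelled during the
          search.\<close>
        let ?B = "q ` {Suc i..<n}"
        \<comment> \<open>A vertex in a higher layer than \<open>l\<close> comes later in the queue
          and has been passed.\<close>
        have up: "arrs s 7 v \<noteq> 0" if "v < n" "lay l < lay v" for v
        proof -
          have "v \<in> q ` {..<n}" using queue(1) that(1) by simp
          then obtain j where j: "j < n" "v = q j" by auto
          have "\<not> j \<le> i" using queue(2)[of j i] h(3) j that(2) by (auto simp: l_def)
          then show ?thesis using lb[of j] j by simp
        qed
        have start: "search_inv ?B l t (Suc t) ((arrs s 7)(l := Suc l)) ((arrs s 8)(t := l)) ((arrs s 9)(l := p l))"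
        proof (rule search_start[OF h(6) ln Ml])
          show "lay l \<le> lay v" if "arrs s 7 v \<noteq> 0" for v using ly[OF that, of i] by (simp add: l_def)
          show "arrs s 7 x \<noteq> 0" if "x \<in> ?B" for x using that lb by auto
        qed (rule up)
        show "wp (Seq search_init search_loop) I ?s (m2 - 1)"
        proof (rule wp_Seq, rule wp_straight)
          show "straight search_init" by (simp add: search_init_def)
          show "cost search_init \<le> m2 - 1" using m2 by (simp add: search_init_def)
          fix m3 assume "m2 - 1 \<le> m3 + cost search_init"
          then have m3: "?W + 1 + (i * 10 + 1 + r) \<le> m3" using m2 by (simp add: search_init_def)
          let ?t = "effect search_init ?s"
          have p5: "arrs ?s 5 = p" using s1(1) by (simp add: base_def)
          have s2: "regs ?t = (regs ?s)(3 := Suc t)"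
            "arrs ?t = (arrs s)(9 := (arrs s 9)(l := p l), 8 := (arrs s 8)(t := l), 7 := (arrs s 7)(l := Suc l))"
            using s1(3,4) p5 unfolding s1(6)[symmetric]
            by (simp_all add: search_init_def del: effect.simps(4) add: effect.simps(4)[of "Put _ _ _"] effect.simps(4)[of "Assign 3 _"])
          have bt: "base ?t" using s1(1) unfolding base_def s1(6) s2 by (simp add: inp_def)
          show "wp search_loop I ?t m3"
          proof (rule wp_search_loop[where i = i and l = l and B = ?B and r = "i * 10 + 1 + r"])
            show "base ?t" by (rule bt)
            show "regs ?t 2 = i" "regs ?t 7 = l" using s1 s2 by simp_all
            show "search_inv ?B l (regs ?t 8) (regs ?t 3) (arrs ?t 7) (arrs ?t 8) (arrs ?t 9)"
              unfolding s2 using start s1 by simp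
            have "((arrs s 8)(t := l)) ` {..<t} = arrs s 8 ` {..<t}" by auto
            then show "sum search_weight ({..<n} - arrs ?t 8 ` {..<regs ?t 8}) + 1 + (i * 10 + 1 + r) \<le> m3"
              unfolding s2 using m3 s1(5) by simp
            show "I s' m4" if s': "base s'" "regs s' 2 = i" "regs s' 8 = regs s' 3"
              "search_inv ?B l (regs s' 3) (regs s' 3) (arrs s' 7) (arrs s' 8) (arrs s' 9)"
              "sum search_weight ({..<n} - arrs s' 8 ` {..<regs s' 3}) + (i * 10 + 1 + r) \<le> m4" for s' m4
            proof -
              note f = search_facts[OF s'(4)]
              have "arrs s' 7 (q j) \<noteq> 0" if "i \<le> j" "j < n" for j
                using f(15)[of "q j"] f(4) that by (cases "j = i") (auto simp: l_def)
              moreover have "lay (q j) \<le> lay v" if "arrs s' 7 v \<noteq> 0" "j < i" for v j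
                using f(12)[OF that(1)] queue(2)[of j i] that(2) h(3) by (simp add: l_def)
              moreover have "lab_core (regs s' 3) (regs s' 3) (arrs s' 7) (arrs s' 8) (arrs s' 9)"
                using s'(4) by (simp add: search_inv_def)
              ultimately show ?thesis unfolding I_def using s' h(3)
                by - (rule exI[of _ i], rule exI[of _ "regs s' 3"], simp)
            qed
          qed
        qed
      qed
    qed
  qed
qed (use m in auto)

end

subsection \<open>Representatives and output\<close>

text \<open>Array 11 flags the merged clusters, array 10 holds the second representatives, array 12 the representative
  of every vertex.\<close>

definition flag_body :: com where
  "flag_body = Cond (Equal (Get 4 (Reg 6)) (Get 4 (Reg 4)))
     (Cond (Equal (Get 5 (Reg 6)) (Get 5 (Reg 4))) Skip (Put 11 (label_of (Reg 4)) (Const 1)))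
     (Cond (Less (Get 4 (Reg 6)) (Get 4 (Reg 4)))
       (Seq (Cond (Equal (Reg 6) (Get 5 (Reg 4))) Skip (Put 11 (label_of (Reg 4)) (Const 1)))
         (Cond (Equal (Reg 6) (Get 5 (label_of (Reg 4)))) Skip
           (Seq (Put 10 (label_of (Reg 4)) (Reg 4))
             (Cond (Equal (Reg 6) (Get 9 (label_of (Reg 4)))) Skip (Put 11 (label_of (Reg 4)) (Const 1))))))
       Skip)"

definition rho_body :: com where
  "rho_body = Seq (Cond (Equal (Get 11 (label_of (Reg 2))) (Const 0))
      (Cond (Equal (Get 5 (Reg 2)) (Get 5 (label_of (Reg 2)))) (Put 12 (Reg 2) (label_of (Reg 2)))
        (Put 12 (Reg 2) (Get 10 (label_of (Reg 2)))))
      (Put 12 (Reg 2) (label_of (Reg 2))))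
    (Assign 2 (Succ (Reg 2)))"

definition rho_prog :: com where
  "rho_prog = Seq (Assign 2 (Const 0)) (While (Less (Reg 2) (Reg 0)) rho_body)"

definition emit :: "aexp \<Rightarrow> aexp \<Rightarrow> com" where
  "emit x y = Seq (Put 2 (Reg 1) x) (Seq (Put 3 (Reg 1) y) (Assign 1 (Succ (Reg 1))))"

definition out_body :: com where
  "out_body = Cond (Less (Get 4 (Reg 6)) (Get 4 (Reg 4)))
     (Seq (emit (Reg 4) (Get 12 (Reg 6))) (emit (Get 12 (Reg 4)) (Get 12 (Reg 6)))) Skip"

definition main_prog :: com where
  "main_prog = Seq bfs_prog (Seq cluster_prog (Seq (for_edges flag_body) (Seq rho_prog
     (Seq (Assign 1 (Const 0)) (for_edges out_body)))))"

locale cluster_input = bfs_input +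
  fixes M D :: "nat \<Rightarrow> nat"
  assumes clusters: "clusters_done M D"
begin

definition lab :: "nat \<Rightarrow> nat" where "lab v = M v - 1"

lemma M_facts:
  assumes "v < n"
  shows "M v = Suc (lab v)" "lab v < n" "lab (lab v) = lab v" "lay (lab v) = lay v"
    "(lab v, v) \<in> joined G (above (lay v))" "M (lab v) = Suc (lab v)"
proof -
  have "M v \<noteq> 0 \<and> M v - 1 < n \<and> M (M v - 1) = M v \<and> lay (M v - 1) = lay v \<and> (M v - 1, v) \<in> joined G (above (lay v))"
    using clusters assms unfolding clusters_done_def by blast
  then show "M v = Suc (lab v)" "lab v < n" "lab (lab v) = lab v" "lay (lab v) = lay v"
    "(lab v, v) \<in> joined G (above (lay v))" "M (lab v) = Suc (lab v)" by (simp_all add: lab_def)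
qed

lemma ok_edge: "adjacent G u y \<Longrightarrow> ok M D u y"
  using clusters unfolding clusters_done_def by blast

text \<open>A reason for merging that is visible at one directed edge, so that a single pass over
  the edges detects it.\<close>

definition bad :: "nat \<Rightarrow> nat \<Rightarrow> bool" where
  "bad v y \<longleftrightarrow> lay y = lay v \<and> p y \<noteq> p v \<or> below v y \<and> (y \<noteq> p v \<or> y \<noteq> p (lab v) \<and> y \<noteq> D (lab v))"

definition flags :: "(nat \<times> nat) set \<Rightarrow> (nat \<Rightarrow> nat) \<Rightarrow> (nat \<Rightarrow> nat) \<Rightarrow> bool" where
  "flags Z F R \<longleftrightarrow> (\<forall>c. F c \<noteq> 0 \<longleftrightarrow> (\<exists>v y. (v, y) \<in> Z \<and> lab v = c \<and> bad v y)) \<and>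
     (\<forall>c v y. (v, y) \<in> Z \<longrightarrow> lab v = c \<longrightarrow> below v y \<longrightarrow> y \<noteq> p c \<longrightarrow>
        lab (R c) = c \<and> (\<exists>y. below (R c) y \<and> y \<noteq> p c))"

text \<open>Overwriting an entry of \<open>R\<close> is harmless, as any vertex of the cluster with
  a lower neighbour other than \<open>p c\<close> is admissible.\<close>

lemma flags_insert:
  assumes f: "flags Z F R"
    and F': "F' = (if bad v w then F(lab v := 1) else F)"
    and R': "R' = (if below v w \<and> w \<noteq> p (lab v) then R(lab v := v) else R)"
  shows "flags (insert (v, w) Z) F' R'"
proof -
  have 1: "F c \<noteq> 0 \<longleftrightarrow> (\<exists>v y. (v, y) \<in> Z \<and> lab v = c \<and> bad v y)" for c
    using f unfolding flags_def by blast
  have 2: "lab (R c) = c \<and> (\<exists>y. below (R c) y \<and> y \<noteq> p c)"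
    if "(v, y) \<in> Z" "lab v = c" "below v y" "y \<noteq> p c" for c v y
    using f that unfolding flags_def by blast
  have "F' c \<noteq> 0 \<longleftrightarrow> (\<exists>v' y. (v', y) \<in> insert (v, w) Z \<and> lab v' = c \<and> bad v' y)" for c
    using 1[of c] unfolding F' by (cases "bad v w"; cases "c = lab v") auto
  moreover have "lab (R' c) = c \<and> (\<exists>y. below (R' c) y \<and> y \<noteq> p c)"
    if z: "(v', y) \<in> insert (v, w) Z" "lab v' = c" "below v' y" "y \<noteq> p c" for c v' y
  proof (cases "below v w \<and> w \<noteq> p (lab v) \<and> c = lab v")
    case True
    then show ?thesis unfolding R' by auto
  next
    case False
    then have "(v', y) \<in> Z" using z by auto
    moreover have "R' c = R c" using False unfolding R' by auto
    ultimately show ?thesis using 2[of v' y c] z by simp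
  qed
  ultimately show ?thesis unfolding flags_def by blast
qed

definition base2 :: "(nat \<Rightarrow> nat \<Rightarrow> nat) \<Rightarrow> bool" where
  "base2 ar \<longleftrightarrow> inp ar \<and> ar 4 = L \<and> ar 5 = p \<and> ar 7 = M \<and> ar 9 = D"

lemma flag_body_step:
  assumes b: "base2 (arrs s)" and f: "flags Z (arrs s 11) (arrs s 10)"
    and r: "regs s 4 = v" "regs s 6 = w" and vw: "adjacent G v w" and s': "s' = effect flag_body s"
  shows "base2 (arrs s') \<and> flags (insert (v, w) Z) (arrs s' 11) (arrs s' 10) \<and> regs s' = regs s"
proof -
  have ar: "arrs s 4 = L" "arrs s 5 = p" "arrs s 7 = M" "arrs s 9 = D" using b by (simp_all add: base2_def)
  have n: "v < n" "w < n" using adjacent_less[OF vw] by auto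
  have L: "L v = Suc (lay v)" "L w = Suc (lay w)" using lay_eq n by auto
  have lb: "M v - Suc 0 = lab v" by (simp add: lab_def)
  let ?F = "if bad v w then (arrs s 11)(lab v := 1) else arrs s 11"
  let ?R = "if below v w \<and> w \<noteq> p (lab v) then (arrs s 10)(lab v := v) else arrs s 10"
  have "regs s' = regs s \<and> arrs s' = (arrs s)(11 := ?F, 10 := ?R)"
  proof (cases "lay w = lay v")
    case True
    then have "\<not> below v w" by (simp add: below_def)
    then show ?thesis using True s' ar r L lb by (auto simp: flag_body_def bad_def fun_eq_iff)
  next
    case ne: False
    show ?thesis
    proof (cases "lay w < lay v")
      case True
      then have "below v w" using lay_edge[OF vw] vw by (simp add: below_def)
      then show ?thesis using True s' ar r L lb ne by (auto simp: flag_body_def bad_def fun_eq_iff)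
    next
      case False
      then have "\<not> below v w" by (simp add: below_def)
      then show ?thesis using False ne s' ar r L lb by (auto simp: flag_body_def bad_def fun_eq_iff)
    qed
  qed
  then show ?thesis using b flags_insert[OF f refl refl] by (simp add: base2_def inp_def)
qed

text \<open>Once all edges have been seen, a flag is set exactly for the merged clusters. The
  remaining assumptions of the locale are read off from the edge condition
  \<open>ok\<close>.\<close>

lemma flags_clustering:
  assumes f: "flags {(v, w). adjacent G v w} F R"
  shows "clustering G lay p lab D R"
    and "v < n \<Longrightarrow> clustering.rho G lay p lab D R v = (if F (lab v) \<noteq> 0 \<or> p v = p (lab v) then lab v else R (lab v))"
proof -
  show c: "clustering G lay p lab D R"
  proof unfold_locales
    fix v assume "v \<in> verts G"
    then have v: "v < n" using verts_G by simp
    show "lab v \<in> verts G" "lab (lab v) = lab v" "lay (lab v) = lay v" "(lab v, v) \<in> joined G (above (lay v))"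
      using M_facts[OF v] verts_G by simp_all
  next
    fix u v assume uv: "adjacent G u v" "lay u = lay v"
    have "M v = M u" using ok_edge[OF uv(1)] uv(2) by (simp add: ok_def)
    then show "lab u = lab v" by (simp add: lab_def)
  next
    \<comment> \<open>Each lower neighbour of a cluster is compared with the recorded one, hence any
      two agree.\<close>
    have *: "lab u = lab (p (lab v))" if "below v u" for u v
    proof -
      have "adjacent G u v" using that adj_sym by (simp add: below_def)
      then have "M (p (M v - 1)) = M u" using ok_edge[of u v] that by (simp add: ok_def)
      then show ?thesis by (simp add: lab_def)
    qed
    fix v u v' u' assume "below v u" "below v' u'" "lab v = lab v'"
    then show "lab u = lab u'" using *[of v u] *[of v' u'] by simp
  next
    fix v u assume vu: "below v u"
    then have v: "v < n" "adjacent G v u" using below_verts verts_G by (auto simp: below_def)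
    have "lay (lab v) = Suc (lay u)" using M_facts(4)[OF v(1)] vu by (simp add: below_def)
    then have "lab v \<noteq> 0" by (rule lay_Suc_ne_0)
    then obtain w where "M w = Suc (lab v)" "below w (D (lab v))"
      using clusters M_facts(6)[OF v(1)] unfolding clusters_done_def by blast
    then show "\<exists>w. lab w = lab v \<and> below w (D (lab v))" by (intro exI[of _ w]) (simp add: lab_def)
    assume u: "u \<noteq> p (lab v)"
    then show "D (lab v) \<noteq> p (lab v)" using ok_edge[OF v(2)] vu by (simp add: ok_def lab_def)
    show "lab (R (lab v)) = lab v \<and> (\<exists>u'. below (R (lab v)) u' \<and> u' \<noteq> p (lab v))"
      using f v(2) vu u unfolding flags_def by blast
  qed
  have "clustering.merged G lay p lab D l \<longleftrightarrow> F l \<noteq> 0" for l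
  proof -
    have "F l \<noteq> 0 \<longleftrightarrow> (\<exists>v y. adjacent G v y \<and> lab v = l \<and> bad v y)"
      using f unfolding flags_def by simp
    then show ?thesis unfolding clustering.merged_def[OF c] bad_def below_def by blast
  qed
  then show "clustering.rho G lay p lab D R v = (if F (lab v) \<noteq> 0 \<or> p v = p (lab v) then lab v else R (lab v))"
    unfolding clustering.rho_def[OF c] by simp
qed

lemma wp_rho_prog:
  assumes s: "base2 (arrs s)" "arrs s 11 = F" "arrs s 10 = R" "regs s 0 = n"
    and m: "n * (cost rho_body + 1) + 2 + r \<le> m"
    and Q: "\<And>s m. inp (arrs s) \<Longrightarrow> arrs s 4 = L \<Longrightarrow> regs s 0 = n \<Longrightarrow>
      (\<And>v. v < n \<Longrightarrow> arrs s 12 v = (if F (lab v) \<noteq> 0 \<or> p v = p (lab v) then lab v else R (lab v))) \<Longrightarrow> r \<le> m \<Longrightarrow> Q s m"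
  shows "wp rho_prog Q s m"
  unfolding rho_prog_def
proof (rule wp_Seq, rule wp_straight)
  let ?rho = "\<lambda>v. if F (lab v) \<noteq> 0 \<or> p v = p (lab v) then lab v else R (lab v)"
  define I where "I s m \<longleftrightarrow> (\<exists>k\<le>n. regs s 2 = k \<and> regs s 0 = n \<and> base2 (arrs s) \<and> arrs s 11 = F \<and> arrs s 10 = R \<and>
     (\<forall>v<k. arrs s 12 v = ?rho v) \<and> (n - k) * (cost rho_body + 1) + 1 + r \<le> m)" for s :: ram_state and m
  fix m' assume m': "m \<le> m' + cost (Assign 2 (Const 0))"
  have I0: "I (effect (Assign 2 (Const 0)) s) m'"
    unfolding I_def using s m m' by (intro exI[of _ 0]) simp
  show "wp (While (Less (Reg 2) (Reg 0)) rho_body) Q (effect (Assign 2 (Const 0)) s) m'"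
  proof (rule wp_While[of I])
    show "I (effect (Assign 2 (Const 0)) s) m'" by (rule I0)
    show "1 \<le> m" if "I s m" for s m using that by (auto simp: I_def)
    show "Q s (m - 1)" if "I s m" "\<not> bval (Less (Reg 2) (Reg 0)) s" for s m
      using that by (intro Q) (auto simp: I_def base2_def)
    show "wp rho_body I s (m - 1)" if Is: "I s m" and b: "bval (Less (Reg 2) (Reg 0)) s" for s m
    proof (rule wp_straight)
      obtain k where k: "regs s 2 = k" "k < n" "regs s 0 = n" "base2 (arrs s)" "arrs s 11 = F" "arrs s 10 = R"
        "\<And>v. v < k \<Longrightarrow> arrs s 12 v = ?rho v" "(n - k) * (cost rho_body + 1) + 1 + r \<le> m"
        using Is b by (auto simp: I_def)
      obtain d where d: "n = Suc (k + d)" using k(2) less_imp_Suc_add by blast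
      have dm: "d * (cost rho_body + 1) + cost rho_body + 2 + r \<le> m" using k(8) d by (simp add: algebra_simps)
      show "straight rho_body" by (simp add: rho_body_def)
      show "cost rho_body \<le> m - 1" using dm by simp
      fix m2 assume m2: "m - 1 \<le> m2 + cost rho_body"
      have ar: "arrs s 5 = p" "arrs s 7 = M" using k(4) by (simp_all add: base2_def)
      have lb: "M k - Suc 0 = lab k" by (simp add: lab_def)
      have e: "effect rho_body s = s\<lparr>regs := (regs s)(2 := Suc k), arrs := (arrs s)(12 := (arrs s 12)(k := ?rho k))\<rparr>"
        using k(1,5,6) ar lb by (auto simp: rho_body_def)
      show "I (effect rho_body s) m2"
        unfolding I_def e using k dm m2 d
        by (intro exI[of _ "Suc k"]) (auto simp: base2_def inp_def less_Suc_eq)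
    qed
  qed
qed (use m in auto)

end

section \<open>The emitted edge list\<close>

lemma doubleton_list_Suc:
  "{{f' i, g' i} | i::nat. i < Suc k} = insert {f' k, g' k} {{f' i, g' i} | i. i < k}"
  by (auto simp: less_Suc_eq)

definition emitted :: "(nat \<Rightarrow> nat) \<Rightarrow> (nat \<Rightarrow> nat) \<Rightarrow> nat \<Rightarrow> nat set set" where
  "emitted f g k = {{f i, g i} | i. i < k}"

lemma emitted_upd: "emitted (f(k := x)) (g(k := y)) (Suc k) = insert {x, y} (emitted f g k)"
  unfolding emitted_def doubleton_list_Suc by auto

context bfs_input
begin

definition out_edges :: "(nat \<Rightarrow> nat) \<Rightarrow> (nat \<times> nat) set \<Rightarrow> nat set set" where
  "out_edges R Z = {{x, R u} | x v u. (v, u) \<in> Z \<and> below v u \<and> (x = v \<or> x = R v)}"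

lemma out_edges_insert:
  "out_edges R (insert (v, u) Z) = (if below v u then {{v, R u}, {R v, R u}} else {}) \<union> out_edges R Z"
  unfolding out_edges_def by auto

lemma out_edges_cong:
  assumes "\<And>v. v < n \<Longrightarrow> R v = R' v"
  shows "out_edges R {(v, u). adjacent G v u} = out_edges R' {(v, u). adjacent G v u}"
proof -
  have *: "out_edges R {(v, u). adjacent G v u} \<subseteq> out_edges R' {(v, u). adjacent G v u}"
    if eq: "\<And>v. v < n \<Longrightarrow> R v = R' v" for R R'
  proof
    fix e assume "e \<in> out_edges R {(v, u). adjacent G v u}"
    then obtain x v u where e: "e = {x, R u}" "adjacent G v u" "below v u" "x = v \<or> x = R v"
      by (auto simp: out_edges_def)
    moreover have "R u = R' u" "R v = R' v" using eq adjacent_less[OF e(2)] by simp_all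
    ultimately show "e \<in> out_edges R' {(v, u). adjacent G v u}"
      unfolding out_edges_def mem_Collect_eq
      by - (rule exI[of _ x], rule exI[of _ v], rule exI[of _ u], simp)
  qed
  show ?thesis using *[of R R'] *[of R' R] assms by auto
qed

lemma wp_out:
  assumes s: "inp (arrs s)" "arrs s 4 = L" "arrs s 12 = R" "regs s 0 = n" "regs s 1 = 0"
    and m: "off n * (cost out_body + 3) + n * 5 + 2 + r \<le> m"
    and Q: "\<And>s m. regs s 0 = n \<Longrightarrow> emitted (arrs s 2) (arrs s 3) (regs s 1) = out_edges R {(v, u). adjacent G v u} \<Longrightarrow>
      r \<le> m \<Longrightarrow> Q s m"
  shows "wp (for_edges out_body) Q s m"
proof (rule wp_for_edges[where J = "\<lambda>Z ar k. inp ar \<and> ar 4 = L \<and> ar 12 = R \<and> emitted (ar 2) (ar 3) k = out_edges R Z", OF _ _ _ _ _ m])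
  show "straight out_body" by (simp add: out_body_def emit_def)
  show "inp (arrs s) \<and> arrs s 4 = L \<and> arrs s 12 = R \<and> emitted (arrs s 2) (arrs s 3) (regs s 1) = out_edges R {}"
    using s by (simp add: emitted_def out_edges_def)
  fix Z and s :: ram_state and v w
  assume J: "inp (arrs s) \<and> arrs s 4 = L \<and> arrs s 12 = R \<and> emitted (arrs s 2) (arrs s 3) (regs s 1) = out_edges R Z"
    and r: "regs s 4 = v" "regs s 6 = w" and vw: "adjacent G v w"
  let ?s = "effect out_body s"
  have L: "L v = Suc (lay v)" "L w = Suc (lay w)" using lay_eq adjacent_less[OF vw] by auto
  show "(inp (arrs ?s) \<and> arrs ?s 4 = L \<and> arrs ?s 12 = R \<and> emitted (arrs ?s 2) (arrs ?s 3) (regs ?s 1) = out_edges R (insert (v, w) Z)) \<and>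
      (\<forall>x\<in>{0, 2, 4, 5}. regs ?s x = regs s x)"
  proof (cases "lay w < lay v")
    case True
    then have "below v w" using lay_edge[OF vw] vw by (simp add: below_def)
    \<comment> \<open>Two entries are written. They coincide if \<open>v\<close> is a
      representative; repetitions disappear in the set of edges.\<close>
    then show ?thesis using True J r L
      by (auto simp: out_body_def emit_def inp_def out_edges_insert emitted_upd)
  next
    case False
    then have "\<not> below v w" by (simp add: below_def)
    then show ?thesis using False J r L by (simp add: out_body_def out_edges_insert)
  qed
qed (use s Q in auto)

end

section \<open>Composition of the phases and total running time\<close>

context ram_input
begin

lemma sum_deg: "k \<le> n \<Longrightarrow> (\<Sum>v<k. length (adj ! v) * a + 5) = off k * a + 5 * k"
  by (induction k) (simp_all add: off_0 off_Suc algebra_simps)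

text \<open>Every adjacency entry is treated in four loops. Per vertex there are 5 steps for the
  breadth-first search, 10 + 5 for the clusters, 5 for the flags, 1 beside \<open>rho_body\<close>
  and 5 for the output, which makes 31. The constant parts 3 + 3 + 2 + 2 + 1 + 2 make 13.\<close>

definition total :: nat where
  "total = off n * ((cost bfs_body + 3) + (cost search_body + 3) + (cost flag_body + 3) + (cost out_body + 3))
     + n * (cost rho_body + 31) + 13"

lemma main_prog_correct:
  "wp main_prog (\<lambda>s m. regs s 0 = n \<and> (\<exists>lay par lab two rp. clustering G lay par lab two rp \<and>
      output_graph s = clustering.contraction G lay par lab two rp)) (input_state adj) total"
  (is "wp _ ?Q _ _")
proof -
  \<comment> \<open>\<open>?r5\<close> to \<open>?r2\<close> are the steps that must be left for the
    phases still to come, from the last phase backwards.\<close>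
  let ?r5 = "off n * (cost out_body + 3) + n * 5 + 2 + 0"
  let ?r4 = "n * (cost rho_body + 1) + 2 + (1 + ?r5)"
  let ?r3 = "off n * (cost flag_body + 3) + n * 5 + 2 + ?r4"
  let ?r2 = "n * 10 + (off n * (cost search_body + 3) + 5 * n) + 3 + ?r3"
  have inp: "inp (arrs (input_state adj))"
    unfolding inp_def input_state_def by (auto simp: array_of_def off_def n_def simp del: upt_Suc)
  then have inp0: "inp0 (arrs (input_state adj))"
    by (simp add: inp0_def input_state_def)
  show ?thesis
    unfolding main_prog_def
  proof (rule wp_Seq, rule wp_bfs_prog[where r = "?r2"])
    show "inp0 (arrs (input_state adj))" by (rule inp0)
    show "regs (input_state adj) 0 = n" "regs (input_state adj) 2 = 0" "arrs (input_state adj) 4 = (\<lambda>_. 0)"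
      "arrs (input_state adj) 6 = (\<lambda>_. 0)" by (simp_all add: input_state_def n_def)
    show "(\<Sum>v<n. length (adj ! v) * (cost bfs_body + 3) + 5) + 3 + ?r2 \<le> total"
      unfolding sum_deg[OF order_refl] total_def by (simp add: algebra_simps)
    fix s1 :: ram_state and m1
    assume s1: "inp0 (arrs s1)" "regs s1 0 = n" "regs s1 2 = n" "bfs_done (arrs s1 4) (arrs s1 5) (arrs s1 6)"
      and m1: "?r2 \<le> m1"
    \<comment> \<open>The locales are instantiated with the arrays that the preceding phase has
      computed.\<close>
    interpret B: bfs_input G adj "arrs s1 4" "arrs s1 5" "arrs s1 6" by unfold_locales (rule s1(4))
    show "wp (Seq cluster_prog (Seq (for_edges flag_body) (Seq rho_prog (Seq (Assign 1 (Const 0)) (for_edges out_body))))) ?Q s1 m1"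
    proof (rule wp_Seq, rule B.wp_cluster_prog[where r = "?r3"])
      show "B.base s1" "arrs s1 7 = (\<lambda>_. 0)" using s1 by (simp_all add: B.base_def inp0_def)
      show "regs s1 2 = n" by (rule s1(3))
      show "n * 10 + (\<Sum>v<n. length (adj ! v) * (cost search_body + 3) + 5) + 3 + ?r3 \<le> m1"
        unfolding sum_deg[OF order_refl] by (rule m1)
      fix s2 :: ram_state and m2
      assume s2: "B.base s2" "B.clusters_done (arrs s2 7) (arrs s2 9)" and m2: "?r3 \<le> m2"
      interpret C: cluster_input G adj "arrs s1 4" "arrs s1 5" "arrs s1 6" "arrs s2 7" "arrs s2 9"
        by unfold_locales (rule s2(2))
      show "wp (Seq (for_edges flag_body) (Seq rho_prog (Seq (Assign 1 (Const 0)) (for_edges out_body)))) ?Q s2 m2"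
      proof (rule wp_Seq, rule wp_for_edges[where J = "\<lambda>Z ar k. C.base2 ar \<and> C.flags Z (ar 11) (ar 10)" and r = "?r4", OF _ _ _ _ _ m2])
        show "straight flag_body" by (simp add: flag_body_def)
        show "C.base2 (arrs s2) \<and> C.flags {} (arrs s2 11) (arrs s2 10)"
          using s2(1) by (simp add: C.base2_def C.flags_def B.base_def)
        show "regs s2 0 = n" using s2(1) by (simp add: B.base_def)
        show "inp ar" if "C.base2 ar \<and> C.flags Z (ar 11) (ar 10)" for Z ar using that by (simp add: C.base2_def)
        show "(C.base2 (arrs (effect flag_body s)) \<and>
            C.flags (insert (v, w) Z) (arrs (effect flag_body s) 11) (arrs (effect flag_body s) 10)) \<and>
            (\<forall>x\<in>{0, 2, 4, 5}. regs (effect flag_body s) x = regs s x)"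
          if "C.base2 (arrs s) \<and> C.flags Z (arrs s 11) (arrs s 10)" "regs s 4 = v" "regs s 6 = w" "adjacent G v w" for Z s v w
          using C.flag_body_step[OF conjunct1[OF that(1)] conjunct2[OF that(1)] that(2-4) refl] by simp
        fix s3 :: ram_state and m3
        assume s3: "C.base2 (arrs s3) \<and> C.flags {(v, w). adjacent G v w} (arrs s3 11) (arrs s3 10)" "regs s3 0 = n"
          and m3: "?r4 \<le> m3"
        note cl = C.flags_clustering[OF conjunct2[OF s3(1)]]
        let ?R = "clustering.rho G B.lay (arrs s1 5) C.lab (arrs s2 9) (arrs s3 10)"
        show "wp (Seq rho_prog (Seq (Assign 1 (Const 0)) (for_edges out_body))) ?Q s3 m3"
        proof (rule wp_Seq, rule C.wp_rho_prog[OF conjunct1[OF s3(1)] refl refl s3(2) m3])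
          fix s4 :: ram_state and m4
          assume s4: "inp (arrs s4)" "arrs s4 4 = arrs s1 4" "regs s4 0 = n"
            "\<And>v. v < n \<Longrightarrow> arrs s4 12 v = (if arrs s3 11 (C.lab v) \<noteq> 0 \<or> arrs s1 5 v = arrs s1 5 (C.lab v) then C.lab v else arrs s3 10 (C.lab v))"
            and m4: "1 + ?r5 \<le> m4"
          have R: "arrs s4 12 v = ?R v" if "v < n" for v using s4(4)[OF that] cl(2)[OF that] by simp
          show "wp (Seq (Assign 1 (Const 0)) (for_edges out_body)) ?Q s4 m4"
          proof (rule wp_Seq, rule wp_straight)
            fix m5 assume "m4 \<le> m5 + cost (Assign 1 (Const 0))"
            then have m5: "?r5 \<le> m5" using m4 by simp
            show "wp (for_edges out_body) ?Q (effect (Assign 1 (Const 0)) s4) m5"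
            proof (rule B.wp_out[where R = "arrs s4 12", OF _ _ _ _ _ m5])
              fix s5 :: ram_state and m6
              assume s5: "regs s5 0 = n" "emitted (arrs s5 2) (arrs s5 3) (regs s5 1) = B.out_edges (arrs s4 12) {(v, u). adjacent G v u}"
              have "B.out_edges (arrs s4 12) {(v, u). adjacent G v u} = B.out_edges ?R {(v, u). adjacent G v u}"
                by (rule B.out_edges_cong) (rule R)
              also have "\<dots> = {{x, ?R u} | x v u. B.below v u \<and> (x = v \<or> x = ?R v)}"
                unfolding B.out_edges_def B.below_def by blast
              finally have "output_graph s5 = clustering.contraction G B.lay (arrs s1 5) C.lab (arrs s2 9) (arrs s3 10)"
                unfolding output_graph_def clustering.contraction_def[OF cl(1)]
                using s5 verts_G by (simp add: emitted_def)
              then show "?Q s5 m6" using s5(1) cl(1) by blast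
            qed (use s4 in \<open>simp_all add: inp_def\<close>)
          qed (use m4 in auto)
        qed
      qed
    qed
  qed
qed

end

theorem mainTheorem3:
  "\<exists>(c :: nat) (P :: com) (K :: nat).
     \<forall>(G :: nat ugraph) adj.
       simple_graph G \<and> connected_graph G \<and> universally_signable G \<and> adjacency_lists G adj \<longrightarrow>
       (\<exists>t s. exec P (input_state adj) t s \<and>
          t \<le> K * (card (verts G) + card (edges G)) \<and>
          (let H = output_graph s in
             simple_graph H \<and>
             verts H = verts G \<and>
             tree_width H \<le> 2 \<and>
             (\<forall>u\<in>verts G. \<forall>v\<in>verts G.
                graph_dist G u v \<le> graph_dist H u v + enat c \<and>
                graph_dist H u v \<le> graph_dist G u v + enat c)))"
proof (rule exI[of _ 50], rule exI[of _ main_prog],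
    rule exI[of _ "2 * ((cost bfs_body + 3) + (cost search_body + 3) + (cost flag_body + 3) + (cost out_body + 3)) + cost rho_body + 44"],
    intro allI impI)
  fix G :: "nat ugraph" and adj
  assume a: "simple_graph G \<and> connected_graph G \<and> universally_signable G \<and> adjacency_lists G adj"
  let ?c = "(cost bfs_body + 3) + (cost search_body + 3) + (cost flag_body + 3) + (cost out_body + 3)"
  interpret ram_input G adj by unfold_locales (use a in simp_all)
  obtain t s lay par lab two rp where e: "exec main_prog (input_state adj) t s" "t \<le> total"
    and c: "clustering G lay par lab two rp" and o: "output_graph s = clustering.contraction G lay par lab two rp"
    using main_prog_correct unfolding wp_def by blast
  \<comment> \<open>A connected graph has a vertex, so 13 is absorbed into \<open>n * 13\<close>;
    together with 31 this gives 44. The factor 2 comes from counting adjacency entries by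
    edges.\<close>
  have "total \<le> (2 * card (edges G)) * ?c + n * (cost rho_body + 31) + n * 13"
    unfolding total_def using n_pos by (intro add_le_mono mult_le_mono off_n) auto
  also have "\<dots> = card (edges G) * (2 * ?c) + n * (cost rho_body + 44)"
    by (simp add: add_mult_distrib2)
  also have "\<dots> \<le> card (edges G) * (2 * ?c + cost rho_body + 44) + n * (2 * ?c + cost rho_body + 44)"
    by (intro add_le_mono mult_le_mono2) simp_all
  also have "\<dots> = (2 * ?c + cost rho_body + 44) * (n + card (edges G))"
    by (simp only: mult.commute[of _ "2 * ?c + cost rho_body + 44"] add_mult_distrib2[symmetric] add.commute[of _ n])
  finally have "t \<le> (2 * ?c + cost rho_body + 44) * (n + card (edges G))"
    using e(2) by (rule le_trans[rotated])
  moreover have "card (verts G) = n" using verts_G by simp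
  ultimately have t: "t \<le> (2 * ?c + cost rho_body + 44) * (card (verts G) + card (edges G))"
    by (simp only:)
  have V: "verts (output_graph s) = verts G" unfolding o by (simp add: clustering.contraction_def[OF c])
  have "simple_graph (output_graph s)" "tree_width (output_graph s) \<le> 2"
    unfolding o by (rule clustering.simple_contraction[OF c] clustering.tree_width_contraction[OF c])+
  moreover have "\<forall>u\<in>verts G. \<forall>v\<in>verts G.
      graph_dist G u v \<le> graph_dist (output_graph s) u v + enat 50 \<and>
      graph_dist (output_graph s) u v \<le> graph_dist G u v + enat 50"
    unfolding o by (intro ballI conjI; rule clustering.contraction_dist[OF c]; assumption)
  ultimately show "\<exists>t s. exec main_prog (input_state adj) t s \<and>
          t \<le> (2 * ?c + cost rho_body + 44) * (card (verts G) + card (edges G)) \<and>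
          (let H = output_graph s in simple_graph H \<and> verts H = verts G \<and> tree_width H \<le> 2 \<and>
             (\<forall>u\<in>verts G. \<forall>v\<in>verts G. graph_dist G u v \<le> graph_dist H u v + enat 50 \<and>
                graph_dist H u v \<le> graph_dist G u v + enat 50))"
    unfolding Let_def using e(1) t V by (intro exI conjI)
qed

end
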